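(* Let $I=I_H\subset R=k[x_1,\dots,x_n]$ be the monomial edge ideal associated to a cointerval $d$-graph $H$ on vertex set $[n]$, and let $\mathcal{F}$ be the graded minimal free resolution of $R/I$ obtained from the homomorphism complex $X_H$. Then $\mathcal{F}$ is realized as an iterated mapping cone (with respect to the lexicographic ordering of the generators of $I$), where for each $i\ge 1$ the basis of the module $F_i$ is given by the symbols $(m;\alpha)$ with $m\in G(I)$, $\alpha\subset\mathrm{set}(m)$, $|\alpha|=i-1$. The chain map $d$ of $\mathcal{F}$ is given by \[ d(m;\alpha)=\sum_{j_i\in\alpha}(-1)^{i}x_{j_i}\,(m;\alpha\setminus j_i)+\sum_{j_i\in T(\alpha)}(-1)^{i-1}\frac{x_{j_i}m}{c(x_{j_i}m)}\,(c(x_{j_i}m);\alpha\setminus j_i) \] if $\alpha\neq\emptyset$, where $\alpha=\{j_1,\dots,j_p\}\subset\mathrm{set}(m)$ with $j_1<\cdots<j_p$, and $d(m;\emptyset)=m$ otherwise.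
   Context: $k$ is a field and $R=k[x_1,\dots,x_n]$ with its $\mathbb{Z}^n$-grading. Hypergraphs: a $d$-graph $H$ on $V(H)$ is a collection $E(H)$ of $d$-element subsets (edges) of $V(H)$. Its edge ideal $I_H$ is generated by the monomials $x_{i_1}\cdots x_{i_d}$ with $\{i_1,\dots,i_d\}\in E(H)$. For $v\in V(H)\subseteq\mathbb{Z}$, the $v$-layer of $H$ is the $(d-1)$-graph on $V(H)\setminus v$ with edge set $\{v_1\cdots v_{d-1} : vv_1\cdots v_{d-1}\in E(H),\ v<v_1,\dots,v_{d-1}\}$. Any $1$-graph is cointerval. For $d>1$, a finite $d$-graph $H$ with $V(H)\subseteq\mathbb{Z}$ is cointerval if (1) for every $i\in V(H)$ the $i$-layer is cointerval, and (2) for every pair $i<j$ of vertices the $j$-layer is a subgraph of the $i$-layer (every edge of the $j$-layer is an edge of the $i$-layer). For cointerval $H$, $I_H$ is known to have linear quotients with respect to the lexicographic order on its generators. Homomorphism complex: write $\sigma<\tau$ for subsets of $[n]$ if $x<y$ for all $x\in\sigma$, $y\in\tau$. $X_H$ is the subcomplex of the product $\prod_{i=1}^d\Delta_{V(H)}$ of simplices on the vertex set $V(H)$ whose vertices are $v_{i_1}\times\cdots\times v_{i_d}$ with $v_{i_1}\cdots v_{i_d}$ an edge of $H$, and whose cells are the products $\sigma_1\times\cdots\times\sigma_d$ of nonempty sets with $\sigma_1<\cdots<\sigma_d$ all of whose vertices are vertices of $X_H$. The cell is labeled by $\prod_{i}\prod_{j\in\sigma_i}x_j$. It is known that $X_H$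 supports a minimal cellular resolution of $I_H$: cells of dimension $i-1$ form a basis of $F_i$ (with $F_0=R$), and the coefficient of a cell $c'$ in the differential of a cell $c$ is the incidence number times the quotient of the label of $c$ by the label of $c'$. The orientations of the cells, i.e. the signs of the basis elements, are a matter of choice. Symbols: $G(I)=(m_1,\dots,m_k)$ denotes the generators of $I$ in lexicographic order, $I_j=\langle m_1,\dots,m_j\rangle$, and $\mathrm{set}(m_j)=\{i\in[n] : x_i\in I_{j-1}:m_j\}$. For $m=x_{i_1}\cdots x_{i_d}\in G(I)$ with $i_1<\cdots<i_d$ (and $i_0=0$), the symbol $(m;\alpha)$ with $\alpha\subset\mathrm{set}(m)$ corresponds to the cell $\sigma_1\times\cdots\times\sigma_d$, where $\sigma_\ell=\{i_\ell\}\cup\{j\in\alpha : i_{\ell-1}<j<i_\ell\}$. The function $c$: for $m=x_{i_1}\cdots x_{i_d}\in G(I)$ with $i_1<\dots<i_d$ and $j\in\mathrm{set}(m)$, let $i_k$ be minimal with $i_{k-1}<j\le i_k$ and put $c(x_jm)=x_jm/x_{i_k}$ (an element of $G(I)$). The set $T(\alpha)$: decompose $\mathrm{set}(m)=A_1\cup\cdots\cup A_d$ with $A_\ell=\{j\in[n] : i_{\ell-1}<j<i_\ell,\ x_{i_1}\cdots x_{i_{\ell-1}}x_jx_{i_{\ell+1}}\cdots x_{i_d}\in I\}$. For $\alpha\subset\mathrm{set}(m)$, let $s_\ell$ be the maximum element of $\alpha\cap A_\ell$ (for those $\ell$ with $\alpha\cap A_\ell\ne\emptyset$), and let $T(\alpha)$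 be the set of these $s_\ell$. Iterated mapping cone: for each $j$ there is an exact sequence $0\to R/(I_{j-1}:m_j)\to R/I_{j-1}\to R/I_j\to0$, the first map being multiplication by $m_j$ (with degree shift). Given the resolution $F$ of $R/I_{j-1}$ already constructed and the Koszul complex $G$ resolving $R/(I_{j-1}:m_j)$, one chooses a homomorphism of complexes $\psi:G\to F$ lifting the first map. The mapping cone $C(\psi)=G[1]\oplus F$, with differential $d(g,f)=(-d_G(g),\psi(g)+d_F(f))$, resolves $R/I_j$. Iterate over $j$. The assertion is for a suitable choice of the lifts $\psi$. *)

theory Defs
  imports Complex_Main "HOL-Library.Poly_Mapping" "HOL-Library.List_Lexorder"
begin

section \<open>Monomials, polynomials and ideals\<close>

text \<open>
  The index set \<open>[n]\<close> is a finite linearly ordered type \<open>'n\<close>.  A monomial is identified with its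
  exponent vector, so products of monomials are sums of exponent vectors, and the polynomial ring
  \<open>R = k[x\<^sub>1, \<dots>, x\<^sub>n]\<close> is the monoid algebra of the exponent vectors.
\<close>

type_synonym 'n monom = "'n \<Rightarrow>\<^sub>0 nat"
type_synonym ('n, 'k) mpoly = "'n monom \<Rightarrow>\<^sub>0 'k"

definition monomial :: "'n monom \<Rightarrow> ('n, 'k::field) mpoly" where
  "monomial t = Poly_Mapping.single t 1"

definition var :: "'n \<Rightarrow> ('n, 'k::field) mpoly" where
  "var i = monomial (Poly_Mapping.single i 1)"

text \<open>The squarefree monomial \<open>\<Prod>i\<in>S. x\<^sub>i\<close>.\<close>

definition mon :: "'n set \<Rightarrow> 'n monom" where
  "mon S = (\<Sum>i\<in>S. Poly_Mapping.single i 1)"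

definition ideal_gen :: "'r::comm_ring_1 set \<Rightarrow> 'r set" where
  "ideal_gen S = module.span (*) S"

definition colon :: "'r::comm_ring_1 set \<Rightarrow> 'r \<Rightarrow> 'r set" where
  "colon J p = {q. q * p \<in> J}"


section \<open>Cointerval hypergraphs\<close>

record 'v hypergraph =
  verts :: "'v set"
  edges :: "'v set set"

definition d_graph :: "nat \<Rightarrow> 'v hypergraph \<Rightarrow> bool" where
  "d_graph d H \<longleftrightarrow> finite (verts H) \<and> (\<forall>e\<in>edges H. e \<subseteq> verts H \<and> card e = d)"

text \<open>
  All edges of the \<open>v\<close>-layer lie above \<open>v\<close>, and so does the vertex set of the layer used here.  If
  the vertices below \<open>v\<close> were kept (as isolated vertices of the layer), then condition (2) below,
  applied to the layer and vertices \<open>i < v < j\<close>, would force the \<open>j\<close>-layer of the \<open>v\<close>-layer to be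
  empty, and for \<open>d \<ge> 3\<close> not even complete \<open>d\<close>-graphs would be cointerval.  The variant with vertex
  set \<open>verts H - {v}\<close> is more restrictive, see \<open>cointerval_if_cointerval_full\<close> below.
\<close>

definition layer :: "'v::linorder \<Rightarrow> 'v hypergraph \<Rightarrow> 'v hypergraph" where
  "layer v H = \<lparr>verts = {w \<in> verts H. v < w},
                edges = {e. insert v e \<in> edges H \<and> (\<forall>w\<in>e. v < w)}\<rparr>"

fun cointerval :: "nat \<Rightarrow> 'v::linorder hypergraph \<Rightarrow> bool" where
  "cointerval 0 H \<longleftrightarrow> False"
| "cointerval (Suc 0) H \<longleftrightarrow> True"
| "cointerval (Suc (Suc d)) H \<longleftrightarrow>
     (\<forall>i\<in>verts H. cointerval (Suc d) (layer i H)) \<and>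
     (\<forall>i\<in>verts H. \<forall>j\<in>verts H. i < j \<longrightarrow> edges (layer j H) \<subseteq> edges (layer i H))"

definition layer_full :: "'v::linorder \<Rightarrow> 'v hypergraph \<Rightarrow> 'v hypergraph" where
  "layer_full v H = (layer v H)\<lparr>verts := verts H - {v}\<rparr>"

fun cointerval_full :: "nat \<Rightarrow> 'v::linorder hypergraph \<Rightarrow> bool" where
  "cointerval_full 0 H \<longleftrightarrow> False"
| "cointerval_full (Suc 0) H \<longleftrightarrow> True"
| "cointerval_full (Suc (Suc d)) H \<longleftrightarrow>
     (\<forall>i\<in>verts H. cointerval_full (Suc d) (layer_full i H)) \<and>
     (\<forall>i\<in>verts H. \<forall>j\<in>verts H. i < j \<longrightarrow> edges (layer_full j H) \<subseteq> edges (layer_full i H))"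

lemma cointerval_if_cointerval_full_aux:
  "cointerval_full d H \<Longrightarrow> verts H' \<subseteq> verts H \<Longrightarrow> edges H' = edges H \<Longrightarrow> cointerval d H'"
proof (induction d H arbitrary: H' rule: cointerval_full.induct)
  case (3 d H)
  have e: "edges (layer i H') = edges (layer_full i H)" for i
    using "3.prems" by (simp add: layer_def layer_full_def)
  have "cointerval (Suc d) (layer i H')" if "i \<in> verts H'" for i
  proof (rule "3.IH")
    show "i \<in> verts H" using that "3.prems" by auto
    then show "cointerval_full (Suc d) (layer_full i H)" using "3.prems" by simp
    show "verts (layer i H') \<subseteq> verts (layer_full i H)"
      using "3.prems" by (auto simp: layer_def layer_full_def)
    show "edges (layer i H') = edges (layer_full i H)" by (rule e)
  qed
  moreover have "edges (layer j H') \<subseteq> edges (layer i H')"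
    if "i \<in> verts H'" "j \<in> verts H'" "i < j" for i j
    unfolding e using that "3.prems"(1,2) by (simp add: subsetD)
  ultimately show ?case by simp
qed auto

lemma cointerval_if_cointerval_full: "cointerval_full d H \<Longrightarrow> cointerval d H"
  by (rule cointerval_if_cointerval_full_aux) auto

definition edge_ideal :: "'n::finite hypergraph \<Rightarrow> ('n, 'k::field) mpoly set" where
  "edge_ideal H = ideal_gen ((\<lambda>e. monomial (mon e)) ` edges H)"


section \<open>Linear quotients\<close>

text \<open>
  A squarefree monomial generator is represented by its support.  The lexicographic order is that
  of the increasing tuples \<open>(i\<^sub>1, \<dots>, i\<^sub>d)\<close>, i.e. the monomial order with \<open>x\<^sub>1 > \<dots> > x\<^sub>n\<close> and the
  largest monomial first.
\<close>

definition gens :: "'n::{finite,linorder} hypergraph \<Rightarrow> 'n set list" where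
  "gens H = map set (sorted_list_of_set (sorted_list_of_set ` edges H))"

text \<open>
  Lists are indexed from 0: the generators \<open>m\<^sub>1, \<dots>, m\<^sub>k\<close> are \<open>ms ! 0, \<dots>, ms ! (k-1)\<close>, and
  \<open>ideal_upto ms j\<close> is \<open>I\<^sub>j\<close>, so that the ideal belonging to the generator \<open>ms ! j\<close> in the
  definition of \<open>set(ms ! j)\<close> is \<open>ideal_upto ms j\<close>.
\<close>

definition ideal_upto :: "'n set list \<Rightarrow> nat \<Rightarrow> ('n, 'k::field) mpoly set" where
  "ideal_upto ms j = ideal_gen ((\<lambda>m. monomial (mon m)) ` set (take j ms))"

definition lin_set :: "('n, 'k::field) mpoly set \<Rightarrow> 'n set \<Rightarrow> 'n set" where
  "lin_set J m = {i. var i \<in> colon J (monomial (mon m))}"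

text \<open>The element \<open>j\<^sub>i\<close> of \<open>\<alpha> = {j\<^sub>1 < \<dots> < j\<^sub>p}\<close>, for \<open>1 \<le> i \<le> p\<close>.\<close>

definition elt :: "'n::linorder set \<Rightarrow> nat \<Rightarrow> 'n" where
  "elt S i = sorted_list_of_set S ! (i - 1)"

text \<open>The open interval from \<open>i\<^sub>l\<^sub>-\<^sub>1\<close> to \<open>i\<^sub>l\<close> for \<open>m = {i\<^sub>1 < \<dots> < i\<^sub>d}\<close>, with \<open>i\<^sub>0\<close> below all elements.\<close>

definition gap :: "'n::linorder set \<Rightarrow> nat \<Rightarrow> 'n set" where
  "gap m l = {j. (l = 1 \<or> elt m (l - 1) < j) \<and> j < elt m l}"

text \<open>
  The index \<open>i\<^sub>k\<close> minimal with \<open>i\<^sub>k\<^sub>-\<^sub>1 < j \<le> i\<^sub>k\<close> is the least element of \<open>m\<close> that is at least \<open>j\<close>.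
\<close>

definition cfun :: "'n::linorder \<Rightarrow> 'n set \<Rightarrow> 'n set" where
  "cfun j m = insert j (m - {Min {i \<in> m. j \<le> i}})"

definition Aset :: "('n::linorder, 'k::field) mpoly set \<Rightarrow> 'n set \<Rightarrow> nat \<Rightarrow> 'n set" where
  "Aset I m l = {j \<in> gap m l. monomial (mon (insert j (m - {elt m l}))) \<in> I}"

definition Tset :: "('n::linorder, 'k::field) mpoly set \<Rightarrow> 'n set \<Rightarrow> 'n set \<Rightarrow> 'n set" where
  "Tset I m \<alpha> = {Max (\<alpha> \<inter> Aset I m l) | l. 1 \<le> l \<and> l \<le> card m \<and> \<alpha> \<inter> Aset I m l \<noteq> {}}"


section \<open>Complexes of multigraded based free modules\<close>

text \<open>
  The free \<open>R\<close>-module on \<open>B\<close> is \<open>free B\<close>, the finitely supported functions on \<open>B\<close>; the basis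
  element \<open>b\<close> is \<open>Poly_Mapping.single b 1\<close>.  A linear map is given by its values on basis elements;
  \<open>lin\<close> is the linear extension.
\<close>

definition free :: "'b set \<Rightarrow> ('b \<Rightarrow>\<^sub>0 'r::comm_ring_1) set" where
  "free B = {x. Poly_Mapping.keys x \<subseteq> B}"

definition lin :: "('a \<Rightarrow> ('b \<Rightarrow>\<^sub>0 'r::comm_ring_1)) \<Rightarrow> ('a \<Rightarrow>\<^sub>0 'r) \<Rightarrow> ('b \<Rightarrow>\<^sub>0 'r)" where
  "lin \<phi> x = (\<Sum>a\<in>Poly_Mapping.keys x.
                Poly_Mapping.map (\<lambda>r. Poly_Mapping.lookup x a * r) (\<phi> a))"

definition relabel :: "('a \<Rightarrow> 'b) \<Rightarrow> ('a \<Rightarrow>\<^sub>0 'r::comm_ring_1) \<Rightarrow> ('b \<Rightarrow>\<^sub>0 'r)" where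
  "relabel f = lin (\<lambda>a. Poly_Mapping.single (f a) 1)"

record (overloaded) ('n, 'k, 'b) based_complex =
  basis :: "nat \<Rightarrow> 'b set"
  mdeg :: "'b \<Rightarrow> 'n monom"
  diff :: "'b \<Rightarrow> ('b \<Rightarrow>\<^sub>0 ('n, 'k) mpoly)"

text \<open>\<open>x\<close> is homogeneous of multidegree \<open>t\<close> when the basis element \<open>b\<close> has multidegree \<open>D b\<close>.\<close>

definition homogeneous ::
    "('b \<Rightarrow> 'n monom) \<Rightarrow> 'n monom \<Rightarrow> ('b \<Rightarrow>\<^sub>0 ('n, 'k::field) mpoly) \<Rightarrow> bool" where
  "homogeneous D t x \<longleftrightarrow>
     (\<forall>b. \<forall>s\<in>Poly_Mapping.keys (Poly_Mapping.lookup x b). s + D b = t)"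

definition graded_complex :: "('n, 'k::field, 'b) based_complex \<Rightarrow> bool" where
  "graded_complex F \<longleftrightarrow>
     (\<forall>i. finite (basis F i)) \<and>
     (\<forall>b\<in>basis F 0. diff F b = 0) \<and>
     (\<forall>i. \<forall>b\<in>basis F (Suc i).
        diff F b \<in> free (basis F i) \<and> homogeneous (mdeg F) (mdeg F b) (diff F b) \<and>
        lin (diff F) (diff F b) = 0)"

text \<open>
  A graded free resolution of \<open>R/J\<close> with \<open>F\<^sub>0 = R\<close>: the degree-0 module has the single basis
  element \<open>u\<close>, identified with \<open>1 \<in> R\<close>, and the augmentation is the projection \<open>R \<rightarrow> R/J\<close>.
\<close>

definition resolves ::
    "'b \<Rightarrow> ('n, 'k::field) mpoly set \<Rightarrow> ('n, 'k, 'b) based_complex \<Rightarrow> bool" where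
  "resolves u J F \<longleftrightarrow>
     graded_complex F \<and> basis F 0 = {u} \<and> mdeg F u = 0 \<and>
     (\<lambda>x. Poly_Mapping.lookup x u) ` lin (diff F) ` free (basis F 1) = J \<and>
     (\<forall>i. lin (diff F) ` free (basis F (Suc (Suc i))) =
          {x \<in> free (basis F (Suc i)). lin (diff F) x = 0})"

definition minimal_complex :: "('n, 'k::field, 'b) based_complex \<Rightarrow> bool" where
  "minimal_complex F \<longleftrightarrow>
     (\<forall>i. \<forall>b\<in>basis F i. \<forall>b'. Poly_Mapping.lookup (diff F b) b' \<in> ideal_gen (range var))"

text \<open>Isomorphism of complexes that maps the basis of the one to the basis of the other by \<open>f\<close>.\<close>

definition based_iso :: "('a \<Rightarrow> 'b) \<Rightarrow> ('n, 'k::field, 'a) based_complex \<Rightarrow>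
    ('n, 'k, 'b) based_complex \<Rightarrow> bool" where
  "based_iso f F F' \<longleftrightarrow>
     (\<forall>i. bij_betw f (basis F i) (basis F' i)) \<and>
     (\<forall>i. \<forall>b\<in>basis F i. mdeg F' (f b) = mdeg F b \<and> diff F' (f b) = relabel f (diff F b))"


section \<open>Mapping cones\<close>

definition shift :: "'n monom \<Rightarrow> ('n, 'k, 'b) based_complex \<Rightarrow> ('n, 'k, 'b) based_complex" where
  "shift t F = F\<lparr>mdeg := \<lambda>b. t + mdeg F b\<rparr>"

definition chain_map :: "('n, 'k::field, 'a) based_complex \<Rightarrow> ('n, 'k, 'b) based_complex \<Rightarrow>
    ('a \<Rightarrow> ('b \<Rightarrow>\<^sub>0 ('n, 'k) mpoly)) \<Rightarrow> bool" where
  "chain_map G F \<psi> \<longleftrightarrow>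
     (\<forall>i. \<forall>g\<in>basis G i. \<psi> g \<in> free (basis F i) \<and> homogeneous (mdeg F) (mdeg G g) (\<psi> g) \<and>
        lin \<psi> (diff G g) = lin (diff F) (\<psi> g))"

text \<open>
  The chain map \<open>\<psi>\<close> lifts the map \<open>R/J' \<rightarrow> R/J\<close> induced by multiplication by \<open>p\<close>, where \<open>G\<close> and
  \<open>F\<close> resolve \<open>R/J'\<close> and \<open>R/J\<close> and the degree-0 modules are identified with \<open>R\<close> through \<open>u\<close> and \<open>v\<close>.
\<close>

definition lifts_mult :: "'a \<Rightarrow> 'b \<Rightarrow> ('n, 'k::field) mpoly set \<Rightarrow> ('n, 'k) mpoly \<Rightarrow>
    ('a \<Rightarrow> ('b \<Rightarrow>\<^sub>0 ('n, 'k) mpoly)) \<Rightarrow> bool" where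
  "lifts_mult u v J p \<psi> \<longleftrightarrow>
     (\<forall>g\<in>free {u}. Poly_Mapping.lookup (lin \<psi> g) v - p * Poly_Mapping.lookup g u \<in> J)"

text \<open>\<open>C(\<psi>) = G[1] \<oplus> F\<close> with \<open>d(g, f) = (-d\<^sub>G(g), \<psi>(g) + d\<^sub>F(f))\<close>, given on basis elements.\<close>

definition mapping_cone :: "('n, 'k::field, 'a) based_complex \<Rightarrow> ('n, 'k, 'b) based_complex \<Rightarrow>
    ('a \<Rightarrow> ('b \<Rightarrow>\<^sub>0 ('n, 'k) mpoly)) \<Rightarrow> ('n, 'k, 'a + 'b) based_complex" where
  "mapping_cone G F \<psi> =
     \<lparr>basis = (\<lambda>i. Inl ` (case i of 0 \<Rightarrow> {} | Suc p \<Rightarrow> basis G p) \<union> Inr ` basis F i),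
      mdeg = case_sum (mdeg G) (mdeg F),
      diff = case_sum (\<lambda>g. - relabel Inl (diff G g) + relabel Inr (\<psi> g))
                      (\<lambda>f. relabel Inr (diff F f))\<rparr>"

text \<open>
  The Koszul complex on the variables \<open>x\<^sub>s\<close>, \<open>s \<in> S\<close>; the subset \<open>\<alpha> = {j\<^sub>1 < \<dots> < j\<^sub>p}\<close> of \<open>S\<close> stands
  for the basis element \<open>e\<^bsub>j\<^sub>1\<^esub> \<and> \<dots> \<and> e\<^bsub>j\<^sub>p\<^esub>\<close>.
\<close>

definition koszul :: "'n::{finite,linorder} set \<Rightarrow> ('n, 'k::field, 'n set) based_complex" where
  "koszul S =
     \<lparr>basis = (\<lambda>p. {\<alpha>. \<alpha> \<subseteq> S \<and> card \<alpha> = p}),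
      mdeg = mon,
      diff = (\<lambda>\<alpha>. \<Sum>i = 1..card \<alpha>.
                Poly_Mapping.single (\<alpha> - {elt \<alpha> i}) ((-1) ^ (i - 1) * var (elt \<alpha> i)))\<rparr>"

text \<open>\<open>Sym m \<alpha>\<close> is the symbol \<open>(m; \<alpha>)\<close> and \<open>Base\<close> is the basis element \<open>1\<close> of \<open>F\<^sub>0 = R\<close>.\<close>

datatype 'n symbol = Base | Sym "'n set" "'n set"

text \<open>
  \<open>Fs 0, Fs 1, \<dots>\<close> are the complexes of an iterated mapping cone along the generators \<open>ms\<close>, with
  lifts \<open>\<psi> 0, \<psi> 1, \<dots>\<close>: \<open>Fs 0\<close> is \<open>R\<close> in degree 0, \<open>Fs j\<close> resolves the quotient of \<open>R\<close> by the ideal of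
  the first \<open>j\<close> generators, and \<open>Fs (Suc j)\<close> is the mapping cone of \<open>\<psi> j\<close>, where the summand \<open>Fs j\<close>
  keeps its basis and the Koszul basis element \<open>\<alpha>\<close> is renamed to \<open>(ms ! j; \<alpha>)\<close>.
\<close>

definition iterated_mapping_cone ::
    "'n::{finite,linorder} set list \<Rightarrow> (nat \<Rightarrow> ('n, 'k::field, 'n symbol) based_complex) \<Rightarrow>
     (nat \<Rightarrow> 'n set \<Rightarrow> ('n symbol \<Rightarrow>\<^sub>0 ('n, 'k) mpoly)) \<Rightarrow> bool" where
  "iterated_mapping_cone ms Fs \<psi> \<longleftrightarrow>
     (\<forall>i. basis (Fs 0) i = (if i = 0 then {Base} else {})) \<and>
     (\<forall>j\<le>length ms. resolves Base (ideal_upto ms j) (Fs j)) \<and>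
     (\<forall>j<length ms.
        let m = ms ! j;
            J = ideal_upto ms j;
            G = koszul (lin_set J m)
        in resolves {} (colon J (monomial (mon m))) G \<and>
           chain_map (shift (mon m) G) (Fs j) (\<psi> j) \<and>
           lifts_mult {} Base J (monomial (mon m)) (\<psi> j) \<and>
           based_iso (case_sum (Sym m) id)
             (mapping_cone (shift (mon m) G) (Fs j) (\<psi> j)) (Fs (Suc j)))"


section \<open>The homomorphism complex\<close>

definition set_less :: "'n::linorder set \<Rightarrow> 'n set \<Rightarrow> bool" where
  "set_less \<sigma> \<tau> \<longleftrightarrow> (\<forall>x\<in>\<sigma>. \<forall>y\<in>\<tau>. x < y)"

text \<open>
  The cell \<open>\<sigma>\<^sub>1 \<times> \<dots> \<times> \<sigma>\<^sub>d\<close> is the list of its factors; its vertices are the lists \<open>v\<close> with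
  \<open>list_all2 (\<in>) v c\<close>.
\<close>

definition hom_cells :: "nat \<Rightarrow> 'n::linorder hypergraph \<Rightarrow> 'n set list set" where
  "hom_cells d H = {c. length c = d \<and> (\<forall>\<sigma>\<in>set c. \<sigma> \<noteq> {} \<and> \<sigma> \<subseteq> verts H) \<and>
     sorted_wrt set_less c \<and> (\<forall>v. list_all2 (\<in>) v c \<longrightarrow> set v \<in> edges H)}"

definition cell_dim :: "'n set list \<Rightarrow> nat" where
  "cell_dim c = (\<Sum>\<sigma>\<leftarrow>c. card \<sigma> - 1)"

definition cell_label :: "'n set list \<Rightarrow> 'n monom" where
  "cell_label c = (\<Sum>\<sigma>\<leftarrow>c. mon \<sigma>)"

text \<open>
  The incidence number of \<open>c\<close> and \<open>c'\<close> for the product orientation, where each simplex is oriented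
  by the order of its vertices: the sign in
  \<open>\<partial>(\<sigma>\<^sub>1 \<times> \<dots> \<times> \<sigma>\<^sub>d) = (\<Sum>l. (-1)\<^bsup>dim \<sigma>\<^sub>1 + \<dots> + dim \<sigma>\<^sub>l\<^sub>-\<^sub>1\<^esup> \<sigma>\<^sub>1 \<times> \<dots> \<times> \<partial>\<sigma>\<^sub>l \<times> \<dots> \<times> \<sigma>\<^sub>d)\<close>, and 0 if \<open>c'\<close> does not
  occur in it.
\<close>

definition incidence :: "'n::linorder set list \<Rightarrow> 'n set list \<Rightarrow> int" where
  "incidence c c' =
     (\<Sum>l<length c. \<Sum>w\<in>{w \<in> c ! l. c' = c[l := c ! l - {w}]}.
        (-1) ^ ((\<Sum>l'<l. card (c ! l') - 1) + card {w' \<in> c ! l. w' < w}))"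

text \<open>
  The cellular complex of \<open>X\<^sub>H\<close>.  The basis element \<open>None\<close> is the empty cell, the generator of
  \<open>F\<^sub>0 = R\<close>.  A choice of orientations is given by \<open>\<epsilon>\<close> with values \<open>\<plusminus>1\<close>: the orientation of \<open>c\<close> is
  \<open>\<epsilon> c\<close> times the product orientation.  The label of a face divides the label of the cell, so the
  differences of exponent vectors are quotients of monomials.
\<close>

definition cellular_complex :: "nat \<Rightarrow> 'n::linorder hypergraph \<Rightarrow> ('n set list \<Rightarrow> int) \<Rightarrow>
    ('n, 'k::field, 'n set list option) based_complex" where
  "cellular_complex d H \<epsilon> =
     \<lparr>basis = (\<lambda>i. case i of 0 \<Rightarrow> {None}
                  | Suc p \<Rightarrow> Some ` {c \<in> hom_cells d H. cell_dim c = p}),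
      mdeg = (\<lambda>b. case b of None \<Rightarrow> 0 | Some c \<Rightarrow> cell_label c),
      diff = (\<lambda>b. case b of None \<Rightarrow> 0 | Some c \<Rightarrow>
        (if cell_dim c = 0
         then Poly_Mapping.single None (of_int (\<epsilon> c) * monomial (cell_label c))
         else (\<Sum>c' \<in> {c' \<in> hom_cells d H. cell_dim c' = cell_dim c - 1}.
                 Poly_Mapping.single (Some c')
                   (of_int (\<epsilon> c * \<epsilon> c' * incidence c c') *
                    monomial (cell_label c - cell_label c')))))\<rparr>"

fun symbol_cell :: "'n::linorder symbol \<Rightarrow> 'n set list option" where
  "symbol_cell Base = None"
| "symbol_cell (Sym m \<alpha>) =
     Some (map (\<lambda>l. {elt m l} \<union> (\<alpha> \<inter> gap m l)) [1..<Suc (card m)])"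

end

theory Submission
  imports Defs
begin

text \<open>
  The colon ideals of the lexicographically ordered generators are generated by variables, and the
  Koszul complex on these variables is itself an iterated mapping cone of multiplications by one
  variable, hence a resolution.  The mapping cone of a chain map from this Koszul complex to a
  resolution of \<open>R/I\<^bsub>j-1\<^esub>\<close> that lifts multiplication by \<open>m\<^sub>j\<close> resolves \<open>R/I\<^sub>j\<close>, by a diagram chase.

  The cellular differential provides the chain maps.  Exchange properties of cointerval hypergraphs
  show that the symbols \<open>(m; \<alpha>)\<close> correspond to the cells, \<open>m\<close> being the set of the maxima of the
  factors.  Removing from a factor an element other than the maximum gives the Koszul part of the
  differential, removing the maximum gives the part over \<open>T(\<alpha>)\<close>.  The latter is a chain map because
  the cellular differential squares to zero.  With the orientation \<open>(-1)\<^bsup>dim c\<^esup>\<close> of the cells all signs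
  are those of the mapping cone.
\<close>

section \<open>Free modules\<close>

text \<open>On symbols it is awkward to check that the lifts commute with the differentials:
  removing an element of \<alpha> changes T(\<alpha>) and, in terms of the second kind, also the
  generator. On cells the same terms are removals of two elements in either order, so only signs
  have to be compared, and the injection of symbols into cells carries the result back. Since the
  Koszul part already squares to zero, what remains of d(d(m;\<alpha>)) = 0 is exactly the chain map
  equation. Exactness travels the other way: it is proved for the cones and reaches the cellular
  complex through the final isomorphism. The signs: in the product orientation, removing w from the
  cell of (m;\<alpha>) has the sign (-1)^r, where r is the number of elements of \<alpha> below w.
  For w = j_i this r is i-1; for the maximum of the factor in which j_i is the largest element of
  \<alpha> it is i. Both signs differ from those of the formula, (-1)^i and (-1)^(i-1), by a factor
  -1. The orientation (-1)^dim yields this factor at every facet and leaves the augmentation of the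
  vertices positive.\<close>

abbreviation lkp :: "('a \<Rightarrow>\<^sub>0 'b::zero) \<Rightarrow> 'a \<Rightarrow> 'b" where
  "lkp \<equiv> Poly_Mapping.lookup"

text \<open>The scaling that occurs inside \<open>lin\<close>, named so that it can have
  simplification rules.\<close>

definition smult :: "'r::comm_ring_1 \<Rightarrow> ('b \<Rightarrow>\<^sub>0 'r) \<Rightarrow> ('b \<Rightarrow>\<^sub>0 'r)" where
  "smult r x = Poly_Mapping.map (\<lambda>s. r * s) x"

lemma lookup_smult [simp]: "lkp (smult r x) b = r * lkp x b"
  unfolding smult_def by (simp add: map.rep_eq when_def)

lemma smult_simps [simp]:
  "smult 0 x = 0" "smult r 0 = 0" "smult 1 x = x" "smult r (smult s x) = smult (r * s) x"
  "smult (- r) x = - smult r x" "smult r (- x) = - smult r x"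
  "smult r (Poly_Mapping.single b s) = Poly_Mapping.single b (r * s)"
  by (rule poly_mapping_eqI; simp add: lookup_single when_def mult.assoc)+

lemma smult_add: "smult r (x + y) = smult r x + smult r y"
  by (rule poly_mapping_eqI) (simp add: lookup_add algebra_simps)

lemma smult_add_left: "smult (r + s) x = smult r x + smult s x"
  by (rule poly_mapping_eqI) (simp add: lookup_add algebra_simps)

lemma smult_sum: "smult r (sum f A) = (\<Sum>a\<in>A. smult r (f a))"
  by (rule poly_mapping_eqI) (simp add: lookup_sum sum_distrib_left)

text \<open>Supports change under addition and scaling. Summing over a common finite superset makes
  linearity of \<open>lin\<close> a termwise identity.\<close>

lemma lin_eq_sum:
  assumes "finite A" "Poly_Mapping.keys x \<subseteq> A"
  shows "lin \<phi> x = (\<Sum>a\<in>A. smult (lkp x a) (\<phi> a))"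
  unfolding lin_def smult_def[symmetric]
  by (rule sum.mono_neutral_left) (use assms in \<open>auto simp: in_keys_iff\<close>)

lemma lin_zero [simp]: "lin \<phi> 0 = 0"
  by (simp add: lin_def)

lemma lin_add: "lin \<phi> (x + y) = lin \<phi> x + lin \<phi> y"
proof -
  have fin: "finite (Poly_Mapping.keys x \<union> Poly_Mapping.keys y)" by simp
  show ?thesis
    by (subst (1 2 3) lin_eq_sum[OF fin])
      (auto simp: lookup_add smult_add_left sum.distrib dest: subsetD[OF keys_add])
qed

lemma lin_smult [simp]: "lin \<phi> (smult r x) = smult r (lin \<phi> x)"
proof -
  have "Poly_Mapping.keys (smult r x) \<subseteq> Poly_Mapping.keys x"
    by (auto simp: in_keys_iff)
  then show ?thesis
    by (subst (1 2) lin_eq_sum[OF finite_keys[of x]]) (auto simp: smult_sum)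
qed

lemma lin_uminus [simp]: "lin \<phi> (- x) = - lin \<phi> x"
  using lin_smult[of \<phi> "-1" x] by simp

lemma lin_diff: "lin \<phi> (x - y) = lin \<phi> x - lin \<phi> y"
  using lin_add[of \<phi> x "- y"] by simp

lemma lin_single [simp]: "lin \<phi> (Poly_Mapping.single a r) = smult r (\<phi> a)"
  by (subst lin_eq_sum[of "{a}"]) auto

lemma lin_sum: "lin \<phi> (sum f A) = (\<Sum>a\<in>A. lin \<phi> (f a))"
  by (induction A rule: infinite_finite_induct) (auto simp: lin_add)

lemma lin_lin: "lin \<phi> (lin \<psi> x) = lin (\<lambda>a. lin \<phi> (\<psi> a)) x"
  by (simp add: lin_eq_sum[OF finite_keys[of x] order_refl] lin_sum)

lemma lin_cong:
  assumes "\<And>a. a \<in> Poly_Mapping.keys x \<Longrightarrow> \<phi> a = \<psi> a"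
  shows "lin \<phi> x = lin \<psi> x"
  by (subst (1 2) lin_eq_sum[OF finite_keys[of x] order_refl]) (simp add: assms)

lemma lin_uminus_fun: "lin (\<lambda>a. - \<phi> a) x = - lin \<phi> x"
  by (subst (1 2) lin_eq_sum[OF finite_keys[of x] order_refl]) (simp add: sum_negf)

lemma lin_add_fun: "lin (\<lambda>a. \<phi> a + \<psi> a) x = lin \<phi> x + lin \<psi> x"
  by (subst (1 2 3) lin_eq_sum[OF finite_keys[of x] order_refl]) (simp add: sum.distrib smult_add)

lemma lin_eq_zero: "(\<And>a. a \<in> Poly_Mapping.keys x \<Longrightarrow> \<phi> a = 0) \<Longrightarrow> lin \<phi> x = 0"
  by (subst lin_eq_sum[OF finite_keys[of x] order_refl]) simp

lemma lin_single_id: "lin (\<lambda>a. Poly_Mapping.single a 1) x = x"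
proof (rule poly_mapping_eqI)
  fix a
  have "lkp (lin (\<lambda>a. Poly_Mapping.single a 1) x) a =
      (\<Sum>b\<in>Poly_Mapping.keys x. if b = a then lkp x a else 0)"
    by (subst lin_eq_sum[OF finite_keys[of x] order_refl])
      (auto simp: lookup_sum lookup_single when_def intro!: sum.cong)
  then show "lkp (lin (\<lambda>a. Poly_Mapping.single a 1) x) a = lkp x a"
    by (simp add: in_keys_iff)
qed

lemma free_zero [simp]: "0 \<in> free B"
  by (simp add: free_def)

lemma free_iff: "x \<in> free B \<longleftrightarrow> (\<forall>b. b \<notin> B \<longrightarrow> lkp x b = 0)"
  by (auto simp: free_def in_keys_iff)

lemma free_add: "x \<in> free B \<Longrightarrow> y \<in> free B \<Longrightarrow> x + y \<in> free B"
  by (auto simp: free_iff lookup_add)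

lemma free_smult: "x \<in> free B \<Longrightarrow> smult r x \<in> free B"
  by (auto simp: free_iff)

lemma free_uminus: "x \<in> free B \<Longrightarrow> - x \<in> free B"
  by (auto simp: free_iff)

lemma free_single: "b \<in> B \<Longrightarrow> Poly_Mapping.single b r \<in> free B"
  by (auto simp: free_iff lookup_single when_def)

lemma free_sum: "(\<And>a. a \<in> A \<Longrightarrow> f a \<in> free B) \<Longrightarrow> sum f A \<in> free B"
  by (induction A rule: infinite_finite_induct) (auto simp: free_add)

lemma free_mono: "x \<in> free B \<Longrightarrow> B \<subseteq> B' \<Longrightarrow> x \<in> free B'"
  by (auto simp: free_iff)

lemma lin_free:
  assumes "x \<in> free A" "\<And>a. a \<in> A \<Longrightarrow> \<phi> a \<in> free B"
  shows "lin \<phi> x \<in> free B"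
  unfolding lin_def smult_def[symmetric]
  by (intro free_sum free_smult) (use assms in \<open>auto simp: free_def\<close>)

lemma lin_free_cong: "x \<in> free A \<Longrightarrow> (\<And>a. a \<in> A \<Longrightarrow> \<phi> a = \<psi> a) \<Longrightarrow> lin \<phi> x = lin \<psi> x"
  by (rule lin_cong) (auto simp: free_def)

lemma lin_free_zero: "x \<in> free A \<Longrightarrow> (\<And>a. a \<in> A \<Longrightarrow> \<phi> a = 0) \<Longrightarrow> lin \<phi> x = 0"
  by (rule lin_eq_zero) (auto simp: free_def)

lemma free_empty [simp]: "free {} = {0}"
  by (auto simp: free_def)

lemma free_singletonE:
  assumes "x \<in> free {b}"
  obtains r where "x = Poly_Mapping.single b r"
proof
  show "x = Poly_Mapping.single b (lkp x b)"
    by (rule poly_mapping_eqI) (use assms in \<open>auto simp: free_iff lookup_single when_def\<close>)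
qed

lemma relabel_simps [simp]:
  "relabel f 0 = 0" "relabel f (- x) = - relabel f x" "relabel f (smult r x) = smult r (relabel f x)"
  "relabel f (Poly_Mapping.single a r) = Poly_Mapping.single (f a) r"
  by (simp_all add: relabel_def)

lemma relabel_add: "relabel f (x + y) = relabel f x + relabel f y"
  by (simp add: relabel_def lin_add)

lemma relabel_diff: "relabel f (x - y) = relabel f x - relabel f y"
  by (simp add: relabel_def lin_diff)

lemma relabel_sum: "relabel f (sum h A) = (\<Sum>a\<in>A. relabel f (h a))"
  by (simp add: relabel_def lin_sum)

lemma relabel_id [simp]: "relabel id x = x"
  by (simp add: relabel_def lin_single_id)

lemma lin_relabel: "lin \<phi> (relabel f x) = lin (\<lambda>a. \<phi> (f a)) x"
  by (simp add: relabel_def lin_lin)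

lemma relabel_lin: "relabel f (lin \<phi> x) = lin (\<lambda>a. relabel f (\<phi> a)) x"
  by (simp add: relabel_def lin_lin)

lemma relabel_relabel: "relabel f (relabel g x) = relabel (\<lambda>a. f (g a)) x"
  unfolding relabel_def[of g] relabel_lin by (simp add: relabel_def)

lemma relabel_cong: "x \<in> free A \<Longrightarrow> (\<And>a. a \<in> A \<Longrightarrow> f a = g a) \<Longrightarrow> relabel f x = relabel g x"
  unfolding relabel_def by (rule lin_free_cong) auto

lemma relabel_free: "x \<in> free A \<Longrightarrow> (\<And>a. a \<in> A \<Longrightarrow> f a \<in> B) \<Longrightarrow> relabel f x \<in> free B"
  unfolding relabel_def by (rule lin_free) (auto simp: free_single)

lemma relabel_inv_into:
  assumes "inj_on f A" "x \<in> free A"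
  shows "relabel (inv_into A f) (relabel f x) = x"
proof -
  have "relabel (inv_into A f) (relabel f x) = relabel id x"
    unfolding relabel_relabel by (rule relabel_cong[OF assms(2)]) (simp add: assms(1))
  then show ?thesis by simp
qed

lemma relabel_inj:
  "inj_on f A \<Longrightarrow> x \<in> free A \<Longrightarrow> y \<in> free A \<Longrightarrow> relabel f x = relabel f y \<Longrightarrow> x = y"
  by (metis relabel_inv_into)

lemma relabel_surj:
  assumes "y \<in> free (f ` A)"
  obtains x where "x \<in> free A" "relabel f x = y"
proof
  show "relabel (inv_into A f) y \<in> free A"
    using assms by (rule relabel_free) (auto intro: inv_into_into)
  have "relabel f (relabel (inv_into A f) y) = relabel id y"
    unfolding relabel_relabel by (rule relabel_cong[OF assms]) (auto simp: f_inv_into_f)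
  then show "relabel f (relabel (inv_into A f) y) = y" by simp
qed

lemma lookup_relabel:
  assumes "inj_on f A" "x \<in> free A" "a \<in> A"
  shows "lkp (relabel f x) (f a) = lkp x a"
proof -
  have "lkp (relabel f x) (f a) = (\<Sum>b\<in>Poly_Mapping.keys x. lkp x b * (1 when f b = f a))"
    unfolding relabel_def
    by (subst lin_eq_sum[OF finite_keys[of x] order_refl]) (auto simp: lookup_sum lookup_single when_def intro!: sum.cong)
  also have "\<dots> = (\<Sum>b\<in>Poly_Mapping.keys x. if b = a then lkp x a else 0)"
    using assms by (intro sum.cong) (auto simp: free_def when_def dest: inj_onD)
  finally show ?thesis by (simp add: in_keys_iff)
qed


section \<open>Homogeneous elements\<close>

lemma homogeneous_zero [simp]: "homogeneous D t 0"
  by (simp add: homogeneous_def)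

lemma homogeneous_add: "homogeneous D t x \<Longrightarrow> homogeneous D t y \<Longrightarrow> homogeneous D t (x + y)"
  unfolding homogeneous_def lookup_add by (blast dest: subsetD[OF keys_add])

lemma homogeneous_uminus: "homogeneous D t x \<Longrightarrow> homogeneous D t (- x)"
  by (simp add: homogeneous_def)

lemma homogeneous_sum: "(\<And>a. a \<in> A \<Longrightarrow> homogeneous D t (f a)) \<Longrightarrow> homogeneous D t (sum f A)"
  by (induction A rule: infinite_finite_induct) (auto simp: homogeneous_add)

lemma homogeneous_single:
  "(\<And>s. s \<in> Poly_Mapping.keys r \<Longrightarrow> s + D b = t) \<Longrightarrow> homogeneous D t (Poly_Mapping.single b r)"
  by (auto simp: homogeneous_def lookup_single when_def)

lemma homogeneous_relabel:
  assumes "homogeneous D t x" "x \<in> free A" "inj_on f A" "\<And>a. a \<in> A \<Longrightarrow> D' (f a) = D a"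
  shows "homogeneous D' t (relabel f x)"
  unfolding homogeneous_def
proof (intro allI ballI)
  fix b s assume s: "s \<in> Poly_Mapping.keys (lkp (relabel f x) b)"
  \<comment> \<open>Outside the image of \<open>A\<close> all coefficients are 0 and have no keys,
    so only basis elements of the form \<open>f a\<close> are tested.\<close>
  have "relabel f x \<in> free (f ` A)" using assms(2) by (rule relabel_free) auto
  with s obtain a where a: "a \<in> A" "b = f a" by (force simp: free_iff)
  with s have "s \<in> Poly_Mapping.keys (lkp x a)" using assms by (simp add: lookup_relabel)
  then show "s + D' b = t" using assms a by (auto simp: homogeneous_def)
qed

lemma homogeneous_shift:
  "homogeneous D t x \<Longrightarrow> homogeneous (\<lambda>b. s + D b) (s + t) x"
  unfolding homogeneous_def by (auto simp: add_ac) (metis add.left_commute add.commute)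


section \<open>Isomorphic complexes\<close>

lemma graded_complexD:
  assumes "graded_complex F"
  shows "finite (basis F i)" "b \<in> basis F 0 \<Longrightarrow> diff F b = 0"
    "b \<in> basis F (Suc i) \<Longrightarrow> diff F b \<in> free (basis F i)"
    "b \<in> basis F (Suc i) \<Longrightarrow> homogeneous (mdeg F) (mdeg F b) (diff F b)"
    "b \<in> basis F (Suc i) \<Longrightarrow> lin (diff F) (diff F b) = 0"
  using assms by (auto simp: graded_complex_def)

lemma based_iso_bij: "based_iso f F F' \<Longrightarrow> bij_betw f (basis F i) (basis F' i)"
  by (simp add: based_iso_def)

lemma based_iso_lin:
  assumes "based_iso f F F'" "x \<in> free (basis F i)"
  shows "lin (diff F') (relabel f x) = relabel f (lin (diff F) x)"
  unfolding lin_relabel relabel_lin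
  using assms by (intro lin_free_cong[of x "basis F i"]) (auto simp: based_iso_def)

lemma based_iso_image:
  assumes "based_iso f F F'"
  shows "free (basis F' i) = relabel f ` free (basis F i)"
proof -
  have eq: "basis F' i = f ` basis F i"
    using based_iso_bij[OF assms] by (simp add: bij_betw_def)
  show ?thesis unfolding eq
    by (auto intro: relabel_free elim: relabel_surj[of _ f "basis F i"])
qed

lemma based_iso_graded:
  assumes iso: "based_iso f F F'" and F: "graded_complex F"
  shows "graded_complex F'"
  unfolding graded_complex_def
proof (intro conjI allI ballI)
  note bij = based_iso_bij[OF iso]
  fix i
  show "finite (basis F' i)" using bij_betw_finite[OF bij] graded_complexD(1)[OF F] by blast
  fix b' assume "b' \<in> basis F' (Suc i)"
  then obtain b where b: "b \<in> basis F (Suc i)" "b' = f b" using bij[of "Suc i"] by (auto simp: bij_betw_def)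
  then have d: "diff F' b' = relabel f (diff F b)" and m: "mdeg F' b' = mdeg F b"
    using iso by (auto simp: based_iso_def)
  note c = graded_complexD(3-5)[OF F b(1)]
  show "diff F' b' \<in> free (basis F' i)"
    unfolding d based_iso_image[OF iso] using c by blast
  show "homogeneous (mdeg F') (mdeg F' b') (diff F' b')"
    unfolding d m using c(2) c(1) bij_betw_imp_inj_on[OF bij]
    by (rule homogeneous_relabel) (use iso in \<open>auto simp: based_iso_def\<close>)
  show "lin (diff F') (diff F' b') = 0"
    unfolding d using based_iso_lin[OF iso c(1)] c(3) by simp
next
  fix b' assume "b' \<in> basis F' 0"
  then obtain b where b: "b \<in> basis F 0" "b' = f b"
    using based_iso_bij[OF iso, of 0] by (auto simp: bij_betw_def)
  then show "diff F' b' = 0"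
    using iso graded_complexD(2)[OF F b(1)] by (auto simp: based_iso_def)
qed

text \<open>Mapping cones live on sum types. This lemma lets a resolution be renamed, to subsets for
  the Koszul complex, to symbols for each stage and finally to cells.\<close>

lemma based_iso_resolves:
  assumes iso: "based_iso f F F'" and F: "resolves u J F"
  shows "resolves (f u) J F'"
  unfolding resolves_def
proof (intro conjI allI)
  have gr: "graded_complex F" and u: "basis F 0 = {u}" "mdeg F u = 0"
    and im: "(\<lambda>x. lkp x u) ` lin (diff F) ` free (basis F 1) = J"
    and ex: "\<And>i. lin (diff F) ` free (basis F (Suc (Suc i))) =
          {x \<in> free (basis F (Suc i)). lin (diff F) x = 0}"
    using F by (auto simp: resolves_def)
  note bij = based_iso_bij[OF iso]
  show "graded_complex F'" using based_iso_graded[OF iso gr] .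
  show "basis F' 0 = {f u}" using bij[of 0] u by (auto simp: bij_betw_def)
  show "mdeg F' (f u) = 0" using iso u by (force simp: based_iso_def)
  have lin_free_diff: "lin (diff F) x \<in> free (basis F i)" if "x \<in> free (basis F (Suc i))" for x i
    using that graded_complexD(3)[OF gr] by (rule lin_free)
  have "lkp (lin (diff F') (relabel f x)) (f u) = lkp (lin (diff F) x) u"
    if x: "x \<in> free (basis F 1)" for x
    unfolding based_iso_lin[OF iso x]
    by (rule lookup_relabel[of _ "{u}"]) (use lin_free_diff[of x 0] x u in auto)
  then have "(\<lambda>x. lkp x (f u)) ` lin (diff F') ` relabel f ` free (basis F 1) =
      (\<lambda>x. lkp x u) ` lin (diff F) ` free (basis F 1)"
    by (force simp: image_image)
  then show "(\<lambda>x. lkp x (f u)) ` lin (diff F') ` free (basis F' 1) = J"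
    using im by (simp add: based_iso_image[OF iso])
  fix i
  have "lin (diff F') ` free (basis F' (Suc (Suc i))) =
      relabel f ` lin (diff F) ` free (basis F (Suc (Suc i)))"
    unfolding based_iso_image[OF iso] image_image
    by (intro image_cong refl) (rule based_iso_lin[OF iso])
  also have "\<dots> = relabel f ` {x \<in> free (basis F (Suc i)). lin (diff F) x = 0}" by (simp add: ex)
  also have "\<dots> = {x \<in> free (basis F' (Suc i)). lin (diff F') x = 0}"
  proof -
    have "lin (diff F') (relabel f x) = 0 \<longleftrightarrow> lin (diff F) x = 0" if x: "x \<in> free (basis F (Suc i))" for x
      unfolding based_iso_lin[OF iso x]
      using relabel_inj[OF bij_betw_imp_inj_on[OF bij] lin_free_diff[OF x] free_zero] by auto
    then show ?thesis unfolding based_iso_image[OF iso] by auto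
  qed
  finally show "lin (diff F') ` free (basis F' (Suc (Suc i))) =
          {x \<in> free (basis F' (Suc i)). lin (diff F') x = 0}" .
qed

section \<open>Monomial ideals\<close>

lemma module_times: "module ((*) :: 'r::comm_ring_1 \<Rightarrow> 'r \<Rightarrow> 'r)"
  by unfold_locales (simp_all add: algebra_simps)

lemma ideal_gen_zero [simp]: "0 \<in> ideal_gen A"
  unfolding ideal_gen_def by (rule module.span_zero[OF module_times])

lemma ideal_gen_base: "p \<in> A \<Longrightarrow> p \<in> ideal_gen A"
  unfolding ideal_gen_def by (rule module.span_base[OF module_times])

lemma ideal_gen_add: "p \<in> ideal_gen A \<Longrightarrow> q \<in> ideal_gen A \<Longrightarrow> p + q \<in> ideal_gen A"
  unfolding ideal_gen_def by (rule module.span_add[OF module_times])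

lemma ideal_gen_diff: "p \<in> ideal_gen A \<Longrightarrow> q \<in> ideal_gen A \<Longrightarrow> p - q \<in> ideal_gen A"
  unfolding ideal_gen_def by (rule module.span_diff[OF module_times])

lemma ideal_gen_mult: "p \<in> ideal_gen A \<Longrightarrow> r * p \<in> ideal_gen A"
  unfolding ideal_gen_def by (rule module.span_scale[OF module_times])

lemma ideal_gen_sum: "(\<And>a. a \<in> B \<Longrightarrow> f a \<in> ideal_gen A) \<Longrightarrow> sum f B \<in> ideal_gen A"
  unfolding ideal_gen_def by (rule module.span_sum[OF module_times])

lemma ideal_gen_insert: "ideal_gen (insert p A) = {x. \<exists>r. x - r * p \<in> ideal_gen A}"
  unfolding ideal_gen_def by (rule module.span_insert[OF module_times])

lemma ideal_gen_empty [simp]: "ideal_gen {} = {0}"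
  unfolding ideal_gen_def by (rule module.span_empty[OF module_times])

lemma poly_mapping_sum_single: "p = (\<Sum>t\<in>Poly_Mapping.keys p. Poly_Mapping.single t (lkp p t))"
  by (rule poly_mapping_eqI) (auto simp: lookup_sum lookup_single when_def in_keys_iff)

text \<open>Membership in a monomial ideal is decided term by term, which turns every computation
  with colon ideals into divisibility of exponent vectors. One direction is induction over the span,
  the other splits p into its terms.\<close>

lemma monomial_ideal_iff:
  "p \<in> ideal_gen (monomial ` A) \<longleftrightarrow> (\<forall>t\<in>Poly_Mapping.keys p. \<exists>a\<in>A. \<exists>b. t = b + a)"
proof
  assume "p \<in> ideal_gen (monomial ` A)"
  then show "\<forall>t\<in>Poly_Mapping.keys p. \<exists>a\<in>A. \<exists>b. t = b + a"
    unfolding ideal_gen_def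
  proof (induction rule: module.span_induct_alt[OF module_times, consumes 1, case_names base step])
    case (step r x q)
    from step(1) obtain a where "a \<in> A" "x = Poly_Mapping.single a 1" by (auto simp: monomial_def)
    show ?case
    proof
      fix t assume "t \<in> Poly_Mapping.keys (r * x + q)"
      then consider "t \<in> Poly_Mapping.keys (r * x)" | "t \<in> Poly_Mapping.keys q"
        using subsetD[OF keys_add] by fast
      then show "\<exists>a\<in>A. \<exists>b. t = b + a"
      proof cases
        case 1
        then obtain b where "t = b + a"
          using subsetD[OF keys_mult 1] \<open>x = _\<close> by auto
        with \<open>a \<in> A\<close> show ?thesis by (intro bexI[of _ a] exI[of _ b])
      next
        case 2
        with step(2) show ?thesis by (rule bspec)
      qed
    qed
  qed simp
next
  assume *: "\<forall>t\<in>Poly_Mapping.keys p. \<exists>a\<in>A. \<exists>b. t = b + a"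
  have "Poly_Mapping.single t (lkp p t) \<in> ideal_gen (monomial ` A)" if "t \<in> Poly_Mapping.keys p" for t
  proof -
    from bspec[OF * that] obtain a b where a: "a \<in> A" "t = b + a" by (elim bexE exE)
    have "Poly_Mapping.single t (lkp p t) = Poly_Mapping.single b (lkp p t) * monomial a"
      using a by (simp add: monomial_def mult_single)
    then show ?thesis using a by (auto intro: ideal_gen_mult ideal_gen_base)
  qed
  then have "(\<Sum>t\<in>Poly_Mapping.keys p. Poly_Mapping.single t (lkp p t)) \<in> ideal_gen (monomial ` A)"
    by (rule ideal_gen_sum)
  then show "p \<in> ideal_gen (monomial ` A)"
    by (simp only: poly_mapping_sum_single[symmetric])
qed

text \<open>A polynomial is itself an element of a free module over k, with the exponents as basis.
  There multiplication by a monomial is relabelling along a translation, which is injective, so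
  nothing cancels.\<close>

lemma keys_mult_monomial:
  "Poly_Mapping.keys (q * monomial t :: ('n, 'k::field) mpoly) = (\<lambda>s. s + t) ` Poly_Mapping.keys q"
proof -
  have "q * monomial t =
      (\<Sum>s\<in>Poly_Mapping.keys q. Poly_Mapping.single s (lkp q s)) * monomial t"
    by (simp only: poly_mapping_sum_single[symmetric])
  also have "\<dots> = relabel (\<lambda>s. s + t) q"
    by (simp add: relabel_def lin_eq_sum[OF finite_keys[of q] order_refl] monomial_def
        sum_distrib_right mult_single)
  finally have eq: "q * monomial t = relabel (\<lambda>s. s + t) q" .
  have inj: "inj_on (\<lambda>s. s + t) UNIV" by (auto intro: inj_onI)
  have q: "q \<in> free UNIV" by (simp add: free_def)
  have "relabel (\<lambda>s. s + t) q \<in> free ((\<lambda>s. s + t) ` Poly_Mapping.keys q)"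
    by (rule relabel_free[of q "Poly_Mapping.keys q"]) (auto simp: free_def)
  moreover have "s + t \<in> Poly_Mapping.keys (relabel (\<lambda>s. s + t) q) \<longleftrightarrow> s \<in> Poly_Mapping.keys q" for s
    using lookup_relabel[OF inj q, of s] by (simp add: in_keys_iff)
  ultimately show ?thesis
    unfolding eq free_def by blast
qed

lemma keys_monomial [simp]: "Poly_Mapping.keys (monomial t :: ('n, 'k::field) mpoly) = {t}"
  by (simp add: monomial_def)

lemma mem_colon_monomial_ideal_iff:
  "(q :: ('n, 'k::field) mpoly) \<in> colon (ideal_gen (monomial ` A)) (monomial t) \<longleftrightarrow>
     (\<forall>s\<in>Poly_Mapping.keys q. \<exists>a\<in>A. \<exists>b. s + t = b + a)"
  by (simp add: colon_def monomial_ideal_iff keys_mult_monomial)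

lemma colon_monomial_ideal_eqI:
  assumes "\<And>s. (\<exists>a\<in>A. \<exists>b. s + t = b + a) \<longleftrightarrow> (\<exists>a\<in>B. \<exists>b. s = b + a)"
  shows "colon (ideal_gen (monomial ` A)) (monomial t) = (ideal_gen (monomial ` B) :: ('n, 'k::field) mpoly set)"
  by (rule set_eqI) (simp add: mem_colon_monomial_ideal_iff monomial_ideal_iff assms)

lemma adds_iff_le:
  fixes a s :: "'n monom"
  shows "(\<exists>b. s = b + a) \<longleftrightarrow> (\<forall>i. lkp a i \<le> lkp s i)"
proof
  assume "\<forall>i. lkp a i \<le> lkp s i"
  then have "s = (s - a) + a" by (intro poly_mapping_eqI) (simp add: lookup_add lookup_minus)
  then show "\<exists>b. s = b + a" ..
qed (auto simp: lookup_add)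

lemma lookup_mon: "finite S \<Longrightarrow> lkp (mon S) i = (if i \<in> S then 1 else 0)"
  by (simp add: mon_def lookup_sum lookup_single when_def)

lemma mon_empty [simp]: "mon {} = 0"
  by (simp add: mon_def)

lemma mon_singleton: "mon {i} = Poly_Mapping.single i 1"
  by (simp add: mon_def)

lemma var_eq: "var i = monomial (mon {i})"
  by (simp add: var_def mon_singleton)

lemma monomial_mult: "monomial s * monomial t = (monomial (s + t) :: ('n, 'k::field) mpoly)"
  by (simp add: monomial_def mult_single)

lemma mon_remove: "finite S \<Longrightarrow> i \<in> S \<Longrightarrow> mon S = mon {i} + mon (S - {i})"
  unfolding mon_def by (simp add: sum.remove)

lemma mon_insert: "finite S \<Longrightarrow> i \<notin> S \<Longrightarrow> mon (insert i S) = mon {i} + mon S"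
  unfolding mon_def by simp

lemma mon_Un_disjoint: "finite S \<Longrightarrow> finite T \<Longrightarrow> S \<inter> T = {} \<Longrightarrow> mon (S \<union> T) = mon S + mon T"
  unfolding mon_def by (rule sum.union_disjoint)

section \<open>The mapping cone of a map between resolutions\<close>

text \<open>The two sets may overlap; the projection assigns the overlap to the first
  summand.\<close>

lemma free_Un_split:
  assumes "x \<in> free (A \<union> B)"
  obtains y z where "y \<in> free A" "z \<in> free B" "x = y + z"
proof
  let ?y = "lin (\<lambda>a. if a \<in> A then Poly_Mapping.single a 1 else 0) x"
  show "?y \<in> free A"
    by (rule lin_free[of x UNIV]) (auto simp: free_def)
  have "x - ?y = lin (\<lambda>a. if a \<in> A then 0 else Poly_Mapping.single a 1) x"
    by (subst lin_single_id[of x, symmetric])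
      (auto simp: diff_conv_add_uminus lin_uminus_fun[symmetric] lin_add_fun[symmetric]
        simp del: add_uminus_conv_diff intro!: lin_cong)
  also have "\<dots> \<in> free B"
    by (rule lin_free[OF assms]) (auto simp: free_single)
  finally show "x - ?y \<in> free B" .
  show "x = ?y + (x - ?y)" by simp
qed

lemma relabel_Inl_Inr_inject:
  assumes "relabel Inl g + relabel Inr f = relabel Inl g' + relabel Inr f'"
  shows "g = g'" "f = f'"
proof -
  let ?l = "lin (case_sum (\<lambda>a. Poly_Mapping.single a 1) (\<lambda>_. 0))"
  let ?r = "lin (case_sum (\<lambda>_. 0) (\<lambda>a. Poly_Mapping.single a 1))"
  have "?l (relabel Inl x + relabel Inr y) = x" "?r (relabel Inl x + relabel Inr y) = y" for x y
    by (simp_all add: lin_add lin_relabel lin_single_id lin_eq_zero)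
  with assms show "g = g'" "f = f'" by metis+
qed

lemma basis_mapping_cone:
  "basis (mapping_cone G F \<psi>) 0 = Inr ` basis F 0"
  "basis (mapping_cone G F \<psi>) (Suc i) = Inl ` basis G i \<union> Inr ` basis F (Suc i)"
  by (simp_all add: mapping_cone_def)

lemma diff_mapping_cone:
  "diff (mapping_cone G F \<psi>) (Inl g) = - relabel Inl (diff G g) + relabel Inr (\<psi> g)"
  "diff (mapping_cone G F \<psi>) (Inr f) = relabel Inr (diff F f)"
  by (simp_all add: mapping_cone_def)

lemma mdeg_mapping_cone:
  "mdeg (mapping_cone G F \<psi>) (Inl g) = mdeg G g"
  "mdeg (mapping_cone G F \<psi>) (Inr f) = mdeg F f"
  by (simp_all add: mapping_cone_def)

lemma lin_diff_mapping_cone: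
  "lin (diff (mapping_cone G F \<psi>)) (relabel Inl g + relabel Inr f) =
     relabel Inl (- lin (diff G) g) + relabel Inr (lin \<psi> g + lin (diff F) f)"
  unfolding lin_add lin_relabel diff_mapping_cone lin_add_fun lin_uminus_fun relabel_lin relabel_add
    relabel_simps
  by simp

lemma free_mapping_cone:
  "free (basis (mapping_cone G F \<psi>) (Suc i)) =
     {relabel Inl g + relabel Inr f | g f. g \<in> free (basis G i) \<and> f \<in> free (basis F (Suc i))}"
  (is "?L = ?R")
proof
  show "?L \<subseteq> ?R"
  proof
    fix x assume "x \<in> ?L"
    then obtain y z where yz: "y \<in> free (Inl ` basis G i)" "z \<in> free (Inr ` basis F (Suc i))" "x = y + z"
      unfolding basis_mapping_cone by (rule free_Un_split)
    from yz(1) obtain g where "g \<in> free (basis G i)" "relabel Inl g = y" by (rule relabel_surj)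
    moreover from yz(2) obtain f where "f \<in> free (basis F (Suc i))" "relabel Inr f = z"
      by (rule relabel_surj)
    ultimately show "x \<in> ?R" using yz(3) by blast
  qed
  show "?R \<subseteq> ?L" unfolding basis_mapping_cone
    by (auto intro!: free_add intro: relabel_free)
qed

text \<open>Applied twice to a generator from \<open>G\<close>, the differential leaves the mixed
  term d(\<psi> g) - \<psi>(d g) beside the squares of the two differentials; the minus sign in the
  cone makes it vanish for a chain map.\<close>

lemma mapping_cone_graded:
  assumes G: "graded_complex G" and F: "graded_complex F" and \<psi>: "chain_map G F \<psi>"
  shows "graded_complex (mapping_cone G F \<psi>)" (is "graded_complex ?C")
  unfolding graded_complex_def
proof (intro conjI allI ballI)
  fix i
  show "finite (basis ?C i)"
    using graded_complexD(1)[OF G] graded_complexD(1)[OF F]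
    by (cases i) (simp_all add: basis_mapping_cone)
  fix b assume "b \<in> basis ?C (Suc i)"
  then consider (l) g where "b = Inl g" "g \<in> basis G i" | (r) f where "b = Inr f" "f \<in> basis F (Suc i)"
    by (auto simp: basis_mapping_cone)
  then have "diff ?C b \<in> free (basis ?C i) \<and>
    homogeneous (mdeg ?C) (mdeg ?C b) (diff ?C b) \<and> lin (diff ?C) (diff ?C b) = 0"
  proof cases
    case r
    note d = graded_complexD(3-5)[OF F r(2)]
    have "Inr ` basis F i \<subseteq> basis ?C i" by (cases i) (auto simp: basis_mapping_cone)
    moreover have "relabel Inr (diff F f) \<in> free (Inr ` basis F i)"
      using d(1) by (rule relabel_free) simp
    ultimately have "diff ?C b \<in> free (basis ?C i)"
      by (auto simp: r diff_mapping_cone intro: free_mono)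
    moreover have "homogeneous (mdeg ?C) (mdeg ?C b) (diff ?C b)"
      unfolding r diff_mapping_cone mdeg_mapping_cone using d(2,1)
      by (rule homogeneous_relabel) (auto simp: mdeg_mapping_cone)
    moreover have "lin (diff ?C) (diff ?C b) = 0"
      using d(3) lin_diff_mapping_cone[of G F \<psi> 0 "diff F f"] by (simp add: r diff_mapping_cone)
    ultimately show ?thesis by blast
  next
    case l
    have p: "\<psi> g \<in> free (basis F i)" "homogeneous (mdeg F) (mdeg G g) (\<psi> g)"
       "lin \<psi> (diff G g) = lin (diff F) (\<psi> g)"
      using \<psi> l(2) by (auto simp: chain_map_def)
    \<comment> \<open>In degree 0 of \<open>G\<close> both facts hold because the differential is 0
      there; the general rules speak of successor degrees only.\<close>
    have d: "homogeneous (mdeg G) (mdeg G g) (diff G g)" "lin (diff G) (diff G g) = 0"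
      using graded_complexD(2)[OF G, of g] graded_complexD(4,5)[OF G, of g] l(2)
      by (cases i; simp)+
    have "Inr ` basis F i \<subseteq> basis ?C i" by (cases i) (auto simp: basis_mapping_cone)
    moreover have "relabel Inr (\<psi> g) \<in> free (Inr ` basis F i)"
      using p(1) by (rule relabel_free) simp
    ultimately have 1: "relabel Inr (\<psi> g) \<in> free (basis ?C i)" by (rule free_mono[rotated])
    have 2: "relabel Inl (diff G g) \<in> free (basis ?C i)"
    proof (cases i)
      case 0
      then show ?thesis using graded_complexD(2)[OF G, of g] l(2) by simp
    next
      case (Suc i')
      have "diff G g \<in> free (basis G i')" using graded_complexD(3)[OF G] l(2) Suc by simp
      then show ?thesis unfolding Suc by (rule relabel_free) (simp add: basis_mapping_cone)
    qed
    have 3: "homogeneous (mdeg ?C) (mdeg G g) (relabel Inr (\<psi> g))"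
      using p(2,1) by (rule homogeneous_relabel) (auto simp: mdeg_mapping_cone)
    have 4: "homogeneous (mdeg ?C) (mdeg G g) (relabel Inl (diff G g))"
      using d(1) by (rule homogeneous_relabel[where A = UNIV]) (auto simp: mdeg_mapping_cone free_def)
    have "lin (diff ?C) (diff ?C b) = 0"
      using lin_diff_mapping_cone[of G F \<psi> "- diff G g" "\<psi> g"] d(2) p(3)
      by (simp add: l diff_mapping_cone)
    then show ?thesis using 1 2 3 4
      unfolding l diff_mapping_cone mdeg_mapping_cone
      by (intro conjI free_add free_uminus homogeneous_add homogeneous_uminus)
  qed
  then show "diff ?C b \<in> free (basis ?C i)" "homogeneous (mdeg ?C) (mdeg ?C b) (diff ?C b)"
    "lin (diff ?C) (diff ?C b) = 0" by auto
next
  fix b assume "b \<in> basis ?C 0"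
  then show "diff ?C b = 0"
    using graded_complexD(2)[OF F] by (auto simp: basis_mapping_cone diff_mapping_cone)
qed

lemma graded_shift:
  assumes "graded_complex G"
  shows "graded_complex (shift t G)"
  using assms by (auto simp: graded_complex_def shift_def intro: homogeneous_shift)

text \<open>The exact sequence of the cone, carried out on elements. The colon ideal enters in the
  lowest degree, where it makes a cycle coming from \<open>G\<close> a boundary of \<open>G\<close>;
  in higher degrees exactness of \<open>G\<close> does this. Exactness of \<open>F\<close> then
  corrects the second component.\<close>

lemma mapping_cone_resolves:
  fixes G :: "('n, 'k::field, 'a) based_complex" and F :: "('n, 'k, 'b) based_complex"
  assumes G: "resolves u (colon (ideal_gen A) p) G" and F: "resolves v (ideal_gen A) F"
    and \<psi>: "chain_map (shift t G) F \<psi>" and lift: "lifts_mult u v (ideal_gen A) p \<psi>"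
  shows "resolves (Inr v) (ideal_gen (insert p A)) (mapping_cone (shift t G) F \<psi>)"
    (is "resolves _ _ ?C")
proof -
  let ?J = "ideal_gen A" and ?dG = "lin (diff G)" and ?dF = "lin (diff F)"
  have grG: "graded_complex G" and uG: "basis G 0 = {u}"
    and imG: "(\<lambda>x. lkp x u) ` ?dG ` free (basis G 1) = colon ?J p"
    and exG: "\<And>i. ?dG ` free (basis G (Suc (Suc i))) = {x \<in> free (basis G (Suc i)). ?dG x = 0}"
    using G by (auto simp: resolves_def)
  have grF: "graded_complex F" and vF: "basis F 0 = {v}" "mdeg F v = 0"
    and imF: "(\<lambda>x. lkp x v) ` ?dF ` free (basis F 1) = ?J"
    and exF: "\<And>i. ?dF ` free (basis F (Suc (Suc i))) = {x \<in> free (basis F (Suc i)). ?dF x = 0}"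
    using F by (auto simp: resolves_def)
  have gr: "graded_complex ?C" using mapping_cone_graded[OF graded_shift[OF grG] grF \<psi>] .
  have sh: "basis (shift t G) = basis G" "diff (shift t G) = diff G" by (simp_all add: shift_def)
  have dC: "lin (diff ?C) (relabel Inl g + relabel Inr f) =
      relabel Inl (- ?dG g) + relabel Inr (lin \<psi> g + ?dF f)" for g f
    by (simp add: lin_diff_mapping_cone sh)
  have fC: "free (basis ?C (Suc i)) =
     {relabel Inl g + relabel Inr f | g f. g \<in> free (basis G i) \<and> f \<in> free (basis F (Suc i))}" for i
    by (simp add: free_mapping_cone sh)
  have dF_free: "?dF f \<in> free (basis F i)" if "f \<in> free (basis F (Suc i))" for f i
    using that graded_complexD(3)[OF grF] by (rule lin_free)
  have dG_free: "?dG g \<in> free (basis G i)" if "g \<in> free (basis G (Suc i))" for g i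
    using that graded_complexD(3)[OF grG] by (rule lin_free)
  have \<psi>_free: "lin \<psi> g \<in> free (basis F i)" if "g \<in> free (basis G i)" for g i
    using that by (rule lin_free) (use \<psi> in \<open>auto simp: chain_map_def sh\<close>)
  have \<psi>_d: "lin \<psi> (?dG g) = ?dF (lin \<psi> g)" if "g \<in> free (basis G i)" for g i
    unfolding lin_lin using that by (rule lin_free_cong) (use \<psi> in \<open>auto simp: chain_map_def sh\<close>)
  have dG0: "?dG g = 0" if "g \<in> free (basis G 0)" for g
    using that graded_complexD(2)[OF grG] by (rule lin_free_zero)
  have lift0: "lkp (lin \<psi> g) v - p * lkp g u \<in> ?J" if "g \<in> free (basis G 0)" for g
    using lift that by (simp add: lifts_mult_def uG)
  have free_v_eqI: "x = y" if "x \<in> free (basis F 0)" "y \<in> free (basis F 0)" "lkp x v = lkp y v" for x y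
    using that unfolding vF by (elim free_singletonE) simp
  \<comment> \<open>In degree 0 exactness of \<open>G\<close> says nothing. There \<psi> g lies in J
    up to sign as an image from \<open>F\<close>, and \<psi> g is p times g modulo J, so g lies in
    the colon ideal, which is the image of the differential of \<open>G\<close>.\<close>
  have exG': "\<exists>g'\<in>free (basis G (Suc i)). g = ?dG g'"
    if "g \<in> free (basis G i)" "f \<in> free (basis F (Suc i))" "?dG g = 0" "lin \<psi> g + ?dF f = 0" for g f i
  proof (cases i)
    case (Suc i')
    then show ?thesis using exG[of i'] that by (force simp: image_def)
  next
    case 0
    have "lkp (?dF f) v \<in> ?J" using imF that(2) 0 by auto
    moreover have "lkp (lin \<psi> g) v + lkp (?dF f) v = 0"
      using that(4) by (metis lookup_add lookup_zero)
    ultimately have "lkp (lin \<psi> g) v \<in> ?J" using ideal_gen_diff[of 0 A] by (metis add.commute diff_0 eq_neg_iff_add_eq_0 ideal_gen_zero)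
    with lift0[of g] that(1) 0 have "p * lkp g u \<in> ?J"
      using ideal_gen_diff by (metis diff_diff_eq2 add_diff_cancel_left')
    then have "lkp g u \<in> colon ?J p" by (simp add: colon_def mult.commute)
    then obtain g' where g': "g' \<in> free (basis G 1)" "lkp (?dG g') u = lkp g u"
      unfolding imG[symmetric] by auto
    have "?dG g' \<in> free {u}" "g \<in> free {u}" using dG_free[of g' 0] g'(1) that(1) 0 uG by simp_all
    with g'(2) have "g = ?dG g'" by (elim free_singletonE) simp
    then show ?thesis using g'(1) 0 by auto
  qed
  have exC: "lin (diff ?C) ` free (basis ?C (Suc (Suc i))) =
          {x \<in> free (basis ?C (Suc i)). lin (diff ?C) x = 0}" for i
  proof (intro equalityI subsetI)
    fix x assume "x \<in> lin (diff ?C) ` free (basis ?C (Suc (Suc i)))"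
    then obtain y where y: "y \<in> free (basis ?C (Suc (Suc i)))" "x = lin (diff ?C) y" by blast
    have "x \<in> free (basis ?C (Suc i))" unfolding y using y(1) graded_complexD(3)[OF gr] by (rule lin_free)
    moreover have "lin (diff ?C) x = 0"
      unfolding y lin_lin using y(1) graded_complexD(5)[OF gr] by (rule lin_free_zero)
    ultimately show "x \<in> {x \<in> free (basis ?C (Suc i)). lin (diff ?C) x = 0}" by blast
  next
    fix x assume x: "x \<in> {x \<in> free (basis ?C (Suc i)). lin (diff ?C) x = 0}"
    then obtain g f where gf: "g \<in> free (basis G i)" "f \<in> free (basis F (Suc i))"
      "x = relabel Inl g + relabel Inr f" by (auto simp: fC)
    have "relabel Inl (- ?dG g) + relabel Inr (lin \<psi> g + ?dF f) = relabel Inl 0 + relabel Inr 0"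
      using x dC[of g f] gf(3) by simp
    from relabel_Inl_Inr_inject[OF this] have z: "?dG g = 0" "lin \<psi> g + ?dF f = 0" by simp_all
    from exG'[OF gf(1,2) z] obtain g' where g': "g' \<in> free (basis G (Suc i))" "g = ?dG g'" by blast
    \<comment> \<open>Since g = d g', the chain map property turns the cycle condition into d(f +
      \<psi> g') = 0. With f' a preimage of f + \<psi> g', the pair (-g', f') is mapped to (g, f),
      the minus sign undoing that of the cone.\<close>
    have "?dF (f + lin \<psi> g') = 0" using z(2) \<psi>_d[OF g'(1)] g'(2) by (simp add: lin_add add.commute)
    moreover have "f + lin \<psi> g' \<in> free (basis F (Suc i))" using gf(2) \<psi>_free[OF g'(1)] by (rule free_add)
    ultimately obtain f' where f': "f' \<in> free (basis F (Suc (Suc i)))" "f + lin \<psi> g' = ?dF f'"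
      using exF[of i] by (auto simp: image_def)
    have "x = lin (diff ?C) (relabel Inl (- g') + relabel Inr f')"
      unfolding dC gf(3) using g'(2) f'(2)[symmetric] by simp
    moreover have "relabel Inl (- g') + relabel Inr f' \<in> free (basis ?C (Suc (Suc i)))"
      unfolding fC using g'(1) f'(1) free_uminus by blast
    ultimately show "x \<in> lin (diff ?C) ` free (basis ?C (Suc (Suc i)))" by blast
  qed
  have lkp_Inr: "lkp (relabel Inl x + relabel Inr y) (Inr v) = lkp y v"
    for x :: "'a \<Rightarrow>\<^sub>0 ('n, 'k) mpoly" and y :: "'b \<Rightarrow>\<^sub>0 ('n, 'k) mpoly"
  proof -
    have "relabel Inl x \<in> free (range Inl)" by (rule relabel_free[of _ UNIV]) (auto simp: free_def)
    then have "lkp (relabel Inl x) (Inr v) = 0" by (auto simp: free_iff)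
    moreover have "lkp (relabel Inr y) (Inr v) = lkp y v"
      by (rule lookup_relabel[of _ UNIV]) (auto simp: free_def)
    ultimately show ?thesis by (simp add: lookup_add)
  qed
  have "(free (basis ?C 1) :: ('a + 'b \<Rightarrow>\<^sub>0 ('n, 'k) mpoly) set) =
      (\<lambda>(g, f). relabel Inl g + relabel Inr f) ` (free (basis G 0) \<times> free (basis F 1))"
    using fC[of 0] by auto
  then have "(\<lambda>x. lkp x (Inr v)) ` lin (diff ?C) ` free (basis ?C 1) =
      (\<lambda>(g, f). lkp (lin \<psi> g + ?dF f) v) ` (free (basis G 0) \<times> free (basis F 1))"
    by (simp only: image_image split_def dC lkp_Inr)
  also have "\<dots> = ideal_gen (insert p A)"
    unfolding ideal_gen_insert lookup_add
  proof (intro equalityI subsetI; clarify)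
    fix g :: "'a \<Rightarrow>\<^sub>0 ('n, 'k) mpoly" and f :: "'b \<Rightarrow>\<^sub>0 ('n, 'k) mpoly"
    assume gf: "g \<in> free (basis G 0)" "f \<in> free (basis F 1)"
    have "lkp (?dF f) v \<in> ?J" using imF gf(2) by auto
    with lift0[OF gf(1)] have "lkp (lin \<psi> g) v - p * lkp g u + lkp (?dF f) v \<in> ?J"
      by (rule ideal_gen_add)
    then show "\<exists>r. lkp (lin \<psi> g) v + lkp (?dF f) v - r * p \<in> ?J"
      by (intro exI[of _ "lkp g u"]) (simp add: algebra_simps)
  next
    fix x r assume x: "x - r * p \<in> ?J"
    \<comment> \<open>The multiple r*p is reached by r times the generator of \<open>G\<close> in
      degree 0, up to an error in J, and J is the image of \<open>F\<close> in degree 1.\<close>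
    let ?g = "Poly_Mapping.single u r"
    have g: "?g \<in> free (basis G 0)" by (simp add: uG free_single)
    have "x - r * p - (lkp (lin \<psi> ?g) v - p * lkp ?g u) \<in> ?J"
      using x lift0[OF g] by (rule ideal_gen_diff)
    then have "x - lkp (lin \<psi> ?g) v \<in> ?J" by (simp add: algebra_simps)
    then obtain f where f: "f \<in> free (basis F 1)" "x - lkp (lin \<psi> ?g) v = lkp (?dF f) v"
      using imF by (auto simp: image_def)
    then have "x = lkp (lin \<psi> ?g) v + lkp (?dF f) v" by (simp add: algebra_simps)
    then show "x \<in> (\<lambda>(g, f). lkp (lin \<psi> g) v + lkp (?dF f) v) ` (free (basis G 0) \<times> free (basis F 1))"
      using g f(1) by (intro image_eqI[of _ _ "(?g, f)"]) auto
  qed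
  finally show ?thesis
    unfolding resolves_def using gr exC vF by (simp add: basis_mapping_cone mdeg_mapping_cone)
qed

section \<open>The Koszul complex\<close>

lemma card_le_elt:
  fixes A :: "'a::linorder set"
  assumes "finite A" "1 \<le> i" "i \<le> card A"
  shows "elt A i \<in> A" "card {k \<in> A. k \<le> elt A i} = i"
proof -
  define xs where "xs = sorted_list_of_set A"
  have xs: "set xs = A" "sorted_wrt (<) xs" "length xs = card A"
    using assms(1) by (auto simp: xs_def)
  then show "elt A i \<in> A" using assms by (auto simp: elt_def xs_def[symmetric] intro: nth_mem)
  have e: "elt A i = xs ! (i - 1)" by (simp add: elt_def xs_def)
  have lt: "xs ! a < xs ! b \<longleftrightarrow> a < b" if "a < card A" "b < card A" for a b
    using that xs(2,3) by (metis linorder_neqE_nat order_less_asym sorted_wrt_nth_less order_less_irrefl)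
  have "{k \<in> A. k \<le> elt A i} = (\<lambda>a. xs ! a) ` {..<i}"
  proof (intro equalityI subsetI)
    fix k assume k: "k \<in> {k \<in> A. k \<le> elt A i}"
    then obtain a where a: "a < card A" "k = xs ! a" using xs by (metis (mono_tags, lifting) in_set_conv_nth mem_Collect_eq)
    with k e have "\<not> i - 1 < a" using lt[of "i - 1" a] assms by auto
    then show "k \<in> (\<lambda>a. xs ! a) ` {..<i}" using a assms by auto
  next
    fix k assume "k \<in> (\<lambda>a. xs ! a) ` {..<i}"
    then obtain a where a: "a < i" "k = xs ! a" by auto
    then have "a = i - 1 \<or> a < i - 1" by auto
    then have "k \<le> elt A i" using a e lt[of a "i - 1"] assms by (auto intro: less_imp_le)
    then show "k \<in> {k \<in> A. k \<le> elt A i}" using a xs assms by (auto intro: nth_mem)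
  qed
  moreover have "inj_on (\<lambda>a. xs ! a) {..<i}"
    by (rule inj_onI) (use lt assms in \<open>metis lessThan_iff linorder_neqE_nat order_less_irrefl order_less_le_trans\<close>)
  ultimately show "card {k \<in> A. k \<le> elt A i} = i" by (simp add: card_image)
qed

lemma elt_card_le:
  fixes A :: "'a::linorder set"
  assumes "finite A" "j \<in> A"
  shows "elt A (card {k \<in> A. k \<le> j}) = j"
proof -
  have "j \<in> set (sorted_list_of_set A)" using assms by simp
  then obtain a where a: "a < card A" "j = sorted_list_of_set A ! a"
    using assms(1) by (metis in_set_conv_nth length_sorted_list_of_set)
  then have "j = elt A (Suc a)" by (simp add: elt_def)
  then show ?thesis using card_le_elt(2)[of A "Suc a"] a assms by simp
qed

lemma card_le_bounds:
  fixes A :: "'a::linorder set"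
  assumes "finite A" "j \<in> A"
  shows "1 \<le> card {k \<in> A. k \<le> j}" "card {k \<in> A. k \<le> j} \<le> card A"
proof -
  have "{k \<in> A. k \<le> j} \<noteq> {}" using assms by auto
  then show "1 \<le> card {k \<in> A. k \<le> j}" using assms(1) by (simp add: Suc_le_eq card_gt_0_iff)
  show "card {k \<in> A. k \<le> j} \<le> card A" using assms(1) by (intro card_mono) auto
qed

lemma card_le_eq_Suc_card_less:
  fixes A :: "'a::linorder set"
  assumes "finite A" "j \<in> A"
  shows "card {k \<in> A. k \<le> j} = Suc (card {k \<in> A. k < j})"
proof -
  have "{k \<in> A. k \<le> j} = insert j {k \<in> A. k < j}" using assms by auto
  then show ?thesis using assms by simp
qed

text \<open>Exchanges the positions i of the displayed formulas for elements j. The position becomes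
  the number of elements at or below j, a quantity whose change under insertion and removal is
  visible.\<close>

lemma sum_elt:
  fixes A :: "'a::linorder set"
  assumes "finite A"
  shows "(\<Sum>i\<in>{i \<in> {1..card A}. P (elt A i)}. h (elt A i) i) =
    (\<Sum>j\<in>{j \<in> A. P j}. h j (card {k \<in> A. k \<le> j}))"
proof (rule sum.reindex_bij_witness[where j = "elt A" and i = "\<lambda>j. card {k \<in> A. k \<le> j}"])
  fix i assume "i \<in> {i \<in> {1..card A}. P (elt A i)}"
  then show "card {k \<in> A. k \<le> elt A i} = i" "elt A i \<in> {j \<in> A. P j}"
    "h (elt A i) (card {k \<in> A. k \<le> elt A i}) = h (elt A i) i"
    using card_le_elt[OF assms, of i] by auto
next
  fix j assume "j \<in> {j \<in> A. P j}"
  then show "elt A (card {k \<in> A. k \<le> j}) = j" "card {k \<in> A. k \<le> j} \<in> {i \<in> {1..card A}. P (elt A i)}"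
    using elt_card_le[OF assms] card_le_bounds[OF assms] by auto
qed

lemma sum_elt_all:
  fixes A :: "'a::linorder set"
  assumes "finite A"
  shows "(\<Sum>i = 1..card A. h (elt A i) i) = (\<Sum>j\<in>A. h j (card {k \<in> A. k \<le> j}))"
  using sum_elt[OF assms, where P = "\<lambda>_. True" and h = h] by (simp only: simp_thms Collect_mem_eq)

section \<open>The Koszul complex as an iterated mapping cone\<close>

lemma basis_koszul: "basis (koszul S) p = {\<alpha>. \<alpha> \<subseteq> S \<and> card \<alpha> = p}"
  and mdeg_koszul: "mdeg (koszul S) = mon"
  by (simp_all add: koszul_def)

text \<open>One formula serves every S, so differentials of Koszul complexes on different sets of
  variables can be exchanged for each other.\<close>

lemma diff_koszul:
  "diff (koszul S :: ('n::{finite,linorder}, 'k::field, _) based_complex) \<alpha> =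
     (\<Sum>j\<in>\<alpha>. Poly_Mapping.single (\<alpha> - {j}) ((-1) ^ card {k \<in> \<alpha>. k < j} * var j))"
proof -
  have "diff (koszul S :: ('n, 'k, _) based_complex) \<alpha> =
     (\<Sum>j\<in>\<alpha>. Poly_Mapping.single (\<alpha> - {j}) ((-1) ^ (card {k \<in> \<alpha>. k \<le> j} - 1) * var j))"
    using sum_elt_all[OF finite[of \<alpha>],
          where h = "\<lambda>j i. Poly_Mapping.single (\<alpha> - {j}) ((-1) ^ (i - 1) * (var j :: ('n, 'k) mpoly))"]
    by (simp add: koszul_def)
  then show ?thesis by (simp add: card_le_eq_Suc_card_less)
qed

lemma shift_simps [simp]:
  "basis (shift t F) = basis F" "diff (shift t F) = diff F" "mdeg (shift t F) = (\<lambda>b. t + mdeg F b)"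
  by (simp_all add: shift_def)

lemma koszul_empty_resolves: "resolves {} {0} (koszul {} :: ('n::{finite,linorder}, 'k::field, _) based_complex)"
proof -
  have b: "basis (koszul {} :: ('n, 'k, _) based_complex) i = (if i = 0 then {{}} else {})" for i
    by (auto simp: basis_koszul)
  show ?thesis
    by (auto simp: resolves_def graded_complex_def b mdeg_koszul diff_koszul)
qed

text \<open>x_s is a nonzerodivisor modulo the variables in S. Hence in the cone of multiplication
  by x_s the same Koszul complex can serve as source and as target.\<close>

lemma colon_variables:
  assumes "s \<notin> S"
  shows "colon (ideal_gen (var ` S)) (var s) = (ideal_gen (var ` S) :: ('n::finite, 'k::field) mpoly set)"
proof -
  have v: "var ` S = monomial ` (\<lambda>i. mon {i}) ` S" by (auto simp: var_eq)
  show ?thesis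
    unfolding v var_eq
    by (rule colon_monomial_ideal_eqI)
      (use assms in \<open>auto simp: adds_iff_le lookup_add lookup_mon split: if_splits\<close>)
qed

lemma koszul_cone_chain_map:
  fixes S :: "'n::{finite,linorder} set"
  defines "K \<equiv> koszul S :: ('n, 'k::field, 'n set) based_complex"
  shows "chain_map (shift (mon {s}) K) K (\<lambda>\<alpha>. Poly_Mapping.single \<alpha> (var s))"
  unfolding chain_map_def
proof (intro allI ballI conjI)
  let ?\<psi> = "\<lambda>\<alpha>. Poly_Mapping.single \<alpha> (var s :: ('n, 'k) mpoly)"
  fix i \<alpha> assume "\<alpha> \<in> basis (shift (mon {s}) K) i"
  then show "?\<psi> \<alpha> \<in> free (basis K i)" by (auto simp: shift_def intro: free_single)
  show "homogeneous (mdeg K) (mdeg (shift (mon {s}) K) \<alpha>) (?\<psi> \<alpha>)"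
    by (rule homogeneous_single) (simp add: K_def var_eq mdeg_koszul shift_def)
  have "lin ?\<psi> x = smult (var s) x" for x :: "'n set \<Rightarrow>\<^sub>0 ('n, 'k) mpoly"
  proof -
    have "lin ?\<psi> x = lin (\<lambda>a. smult (var s) (Poly_Mapping.single a 1)) x" by simp
    also have "\<dots> = smult (var s) (lin (\<lambda>a. Poly_Mapping.single a 1) x)"
      by (simp add: lin_eq_sum[OF finite_keys[of x] order_refl] smult_sum mult.commute)
    finally show ?thesis by (simp add: lin_single_id)
  qed
  then show "lin ?\<psi> (diff (shift (mon {s}) K) \<alpha>) = lin (diff K) (?\<psi> \<alpha>)"
    by (simp add: shift_def)
qed

text \<open>The new variable has to be the least one: then every j in \<alpha> moves up by one
  position, which produces the minus sign of the cone, and s itself comes first, so that its removal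
  has the sign + of the map x_s.\<close>

lemma koszul_insert_iso:
  fixes S :: "'n::{finite,linorder} set"
  assumes "\<And>j. j \<in> S \<Longrightarrow> s < j"
  shows "based_iso (case_sum (insert s) id)
     (mapping_cone (shift (mon {s}) (koszul S)) (koszul S) (\<lambda>\<alpha>. Poly_Mapping.single \<alpha> (var s)))
     (koszul (insert s S) :: ('n, 'k::field, _) based_complex)"
    (is "based_iso ?f ?C ?K")
  unfolding based_iso_def
proof (intro allI conjI ballI)
  have s: "s \<notin> \<alpha>" if "\<alpha> \<subseteq> S" for \<alpha> using assms that by blast
  fix i
  show "bij_betw ?f (basis ?C i) (basis ?K i)"
  proof (cases i)
    case 0
    have "basis ?C 0 = {Inr {}}" "basis ?K 0 = {{}}"
      by (auto simp: basis_mapping_cone basis_koszul)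
    then show ?thesis using 0 by (simp add: bij_betw_def)
  next
    case (Suc p)
    have C: "basis ?C i = Inl ` {\<alpha>. \<alpha> \<subseteq> S \<and> card \<alpha> = p} \<union> Inr ` {\<alpha>. \<alpha> \<subseteq> S \<and> card \<alpha> = Suc p}"
      unfolding Suc basis_mapping_cone shift_simps basis_koszul ..
    have K: "basis ?K i = {\<alpha>. \<alpha> \<subseteq> insert s S \<and> card \<alpha> = Suc p}"
      unfolding Suc basis_koszul ..
    have "inj_on ?f (basis ?C i)"
      unfolding C by (intro inj_onI) (auto dest!: s)
    moreover have "?f ` basis ?C i = basis ?K i"
    proof (intro equalityI subsetI)
      fix \<beta> assume "\<beta> \<in> ?f ` basis ?C i"
      then consider \<alpha> where "\<alpha> \<subseteq> S" "card \<alpha> = p" "\<beta> = insert s \<alpha>" | "\<beta> \<subseteq> S" "card \<beta> = Suc p"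
        unfolding C by (elim imageE UnE) auto
      then show "\<beta> \<in> basis ?K i"
        unfolding K by cases (use s in \<open>auto simp: card_insert_if\<close>)
    next
      fix \<beta> assume \<beta>: "\<beta> \<in> basis ?K i"
      show "\<beta> \<in> ?f ` basis ?C i"
      proof (cases "s \<in> \<beta>")
        case True
        then have "\<beta> - {s} \<subseteq> S" "card (\<beta> - {s}) = p" using \<beta> unfolding K by auto
        then have "Inl (\<beta> - {s}) \<in> basis ?C i" unfolding C by blast
        moreover have "\<beta> = ?f (Inl (\<beta> - {s}))" using True by auto
        ultimately show ?thesis by (rule image_eqI[rotated])
      next
        case False
        then have "\<beta> \<subseteq> S" "card \<beta> = Suc p" using \<beta> unfolding K by auto
        then have "Inr \<beta> \<in> basis ?C i" unfolding C by blast
        moreover have "\<beta> = ?f (Inr \<beta>)" by simp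
        ultimately show ?thesis by (rule image_eqI[rotated])
      qed
    qed
    ultimately show ?thesis by (simp add: bij_betw_def)
  qed
  fix b assume b: "b \<in> basis ?C i"
  have "mdeg ?K (?f b) = mdeg ?C b \<and> diff ?K (?f b) = relabel ?f (diff ?C b)"
  proof (cases b)
    case (Inr \<alpha>)
    then show ?thesis by (simp add: mdeg_mapping_cone diff_mapping_cone mdeg_koszul relabel_relabel diff_koszul relabel_sum)
  next
    case (Inl \<alpha>)
    then have \<alpha>: "\<alpha> \<subseteq> S" using b by (cases i) (simp_all add: basis_mapping_cone basis_koszul image_iff)
    have less: "{k \<in> insert s \<alpha>. k < j} = insert s {k \<in> \<alpha>. k < j}" if "j \<in> \<alpha>" for j
      using that \<alpha> assms by auto
    have "{k \<in> insert s \<alpha>. k < s} = {}" using \<alpha> assms by (auto dest: less_asym)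
    then have "card {k \<in> insert s \<alpha>. k < s} = 0" by (simp only: card.empty)
    moreover have "insert s \<alpha> - {s} = \<alpha>" using s[OF \<alpha>] by simp
    ultimately have "diff ?K (insert s \<alpha>) = Poly_Mapping.single \<alpha> (var s) +
      (\<Sum>j\<in>\<alpha>. Poly_Mapping.single (insert s \<alpha> - {j}) ((-1) ^ card {k \<in> insert s \<alpha>. k < j} * var j))"
      using s[OF \<alpha>] by (simp add: diff_koszul del: insert_iff card_0_eq card_eq_0_iff)
    also have "(\<Sum>j\<in>\<alpha>. Poly_Mapping.single (insert s \<alpha> - {j}) ((-1) ^ card {k \<in> insert s \<alpha>. k < j} * var j)) =
      (\<Sum>j\<in>\<alpha>. - Poly_Mapping.single (insert s (\<alpha> - {j})) ((-1) ^ card {k \<in> \<alpha>. k < j} * var j :: ('n, 'k) mpoly))"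
    proof (rule sum.cong[OF refl])
      fix j assume j: "j \<in> \<alpha>"
      then have "insert s \<alpha> - {j} = insert s (\<alpha> - {j})" using s[OF \<alpha>] by auto
      then show "Poly_Mapping.single (insert s \<alpha> - {j}) ((-1) ^ card {k \<in> insert s \<alpha>. k < j} * var j) =
        - Poly_Mapping.single (insert s (\<alpha> - {j})) ((-1) ^ card {k \<in> \<alpha>. k < j} * var j :: ('n, 'k) mpoly)"
        unfolding less[OF j] using s[OF \<alpha>] by (simp add: single_uminus)
    qed
    also have "Poly_Mapping.single \<alpha> (var s) + \<dots> = relabel ?f (diff ?C (Inl \<alpha>))"
      by (simp add: diff_mapping_cone relabel_add relabel_diff relabel_relabel diff_koszul relabel_sum sum_negf)
    finally have "diff ?K (?f b) = relabel ?f (diff ?C b)" by (simp only: Inl sum.case)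
    moreover have "mdeg ?K (?f b) = mdeg ?C b"
      unfolding Inl mdeg_mapping_cone mdeg_koszul shift_simps sum.case
      by (rule mon_insert) (use s[OF \<alpha>] in auto)
    ultimately show ?thesis by blast
  qed
  then show "mdeg ?K (?f b) = mdeg ?C b" "diff ?K (?f b) = relabel ?f (diff ?C b)" by auto
qed

lemma koszul_resolves:
  "resolves {} (ideal_gen (var ` S)) (koszul S :: ('n::{finite,linorder}, 'k::field, _) based_complex)"
  using finite[of S]
proof (induction S rule: finite_linorder_min_induct)
  case empty
  then show ?case by (simp add: koszul_empty_resolves)
next
  case (insert s S)
  let ?K = "koszul S :: ('n, 'k, _) based_complex"
  have "s \<notin> S" using insert by auto
  then have "resolves {} (colon (ideal_gen (var ` S)) (var s)) ?K"
    using insert.IH by (simp add: colon_variables)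
  moreover have "lifts_mult {} {} (ideal_gen (var ` S)) (var s) (\<lambda>\<alpha>. Poly_Mapping.single \<alpha> (var s :: ('n, 'k) mpoly))"
    by (auto simp: lifts_mult_def elim!: free_singletonE)
  ultimately have "resolves (Inr {}) (ideal_gen (insert (var s) (var ` S)))
    (mapping_cone (shift (mon {s}) ?K) ?K (\<lambda>\<alpha>. Poly_Mapping.single \<alpha> (var s)))"
    using insert.IH koszul_cone_chain_map by (intro mapping_cone_resolves)
  from based_iso_resolves[OF koszul_insert_iso this] insert show ?case by simp
qed

section \<open>Exchange properties of cointerval hypergraphs\<close>

lemma d_graph_layer: "d_graph (Suc d) H \<Longrightarrow> d_graph d (layer v H)"
  unfolding d_graph_def
proof (intro conjI ballI)
  assume H: "finite (verts H) \<and> (\<forall>e\<in>edges H. e \<subseteq> verts H \<and> card e = Suc d)"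
  then show "finite (verts (layer v H))" by (simp add: layer_def)
  fix e assume "e \<in> edges (layer v H)"
  then have e: "insert v e \<in> edges H" "\<forall>w\<in>e. v < w" by (auto simp: layer_def)
  have c: "card (insert v e) = Suc d" and sub: "insert v e \<subseteq> verts H"
    using bspec[OF conjunct2[OF H] e(1)] by blast+
  have "v \<notin> e" using e(2) by auto
  moreover have "finite e" using finite_subset[OF sub] H by simp
  ultimately show "card e = d" using c by simp
  show "e \<subseteq> verts (layer v H)" using sub e(2) by (auto simp: layer_def)
qed

text \<open>The analogue of \<open>gap\<close> for sorted lists, indexed from 0. Lists suit the
  recursion over layers, where passing to a layer strips the head.\<close>

definition in_gap :: "'a::linorder list \<Rightarrow> nat \<Rightarrow> 'a \<Rightarrow> bool" where
  "in_gap xs l j \<longleftrightarrow> l < length xs \<and> (l = 0 \<or> xs ! (l - 1) < j) \<and> j < xs ! l"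

lemma in_gap_Cons_Suc:
  assumes "sorted_wrt (<) (x # xs)" "in_gap (x # xs) (Suc l) j"
  shows "in_gap xs l j" "x < j"
  using assms by (cases l; auto simp: in_gap_def dest: nth_mem less_trans)+

lemma edges_layer_Cons:
  assumes "sorted_wrt (<) (x # xs)"
  shows "set xs \<in> edges (layer x H) \<longleftrightarrow> set (x # xs) \<in> edges H"
  using assms by (simp add: layer_def)

text \<open>At the head, lowering x to j is condition (2), the inclusion of the x-layer in the
  j-layer. Further positions are heads inside iterated layers. The last position is excluded,
  because it is governed by a 1-graph, on which there is no condition.\<close>

lemma cointerval_shift:
  assumes "cointerval d H" "d_graph d H" "sorted_wrt (<) xs" "length xs = d" "set xs \<in> edges H"
    "in_gap xs l j" "Suc l < d" "j \<in> verts H"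
  shows "set (xs[l := j]) \<in> edges H"
  using assms
proof (induction d H arbitrary: xs l rule: cointerval.induct)
  case (3 d H)
  obtain x xs' where xs: "xs = x # xs'" using 3(5) by (cases xs) auto
  have x: "x \<in> verts H" using 3(3,6) by (auto simp: d_graph_def xs)
  have xs': "set xs' \<in> edges (layer x H)" using 3(4,6) edges_layer_Cons xs by blast
  show ?case
  proof (cases l)
    case 0
    then have "j < x" using 3(7) by (simp add: in_gap_def xs)
    then have "set xs' \<in> edges (layer j H)" using 3(2,9) x xs' by auto
    then show ?thesis by (simp add: xs 0 layer_def)
  next
    case (Suc l')
    have g: "in_gap xs' l' j" "x < j"
      using in_gap_Cons_Suc[of x xs' l' j] 3(4,7) unfolding xs Suc by auto
    have "set (xs'[l' := j]) \<in> edges (layer x H)"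
    proof (rule 3(1)[OF x])
      show "cointerval (Suc d) (layer x H)" using 3(2) x by simp
      show "d_graph (Suc d) (layer x H)" using 3(3) by (rule d_graph_layer)
    qed (use 3(4-9) xs xs' g Suc in \<open>auto simp: layer_def\<close>)
    then show ?thesis by (simp add: xs Suc layer_def)
  qed
qed auto

text \<open>Replacements that are possible one at a time are possible simultaneously. Replacing the
  head x by y enlarges the layer, so the single replacements in the tail, known in the x-layer, are
  available in the y-layer, where induction applies.\<close>

lemma cointerval_exchange:
  assumes "cointerval d H" "d_graph d H" "sorted_wrt (<) xs" "length xs = d" "set xs \<in> edges H"
    "length ys = d"
    "\<And>l. l < d \<Longrightarrow> ys ! l = xs ! l \<or>
       (in_gap xs l (ys ! l) \<and> ys ! l \<in> verts H \<and> set (xs[l := ys ! l]) \<in> edges H)"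
  shows "set ys \<in> edges H"
  using assms
proof (induction d H arbitrary: xs ys rule: cointerval.induct)
  case (2 H)
  then obtain x y where "xs = [x]" "ys = [y]" by (auto simp: length_Suc_conv)
  then show ?case using 2(5) 2(7)[of 0] by auto
next
  case (3 d H)
  obtain x xs' where xs: "xs = x # xs'" using 3(5) by (cases xs) auto
  obtain y ys' where ys: "ys = y # ys'" using 3(7) by (cases ys) auto
  have x: "x \<in> verts H" using 3(3,6) by (auto simp: d_graph_def xs)
  have xs': "set xs' \<in> edges (layer x H)" using 3(4,6) edges_layer_Cons xs by blast
  have y: "y \<in> verts H" "y \<le> x" using 3(8)[of 0] x by (auto simp: xs ys in_gap_def)
  have sub: "edges (layer x H) \<subseteq> edges (layer y H)" using y x 3(2) by (cases "x = y") auto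
  have "set ys' \<in> edges (layer y H)"
  proof (rule 3(1)[OF y(1)])
    show "cointerval (Suc d) (layer y H)" using 3(2) y by simp
    show "d_graph (Suc d) (layer y H)" using 3(3) by (rule d_graph_layer)
    fix l assume l: "l < Suc d"
    show "ys' ! l = xs' ! l \<or>
      (in_gap xs' l (ys' ! l) \<and> ys' ! l \<in> verts (layer y H) \<and> set (xs'[l := ys' ! l]) \<in> edges (layer y H))"
    proof (cases "ys' ! l = xs' ! l")
      case False
      then have a: "in_gap (x # xs') (Suc l) (ys' ! l)" "ys' ! l \<in> verts H"
        "insert x (set (xs'[l := ys' ! l])) \<in> edges H"
        using 3(8)[of "Suc l"] l by (auto simp: xs ys)
      have g: "in_gap xs' l (ys' ! l)" "x < ys' ! l"
        using in_gap_Cons_Suc[OF _ a(1)] 3(4) xs by auto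
      have "\<forall>w\<in>set (xs'[l := ys' ! l]). x < w"
        using 3(4) g(2) set_update_subset_insert[of xs' l "ys' ! l"] by (auto simp: xs)
      then have "set (xs'[l := ys' ! l]) \<in> edges (layer x H)" using a(3) by (simp add: layer_def)
      then show ?thesis using sub g a y(2) by (auto simp: layer_def)
    qed simp
  qed (use 3(4-7) xs ys xs' sub in auto)
  then show ?case by (simp add: ys layer_def)
qed auto


section \<open>Linear quotients\<close>

lemma in_gap_exists:
  assumes "sorted_wrt (<) xs" "j \<notin> set xs" "t \<in> set xs" "j < t"
  obtains l where "in_gap xs l j"
proof -
  obtain i where i: "i < length xs" "j < xs ! i" using assms(3,4) by (auto simp: in_set_conv_nth)
  define l where "l = (LEAST l. j < xs ! l)"
  have l: "j < xs ! l" "l \<le> i" unfolding l_def using i(2) by (rule LeastI, rule Least_le)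
  have "xs ! (l - 1) < j" if "l \<noteq> 0"
  proof -
    have "\<not> j < xs ! (l - 1)" using not_less_Least[of "l - 1" "\<lambda>l. j < xs ! l"] that by (simp add: l_def)
    moreover have "xs ! (l - 1) \<noteq> j" using assms(2) l i by (metis less_imp_diff_less nth_mem order_le_less_trans)
    ultimately show ?thesis by simp
  qed
  then have "in_gap xs l j" using l i by (auto simp: in_gap_def)
  then show thesis by (rule that)
qed

lemma sorted_wrt_nth_mono:
  "sorted_wrt (<) (xs :: 'a::linorder list) \<Longrightarrow> i \<le> k \<Longrightarrow> k < length xs \<Longrightarrow> xs ! i \<le> xs ! k"
  by (metis le_neq_implies_less order_less_imp_le order_refl sorted_wrt_nth_less)

lemma in_gap_less:
  assumes "sorted_wrt (<) xs" "in_gap xs l j" "i < length xs"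
  shows "i < l \<Longrightarrow> xs ! i < j" "l \<le> i \<Longrightarrow> j < xs ! i"
proof -
  assume "i < l"
  then have "xs ! i \<le> xs ! (l - 1)" using assms by (intro sorted_wrt_nth_mono) (auto simp: in_gap_def)
  then show "xs ! i < j" using assms(2) \<open>i < l\<close> by (auto simp: in_gap_def)
next
  assume "l \<le> i"
  then have "xs ! l \<le> xs ! i" using assms by (intro sorted_wrt_nth_mono) auto
  then show "j < xs ! i" using assms(2) by (auto simp: in_gap_def)
qed

lemma in_gap_notin: "sorted_wrt (<) xs \<Longrightarrow> in_gap xs l j \<Longrightarrow> j \<notin> set xs"
  using in_gap_less[of xs l j] by (metis in_set_conv_nth linorder_not_less order_less_irrefl)

lemma in_gap_unique:
  "sorted_wrt (<) xs \<Longrightarrow> in_gap xs l j \<Longrightarrow> in_gap xs l' j \<Longrightarrow> l = l'"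
  using in_gap_less[of xs l j l'] in_gap_less[of xs l' j l]
  by (metis in_gap_def linorder_neqE_nat order_less_asym order_less_irrefl)

lemma in_gap_Min:
  assumes "sorted_wrt (<) xs" "in_gap xs l j"
  shows "Min {t \<in> set xs. j \<le> t} = xs ! l"
proof (rule Min_eqI)
  show "xs ! l \<in> {t \<in> set xs. j \<le> t}" using assms(2) by (auto simp: in_gap_def)
  fix t assume "t \<in> {t \<in> set xs. j \<le> t}"
  then obtain i where i: "i < length xs" "t = xs ! i" "j \<le> xs ! i" by (auto simp: in_set_conv_nth)
  then have "l \<le> i" using in_gap_less(1)[OF assms i(1)] by (meson linorder_not_less)
  then show "xs ! l \<le> t" using i assms(1) by (auto intro: sorted_wrt_nth_mono)
qed simp

lemma in_gap_list_update:
  assumes "sorted_wrt (<) xs" "in_gap xs l j"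
  shows "sorted_wrt (<) (xs[l := j])" "set (xs[l := j]) = insert j (set xs - {xs ! l})"
proof -
  have l: "l < length xs" using assms(2) by (simp add: in_gap_def)
  show "sorted_wrt (<) (xs[l := j])"
    unfolding sorted_wrt_iff_nth_less
  proof (intro allI impI)
    fix i k assume "i < k" "k < length (xs[l := j])"
    then show "xs[l := j] ! i < xs[l := j] ! k"
      using in_gap_less[OF assms, of i] in_gap_less[OF assms, of k] sorted_wrt_nth_less[OF assms(1)] l
      by (auto simp: nth_list_update)
  qed
  have "distinct xs" using assms(1) by (simp add: strict_sorted_iff)
  then show "set (xs[l := j]) = insert j (set xs - {xs ! l})"
    using l by (rule set_update_distinct)
qed

text \<open>Connects the function c of the statement with replacement of one list entry, the
  operation of the exchange lemmas.\<close>

lemma in_gap_cfun: "sorted_wrt (<) xs \<Longrightarrow> in_gap xs l j \<Longrightarrow> cfun j (set xs) = set (xs[l := j])"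
  by (simp add: cfun_def in_gap_Min in_gap_list_update)

abbreviation slist :: "'a::linorder set \<Rightarrow> 'a list" where
  "slist \<equiv> sorted_list_of_set"

lemma slist_set: "sorted_wrt (<) xs \<Longrightarrow> slist (set xs) = xs"
  by (simp add: strict_sorted_iff sorted_list_of_set.idem_if_sorted_distinct)

lemma sorted_slist [simp]: "sorted_wrt (<) (slist m)"
  by simp

lemma gap_iff_in_gap:
  "1 \<le> l \<Longrightarrow> l \<le> card m \<Longrightarrow> j \<in> gap m l \<longleftrightarrow> in_gap (slist m) (l - 1) j"
  by (auto simp: gap_def in_gap_def elt_def)

lemma list_less_same_length:
  fixes xs ys :: "'a::linorder list"
  assumes "length xs = length ys"
  shows "xs < ys \<longleftrightarrow> (\<exists>l<length ys. take l xs = take l ys \<and> xs ! l < ys ! l)"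
  using assms by (auto simp: list_less_def lexord_take_index_conv)

section \<open>Colon ideals, set(m) and T(\<alpha>) for a cointerval hypergraph\<close>

locale cointerval_hypergraph =
  fixes H :: "'n::{finite,linorder} hypergraph" and d :: nat
  assumes d_pos: "d \<ge> 1" and d_graph: "d_graph d H" and verts: "verts H = UNIV"
    and cointerval: "cointerval d H"
begin

lemma card_edge: "m \<in> edges H \<Longrightarrow> card m = d"
  using d_graph by (simp add: d_graph_def)

lemma edge_nonempty: "m \<in> edges H \<Longrightarrow> m \<noteq> {}"
  using card_edge d_pos by fastforce

text \<open>The combinatorial form of set(m), see \<open>lin_set_ideal_upto\<close>; it mentions
  neither the field nor the position of m among the generators. An element of m above j is demanded
  because \<open>cfun\<close> would otherwise take the minimum of the empty set.\<close>

definition lset :: "'n set \<Rightarrow> 'n set" where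
  "lset m = {j. j \<notin> m \<and> (\<exists>t\<in>m. j < t) \<and> cfun j m \<in> edges H}"

lemma lset_in_gap:
  assumes "j \<in> lset m"
  obtains l where "in_gap (slist m) l j" "cfun j m = set ((slist m)[l := j])" "set ((slist m)[l := j]) \<in> edges H"
proof -
  obtain t where t: "t \<in> m" "j < t" and j: "j \<notin> m" "cfun j m \<in> edges H" using assms by (auto simp: lset_def)
  then obtain l where l: "in_gap (slist m) l j" using in_gap_exists[of "slist m" j t] by auto
  with in_gap_cfun[OF sorted_slist l] j that show thesis by simp
qed

lemma in_gap_lset:
  assumes "in_gap (slist m) l j" "set ((slist m)[l := j]) \<in> edges H"
  shows "j \<in> lset m"
proof -
  have "j \<notin> m" using in_gap_notin[OF sorted_slist assms(1)] by simp
  moreover have "slist m ! l \<in> m" using assms(1) nth_mem[of l "slist m"] by (simp add: in_gap_def)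
  ultimately show ?thesis using assms in_gap_cfun[OF sorted_slist assms(1)]
    by (auto simp: lset_def in_gap_def)
qed

lemma lset_disjoint: "m \<inter> lset m = {}"
  by (auto simp: lset_def)

text \<open>The heart of linear quotients. At the first place where e and m differ, the entry j of e
  lies in the gap of m. Putting it into m gives an edge by \<open>cointerval_shift\<close> if the
  place is not the last one; if it is the last one, the result is e itself.\<close>

lemma earlier_edge_meets_lset:
  assumes e: "e \<in> edges H" and m: "m \<in> edges H" and less: "slist e < slist m"
  obtains j where "j \<in> e" "j \<in> lset m"
proof -
  have len: "length (slist e) = d" "length (slist m) = d" using card_edge e m by simp_all
  then obtain l where l: "l < d" "take l (slist e) = take l (slist m)" "slist e ! l < slist m ! l"
    using less list_less_same_length[of "slist e" "slist m"] by auto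
  let ?j = "slist e ! l"
  have "slist m ! (l - 1) < ?j" if "l \<noteq> 0"
  proof -
    have "slist m ! (l - 1) = slist e ! (l - 1)"
      using arg_cong[OF l(2), of "\<lambda>xs. xs ! (l - 1)"] that by simp
    also have "\<dots> < ?j" using that l len by (intro sorted_wrt_nth_less[OF sorted_slist]) auto
    finally show ?thesis .
  qed
  then have g: "in_gap (slist m) l ?j" using l len by (auto simp: in_gap_def)
  have "set ((slist m)[l := ?j]) \<in> edges H"
  proof (cases "Suc l < d")
    case True
    then show ?thesis
      using cointerval_shift[OF cointerval d_graph sorted_slist len(2) _ g] m verts by simp
  next
    case False
    then have "d = Suc l" using l by simp
    then have "(slist m)[l := ?j] = slist e"
    proof (intro nth_equalityI)
      fix i assume "i < length ((slist m)[l := ?j])"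
      then have "i < l \<or> i = l" using len \<open>d = Suc l\<close> by auto
      moreover have "slist m ! i = slist e ! i" if "i < l"
        using arg_cong[OF l(2), of "\<lambda>xs. xs ! i"] that by simp
      ultimately show "(slist m)[l := ?j] ! i = slist e ! i" using len l(1) by auto
    qed (use len in simp)
    then show ?thesis using e by simp
  qed
  with g have "?j \<in> lset m" by (rule in_gap_lset)
  moreover have "?j \<in> e" using l len nth_mem[of l "slist e"] by simp
  ultimately show thesis using that by blast
qed

text \<open>Lowering one entry inside its gap keeps the list sorted and makes it lexicographically
  smaller. Thus c(x_j m) is an earlier generator, and the last inclusion says that it divides x_j
  m.\<close>

lemma cfun_earlier:
  assumes m: "m \<in> edges H" and j: "j \<in> lset m"
  shows "cfun j m \<in> edges H" "slist (cfun j m) < slist m" "cfun j m \<subseteq> insert j m"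
proof -
  obtain l where l: "in_gap (slist m) l j" "cfun j m = set ((slist m)[l := j])" using j by (rule lset_in_gap)
  have "slist (cfun j m) = (slist m)[l := j]"
    unfolding l(2) by (rule slist_set) (rule in_gap_list_update(1)[OF sorted_slist l(1)])
  moreover have "(slist m)[l := j] < slist m"
    using l(1) by (subst list_less_same_length) (auto simp: in_gap_def intro!: exI[of _ l])
  ultimately show "slist (cfun j m) < slist m" by simp
  show "cfun j m \<in> edges H" using j by (simp add: lset_def)
  show "cfun j m \<subseteq> insert j m" by (auto simp: cfun_def)
qed

lemma set_gens: "set (gens H) = edges H"
proof -
  have "finite (edges H)" by simp
  then show ?thesis by (simp add: gens_def image_image)
qed

lemma gens_nth: "j < length (gens H) \<Longrightarrow> gens H ! j \<in> edges H"
  using set_gens nth_mem by blast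

text \<open>Replaces the position in the list by an order condition on edges, the form in which
  earlier edges are compared with m.\<close>

lemma set_take_gens:
  assumes "j < length (gens H)"
  shows "set (take j (gens H)) = {e \<in> edges H. slist e < slist (gens H ! j)}"
proof -
  define L where "L = slist (slist ` edges H)"
  have L: "set L = slist ` edges H" "sorted_wrt (<) L" by (simp_all add: L_def)
  have g: "gens H = map set L" by (simp add: gens_def L_def)
  have j: "j < length L" using assms by (simp add: g)
  have "L ! i \<in> slist ` edges H" if "i < length L" for i using that L(1) nth_mem by blast
  then have sl: "slist (set (L ! i)) = L ! i" if "i < length L" for i using that by force
  have lt: "L ! i < L ! j \<longleftrightarrow> i < j" if "i < length L" for i
    using that j L(2) by (metis linorder_neqE_nat order_less_asym order_less_irrefl sorted_wrt_nth_less)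
  have "set (take j (gens H)) = (\<lambda>i. set (L ! i)) ` {..<j}"
    using nth_image[of j "gens H"] j by (auto simp: g atLeast0LessThan)
  also have "\<dots> = (\<lambda>i. set (L ! i)) ` {i. i < length L \<and> slist (set (L ! i)) < slist (gens H ! j)}"
    using lt sl j by (intro arg_cong[of _ _ "image _"]) (auto simp: g)
  also have "\<dots> = {e \<in> edges H. slist e < slist (gens H ! j)}"
  proof -
    have "edges H = (\<lambda>i. set (L ! i)) ` {i. i < length L}"
      unfolding set_gens[symmetric] g set_map by (force simp: in_set_conv_nth)
    then show ?thesis by auto
  qed
  finally show ?thesis .
qed

text \<open>An earlier e that divides s times m contains an element of \<open>lset m\<close>; it
  lies outside m, so its variable divides s. Conversely, for i in \<open>lset m\<close> the earlier
  generator c(x_i m) divides x_i m.\<close>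

lemma colon_ideal_upto:
  assumes "j < length (gens H)"
  defines "m \<equiv> gens H ! j"
  shows "colon (ideal_upto (gens H) j) (monomial (mon m)) = (ideal_gen (var ` lset m) :: ('n, 'k::field) mpoly set)"
proof -
  define B where "B = {e \<in> edges H. slist e < slist m}"
  have m: "m \<in> edges H" unfolding m_def using assms(1) by (rule gens_nth)
  have 1: "ideal_upto (gens H) j = (ideal_gen (monomial ` mon ` B) :: ('n, 'k) mpoly set)"
    using set_take_gens[OF assms(1)] by (simp add: ideal_upto_def image_image B_def m_def)
  have 2: "(var :: 'n \<Rightarrow> ('n, 'k) mpoly) ` lset m = monomial ` (\<lambda>i. mon {i}) ` lset m" by (auto simp: var_eq)
  show ?thesis unfolding 1 2
  proof (rule colon_monomial_ideal_eqI)
    fix s :: "'n monom"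
    show "(\<exists>a\<in>mon ` B. \<exists>b. s + mon m = b + a) \<longleftrightarrow> (\<exists>a\<in>(\<lambda>i. mon {i}) ` lset m. \<exists>b. s = b + a)"
      unfolding adds_iff_le
    proof
      assume "\<exists>a\<in>mon ` B. \<forall>i. lkp a i \<le> lkp (s + mon m) i"
      then obtain e where e: "e \<in> B" "\<And>i. lkp (mon e) i \<le> lkp (s + mon m) i" by blast
      then obtain i where i: "i \<in> e" "i \<in> lset m" using earlier_edge_meets_lset[of e m] m by (auto simp: B_def)
      then have "i \<notin> m" by (simp add: lset_def)
      then have "1 \<le> lkp s i" using e(2)[of i] i(1) by (simp add: lookup_add lookup_mon)
      then show "\<exists>a\<in>(\<lambda>i. mon {i}) ` lset m. \<forall>i. lkp a i \<le> lkp s i"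
        using i(2) by (auto simp: lookup_mon intro!: bexI[of _ i])
    next
      assume "\<exists>a\<in>(\<lambda>i. mon {i}) ` lset m. \<forall>i. lkp a i \<le> lkp s i"
      then obtain i where i: "i \<in> lset m" "\<And>k. lkp (mon {i}) k \<le> lkp s k" by blast
      have "1 \<le> lkp s i" using i(2)[of i] by (simp add: lookup_mon)
      then have "\<forall>k. lkp (mon (cfun i m)) k \<le> lkp (s + mon m) k"
        using cfun_earlier(3)[OF m i(1)] by (auto simp: lookup_mon lookup_add)
      moreover have "cfun i m \<in> B" using cfun_earlier[OF m i(1)] by (simp add: B_def)
      ultimately show "\<exists>a\<in>mon ` B. \<forall>i. lkp a i \<le> lkp (s + mon m) i" by blast
    qed
  qed
qed

lemma lin_set_ideal_upto:
  assumes "j < length (gens H)"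
  shows "lin_set (ideal_upto (gens H) j :: ('n, 'k::field) mpoly set) (gens H ! j) = lset (gens H ! j)"
proof -
  have v: "(var :: 'n \<Rightarrow> ('n, 'k) mpoly) ` lset (gens H ! j) = monomial ` (\<lambda>i. mon {i}) ` lset (gens H ! j)"
    by (auto simp: var_eq)
  show ?thesis
    unfolding lin_set_def colon_ideal_upto[OF assms] v
    by (auto simp: monomial_ideal_iff var_eq adds_iff_le lookup_mon split: if_splits)
qed

text \<open>T(\<alpha>) without reference to an ideal: j is the largest element of \<alpha> in its
  gap if and only if all larger elements of \<alpha> lie beyond the entry of m that closes the
  gap.\<close>

definition tset :: "'n set \<Rightarrow> 'n set \<Rightarrow> 'n set" where
  "tset m \<alpha> = {j \<in> \<alpha>. \<forall>k\<in>\<alpha>. j < k \<longrightarrow> Min {t \<in> m. j \<le> t} < k}"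

text \<open>All generators have degree d, so a generator that divides a squarefree monomial of
  degree d equals it.\<close>

lemma monomial_in_edge_ideal_iff:
  assumes "card X = d"
  shows "(monomial (mon X) :: ('n, 'k::field) mpoly) \<in> edge_ideal H \<longleftrightarrow> X \<in> edges H"
proof -
  have i: "(edge_ideal H :: ('n, 'k) mpoly set) = ideal_gen (monomial ` mon ` edges H)"
    by (simp add: edge_ideal_def image_image)
  have "(\<forall>i. lkp (mon e) i \<le> lkp (mon X) i) \<longleftrightarrow> e = X" if "e \<in> edges H" for e
  proof
    assume "\<forall>i. lkp (mon e) i \<le> lkp (mon X) i"
    then have "e \<subseteq> X" by (auto simp: lookup_mon split: if_splits)
    then show "e = X" using card_edge[OF that] assms by (intro card_subset_eq) auto
  qed simp
  then show ?thesis unfolding i monomial_ideal_iff by (simp add: adds_iff_le)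
qed

text \<open>For \<alpha> inside \<open>lset m\<close> the ideal condition in \<open>Aset\<close>
  holds automatically, as the monomial in question is c(x_j m). Hence only the position in the gaps
  matters.\<close>

lemma Tset_eq:
  assumes m: "m \<in> edges H" and \<alpha>: "\<alpha> \<subseteq> lset m"
  shows "Tset (edge_ideal H :: ('n, 'k::field) mpoly set) m \<alpha> = tset m \<alpha>"
proof -
  let ?xs = "slist m" and ?I = "edge_ideal H :: ('n, 'k) mpoly set"
  note s = sorted_slist[of m]
  have A: "\<alpha> \<inter> Aset ?I m (Suc l) = {j \<in> \<alpha>. in_gap ?xs l j}" if l: "l < card m" for l
  proof -
    have "monomial (mon (insert j (m - {elt m (Suc l)}))) \<in> ?I" if j: "j \<in> \<alpha>" "in_gap ?xs l j" for j
    proof -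
      have "insert j (m - {elt m (Suc l)}) = cfun j m"
        using in_gap_list_update(2)[OF s j(2)] in_gap_cfun[OF s j(2)] by (simp add: elt_def)
      moreover have "cfun j m \<in> edges H" using \<alpha> j(1) by (auto simp: lset_def)
      ultimately show ?thesis using monomial_in_edge_ideal_iff card_edge by metis
    qed
    then show ?thesis using gap_iff_in_gap[of "Suc l" m] l by (auto simp: Aset_def)
  qed
  have "Tset ?I m \<alpha> = {Max {j \<in> \<alpha>. in_gap ?xs l j} | l. l < card m \<and> {j \<in> \<alpha>. in_gap ?xs l j} \<noteq> {}}"
    (is "?L = ?R")
  proof (intro equalityI subsetI)
    fix x assume "x \<in> ?L"
    then obtain l where l: "1 \<le> l" "l \<le> card m" "\<alpha> \<inter> Aset ?I m l \<noteq> {}" "x = Max (\<alpha> \<inter> Aset ?I m l)"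
      by (auto simp: Tset_def)
    then show "x \<in> ?R" using A[of "l - 1"] by (auto intro!: exI[of _ "l - 1"])
  next
    fix x assume "x \<in> ?R"
    then obtain l where l: "l < card m" "{j \<in> \<alpha>. in_gap ?xs l j} \<noteq> {}" "x = Max {j \<in> \<alpha>. in_gap ?xs l j}"
      by blast
    then show "x \<in> ?L" unfolding Tset_def using A[of l] by (intro CollectI exI[of _ "Suc l"]) auto
  qed
  also have "\<dots> = tset m \<alpha>"
  proof (intro equalityI subsetI)
    fix x assume "x \<in> ?R"
    then obtain l where l: "l < card m" "{j \<in> \<alpha>. in_gap ?xs l j} \<noteq> {}" "x = Max {j \<in> \<alpha>. in_gap ?xs l j}"
      by blast
    then have x: "x \<in> \<alpha>" "in_gap ?xs l x" using Max_in[of "{j \<in> \<alpha>. in_gap ?xs l j}"] by auto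
    have "?xs ! l < k" if k: "k \<in> \<alpha>" "x < k" for k
    proof -
      have "\<not> in_gap ?xs l k"
      proof
        assume "in_gap ?xs l k"
        then have "k \<le> x" unfolding l(3) using k(1) by (intro Max_ge) auto
        then show False using k(2) by simp
      qed
      then have "?xs ! l \<le> k" using x(2) k(2) by (auto simp: in_gap_def)
      moreover have "?xs ! l \<in> m" using x(2) nth_mem[of l ?xs] by (simp add: in_gap_def)
      then have "?xs ! l \<noteq> k" using k(1) \<alpha> lset_disjoint by blast
      ultimately show ?thesis by simp
    qed
    then show "x \<in> tset m \<alpha>" using x in_gap_Min[OF s x(2)] by (simp add: tset_def)
  next
    fix x assume x: "x \<in> tset m \<alpha>"
    then have xa: "x \<in> \<alpha>" by (simp add: tset_def)
    then obtain l where l: "in_gap ?xs l x" using \<alpha> lset_in_gap by blast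
    have mn: "Min {t \<in> m. x \<le> t} = ?xs ! l" using in_gap_Min[OF s l] by simp
    have "Max {j \<in> \<alpha>. in_gap ?xs l j} = x"
    proof (rule Max_eqI)
      fix k assume "k \<in> {j \<in> \<alpha>. in_gap ?xs l j}"
      then show "k \<le> x" using x mn by (force simp: tset_def in_gap_def)
    qed (use xa l in auto)
    then show "x \<in> ?R" using xa l by (auto simp: in_gap_def intro!: exI[of _ l])
  qed
  finally show ?thesis .
qed

end

section \<open>Faces of the cells of the homomorphism complex\<close>

lemma single_sum: "Poly_Mapping.single a (sum f A) = (\<Sum>x\<in>A. Poly_Mapping.single a (f x))"
  by (induction A rule: infinite_finite_induct) (auto simp: single_add)

definition del :: "'a set list \<Rightarrow> nat \<Rightarrow> 'a \<Rightarrow> 'a set list" where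
  "del c l w = c[l := c ! l - {w}]"

text \<open>Facets are indexed by the factor and the removed element rather than by the resulting
  cell, so that two successive removals can be reordered pair by pair. The bound on the cardinality
  keeps the factor nonempty.\<close>

definition faces :: "'a set list \<Rightarrow> (nat \<times> 'a) set" where
  "faces c = {(l, w). l < length c \<and> w \<in> c ! l \<and> 2 \<le> card (c ! l)}"

definition sign_exp :: "'a::linorder set list \<Rightarrow> nat \<Rightarrow> 'a \<Rightarrow> nat" where
  "sign_exp c l w = (\<Sum>k<l. card (c ! k) - 1) + card {v \<in> c ! l. v < w}"

lemma length_del [simp]: "length (del c l w) = length c"
  by (simp add: del_def)

lemma del_nth: "l < length c \<Longrightarrow> del c l w ! i = (if i = l then c ! l - {w} else c ! i)"
  by (simp add: del_def nth_list_update)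

lemma cell_dim_eq_sum: "cell_dim c = (\<Sum>i<length c. card (c ! i) - 1)"
  unfolding cell_dim_def by (subst sum_list_sum_nth) (simp add: atLeast0LessThan)

lemma cell_label_eq_sum: "cell_label c = (\<Sum>i<length c. mon (c ! i))"
  unfolding cell_label_def by (subst sum_list_sum_nth) (simp add: atLeast0LessThan)

lemma finite_faces: "finite (faces (c :: 'a::finite set list))"
proof (rule finite_subset)
  show "faces c \<subseteq> {..<length c} \<times> UNIV" by (auto simp: faces_def)
qed simp

lemma sum_del:
  fixes f :: "'a set \<Rightarrow> 'b::comm_monoid_add"
  assumes "l < n" "n \<le> length c"
  shows "(\<Sum>i<n. f (del c l w ! i)) = f (c ! l - {w}) + (\<Sum>i\<in>{..<n} - {l}. f (c ! i))"
    "(\<Sum>i<n. f (c ! i)) = f (c ! l) + (\<Sum>i\<in>{..<n} - {l}. f (c ! i))"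
proof -
  show "(\<Sum>i<n. f (del c l w ! i)) = f (c ! l - {w}) + (\<Sum>i\<in>{..<n} - {l}. f (c ! i))"
    using assms by (subst sum.remove[of _ l]) (auto simp: del_nth intro!: sum.cong)
  show "(\<Sum>i<n. f (c ! i)) = f (c ! l) + (\<Sum>i\<in>{..<n} - {l}. f (c ! i))"
    using assms by (subst sum.remove[of _ l]) auto
qed

lemma sum_card_del:
  fixes c :: "'a::finite set list"
  assumes "(l, w) \<in> faces c" "l < n" "n \<le> length c"
  shows "Suc (\<Sum>i<n. card (del c l w ! i) - 1) = (\<Sum>i<n. card (c ! i) - 1)"
  using sum_del(1)[of l n c, where f = "\<lambda>s. card s - 1" and w = w]
    sum_del(2)[of l n c, where f = "\<lambda>s. card s - 1"] assms by (auto simp: faces_def)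

lemma cell_dim_del:
  fixes c :: "'a::finite set list"
  shows "(l, w) \<in> faces c \<Longrightarrow> Suc (cell_dim (del c l w)) = cell_dim c"
  unfolding cell_dim_eq_sum by (subst sum_card_del[symmetric]) (auto simp: faces_def)

lemma cell_label_del:
  fixes c :: "'a::finite set list"
  assumes "(l, w) \<in> faces c"
  shows "cell_label c = mon {w} + cell_label (del c l w)"
proof -
  have l: "l < length c" "w \<in> c ! l" using assms by (auto simp: faces_def)
  have "mon (c ! l) = mon {w} + mon (c ! l - {w})" using l by (intro mon_remove) auto
  then show ?thesis using sum_del(1)[of l "length c" c, where f = mon and w = w] sum_del(2)[of l "length c" c, where f = mon] l by (simp add: cell_label_eq_sum add.assoc)
qed

lemma sorted_blocks_less:
  assumes "sorted_wrt set_less c" "k < l" "l < length c" "v \<in> c ! k" "w \<in> c ! l"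
  shows "v < w"
  using sorted_wrt_nth_less[OF assms(1-3)] assms(4,5) by (simp add: set_less_def)

lemma sorted_blocks_le:
  assumes "sorted_wrt set_less c" "k < length c" "l < length c" "v \<in> c ! k" "w \<in> c ! l" "v < w"
  shows "k \<le> l"
proof (rule ccontr)
  assume "\<not> k \<le> l"
  then have "w < v" using sorted_blocks_less[OF assms(1), of l k w v] assms by simp
  then show False using assms(6) by simp
qed

lemma sorted_blocks_unique:
  assumes "sorted_wrt set_less c" "k < length c" "l < length c" "v \<in> c ! k" "v \<in> c ! l"
  shows "k = l"
  using sorted_blocks_less[OF assms(1)] assms(2-) by (metis linorder_neqE_nat order_less_irrefl)

lemma faces_del_swap:
  fixes c :: "'a::{finite,linorder} set list"
  assumes s: "sorted_wrt set_less c" and f: "(l, w) \<in> faces c" and f': "(l', w') \<in> faces (del c l w)"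
  shows "w \<noteq> w'" "(l', w') \<in> faces c" "(l, w) \<in> faces (del c l' w')"
    "del (del c l w) l' w' = del (del c l' w') l w"
proof -
  have l: "l < length c" "w \<in> c ! l" "2 \<le> card (c ! l)" using f by (auto simp: faces_def)
  have l': "l' < length c" "w' \<in> del c l w ! l'" "2 \<le> card (del c l w ! l')" using f' by (auto simp: faces_def)
  have w': "w' \<in> c ! l'" using l(1) l'(2) by (auto simp: del_nth split: if_splits)
  show ne: "w \<noteq> w'"
  proof
    assume "w = w'"
    then have "l = l'" using sorted_blocks_unique[OF s l(1) _ l(2)] l'(1) w' by simp
    then show False using l(1) l'(2) \<open>w = w'\<close> by (simp add: del_nth)
  qed
  show "(l', w') \<in> faces c"
    using l l' by (auto simp: faces_def del_nth split: if_splits)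
  show "(l, w) \<in> faces (del c l' w')"
    using l l' ne by (auto simp: faces_def del_nth split: if_splits)
  show "del (del c l w) l' w' = del (del c l' w') l w"
    using l l' by (intro nth_equalityI) (auto simp: del_nth)
qed

text \<open>The exponent counts what precedes the removed element: the dimensions of earlier factors
  and the smaller elements of its own factor. Removing w < w' lowers one of these counts for w' by
  one, whereas w does not notice the removal of w'. This asymmetry makes the two orders of removal
  cancel.\<close>

lemma sign_exp_del:
  fixes c :: "'a::{finite,linorder} set list"
  assumes s: "sorted_wrt set_less c" and f: "(l, w) \<in> faces c" and f': "(l', w') \<in> faces c"
    and less: "w < w'"
  shows "Suc (sign_exp (del c l w) l' w') = sign_exp c l' w'" "sign_exp (del c l' w') l w = sign_exp c l w"
proof -
  have l: "l < length c" "w \<in> c ! l" and l': "l' < length c" "w' \<in> c ! l'"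
    using f f' by (auto simp: faces_def)
  have le: "l \<le> l'" using sorted_blocks_le[OF s l(1) l'(1) l(2) l'(2) less] .
  show "Suc (sign_exp (del c l w) l' w') = sign_exp c l' w'"
  proof (cases "l = l'")
    case False
    then show ?thesis using sum_card_del[OF f, of l'] le l l' by (simp add: sign_exp_def del_nth)
  next
    case True
    have "{v \<in> c ! l. v < w'} = insert w {v \<in> c ! l - {w}. v < w'}" using l less by auto
    then have "card {v \<in> c ! l. v < w'} = Suc (card {v \<in> c ! l - {w}. v < w'})" by (simp only:) (subst card_insert_disjoint, auto)
    then show ?thesis using True l by (simp add: sign_exp_def del_nth)
  qed
  have "{v \<in> del c l' w' ! l. v < w} = {v \<in> c ! l. v < w}"
    using less l l' by (auto simp: del_nth)
  then show "sign_exp (del c l' w') l w = sign_exp c l w"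
    using le l' by (auto simp: sign_exp_def del_nth)
qed

lemma sum_antisymmetric_pairs:
  fixes h :: "'b \<times> 'b \<Rightarrow> 'c::ab_group_add" and key :: "'b \<Rightarrow> 'd::linorder"
  assumes "finite P"
    and sw: "\<And>x y. (x, y) \<in> P \<Longrightarrow> (y, x) \<in> P \<and> h (y, x) = - h (x, y) \<and> key x \<noteq> key y"
  shows "sum h P = 0"
proof -
  let ?A = "{p \<in> P. key (fst p) < key (snd p)}" and ?B = "{p \<in> P. key (snd p) < key (fst p)}"
  \<comment> \<open>comparing the sum with its image under the swap would only give \<open>2 * sum h P = 0\<close>\<close>
  have "P = ?A \<union> ?B"
  proof (intro equalityI subsetI)
    fix p assume "p \<in> P"
    then show "p \<in> ?A \<union> ?B" using sw[of "fst p" "snd p"] by (auto simp: linorder_neq_iff)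
  qed auto
  moreover have "?A \<inter> ?B = {}" by auto
  ultimately have "sum h P = sum h ?A + sum h ?B"
    using assms(1) by (metis (no_types, lifting) finite_Un sum.union_disjoint)
  also have "sum h ?B = (\<Sum>p\<in>?A. - h p)"
    by (rule sum.reindex_bij_witness[where i = prod.swap and j = prod.swap]) (auto dest: sw)
  finally show ?thesis by (simp add: sum_negf)
qed

section \<open>The cellular differential and its square\<close>

context cointerval_hypergraph
begin

lemma hom_cellsD:
  assumes "c \<in> hom_cells d H"
  shows "length c = d" "sorted_wrt set_less c" "l < d \<Longrightarrow> c ! l \<noteq> {}"
    "list_all2 (\<in>) v c \<Longrightarrow> set v \<in> edges H"
  using assms by (auto simp: hom_cells_def)

lemma hom_cellsI:
  assumes "length c = d" "sorted_wrt set_less c" "\<And>l. l < d \<Longrightarrow> c ! l \<noteq> {}"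
    "\<And>v. list_all2 (\<in>) v c \<Longrightarrow> set v \<in> edges H"
  shows "c \<in> hom_cells d H"
  using assms by (auto simp: hom_cells_def verts in_set_conv_nth)

lemma finite_hom_cells: "finite (hom_cells d H)"
proof (rule finite_subset)
  show "hom_cells d H \<subseteq> {c. set c \<subseteq> UNIV \<and> length c = d}" by (auto simp: hom_cells_def)
  show "finite {c :: 'n set list. set c \<subseteq> UNIV \<and> length c = d}" by (rule finite_lists_length_eq) simp
qed

lemma del_hom_cells:
  assumes c: "c \<in> hom_cells d H" and f: "(l, w) \<in> faces c"
  shows "del c l w \<in> hom_cells d H"
proof (rule hom_cellsI)
  note D = hom_cellsD[OF c]
  have l: "l < length c" "w \<in> c ! l" "2 \<le> card (c ! l)" using f by (auto simp: faces_def)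
  have sub: "del c l w ! i \<subseteq> c ! i" for i using l(1) by (auto simp: del_nth)
  show "length (del c l w) = d" using D by simp
  show "sorted_wrt set_less (del c l w)"
    unfolding sorted_wrt_iff_nth_less set_less_def
    using sorted_blocks_less[OF D(2)] subsetD[OF sub] by (metis length_del)
  have "c ! l - {w} \<noteq> {}"
  proof
    assume "c ! l - {w} = {}"
    then have "c ! l \<subseteq> {w}" by auto
    then have "card (c ! l) \<le> card {w}" by (intro card_mono) auto
    then show False using l(3) by simp
  qed
  then show "del c l w ! i \<noteq> {}" if "i < d" for i using that D(3)[of i] l(1) by (simp add: del_nth)
  fix v assume "list_all2 (\<in>) v (del c l w)"
  then have "list_all2 (\<in>) v c" using subsetD[OF sub] by (auto simp: list_all2_conv_all_nth)
  then show "set v \<in> edges H" by (rule D(4))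
qed

definition orient :: "'n set list \<Rightarrow> int" where
  "orient c = (-1) ^ cell_dim c"

abbreviation cellular :: "('n, 'k::field, 'n set list option) based_complex" where
  "cellular \<equiv> cellular_complex d H orient"

lemma diff_cellular_None: "diff cellular None = 0"
  by (simp add: cellular_complex_def)

lemma diff_cellular_vertex:
  "cell_dim c = 0 \<Longrightarrow> diff cellular (Some c) = Poly_Mapping.single None (monomial (cell_label c))"
  by (simp add: cellular_complex_def orient_def)

text \<open>\<open>incidence\<close> allows the removal of the only element of a factor,
  \<open>faces\<close> does not. Both sums agree since all factors of the cell c' are
  nonempty.\<close>

lemma incidence_eq:
  assumes c: "c \<in> hom_cells d H" and c': "c' \<in> hom_cells d H"
  shows "incidence c c' = (\<Sum>(l, w)\<in>{x \<in> faces c. del c (fst x) (snd x) = c'}. (-1) ^ sign_exp c l w)"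
proof -
  have "incidence c c' = (\<Sum>(l, w)\<in>Sigma {..<length c} (\<lambda>l. {w \<in> c ! l. c' = del c l w}). (-1) ^ sign_exp c l w)"
    unfolding incidence_def del_def[symmetric] sign_exp_def[symmetric] by (rule sum.Sigma) auto
  also have "Sigma {..<length c} (\<lambda>l. {w \<in> c ! l. c' = del c l w}) = {x \<in> faces c. del c (fst x) (snd x) = c'}"
  proof -
    have "2 \<le> card (c ! l)" if l: "l < length c" "w \<in> c ! l" "c' = del c l w" for l w
    proof -
      have "c ! l - {w} \<noteq> {}"
        using hom_cellsD(3)[OF c', of l] hom_cellsD(1)[OF c] l by (simp add: del_nth)
      then have "card (c ! l - {w}) > 0" by (simp add: card_gt_0_iff)
      then show ?thesis using l(2) by simp
    qed
    then show ?thesis by (auto simp: faces_def)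
  qed
  finally show ?thesis .
qed

text \<open>Grouping the removals by the cell that they produce turns the sum over target cells into
  a sum over facets. The quotient of the labels is the removed variable, and the orientations of
  adjacent dimensions contribute -1.\<close>

lemma diff_cellular:
  assumes c: "c \<in> hom_cells d H" and dim: "cell_dim c \<noteq> 0"
  shows "diff (cellular :: ('n, 'k::field, _) based_complex) (Some c) =
    (\<Sum>(l, w)\<in>faces c. Poly_Mapping.single (Some (del c l w)) (- ((-1) ^ sign_exp c l w) * var w))"
proof -
  let ?X = "{c' \<in> hom_cells d H. cell_dim c' = cell_dim c - 1}"
  let ?h = "\<lambda>x. Poly_Mapping.single (Some (del c (fst x) (snd x)))
    (- ((-1) ^ sign_exp c (fst x) (snd x)) * (var (snd x) :: ('n, 'k) mpoly))"
  have "diff (cellular :: ('n, 'k, _) based_complex) (Some c) = (\<Sum>c'\<in>?X. Poly_Mapping.single (Some c')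
      (of_int (orient c * orient c' * incidence c c') * monomial (cell_label c - cell_label c')))"
    using dim by (simp add: cellular_complex_def)
  also have "\<dots> = (\<Sum>c'\<in>?X. \<Sum>x\<in>{x \<in> faces c. del c (fst x) (snd x) = c'}. ?h x)"
  proof (rule sum.cong[OF refl])
    fix c' assume c': "c' \<in> ?X"
    then have "cell_dim c = Suc (cell_dim c')" using dim by simp
    then have o: "orient c * orient c' = -1" by (simp add: orient_def)
    have "of_int (incidence c c') = (\<Sum>x\<in>{x \<in> faces c. del c (fst x) (snd x) = c'}. (-1) ^ sign_exp c (fst x) (snd x) :: ('n, 'k) mpoly)"
      using c' by (subst incidence_eq[OF c]) (simp_all add: split_def)
    then have "of_int (orient c * orient c' * incidence c c') * monomial (cell_label c - cell_label c') =
      (\<Sum>x\<in>{x \<in> faces c. del c (fst x) (snd x) = c'}. - ((-1) ^ sign_exp c (fst x) (snd x)) *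
          (monomial (cell_label c - cell_label c') :: ('n, 'k) mpoly))"
      unfolding o by (simp add: sum_distrib_right sum_negf)
    also have "\<dots> = (\<Sum>x\<in>{x \<in> faces c. del c (fst x) (snd x) = c'}. - ((-1) ^ sign_exp c (fst x) (snd x)) * var (snd x))"
    proof (rule sum.cong[OF refl])
      fix x assume x: "x \<in> {x \<in> faces c. del c (fst x) (snd x) = c'}"
      then have "cell_label c = mon {snd x} + cell_label c'"
        using cell_label_del[of "fst x" "snd x" c] by simp
      then have "cell_label c - cell_label c' = mon {snd x}" by simp
      then show "- ((-1) ^ sign_exp c (fst x) (snd x)) * (monomial (cell_label c - cell_label c') :: ('n, 'k) mpoly) =
          - ((-1) ^ sign_exp c (fst x) (snd x)) * var (snd x)" by (simp only: var_eq)
    qed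
    finally show "Poly_Mapping.single (Some c')
      (of_int (orient c * orient c' * incidence c c') * monomial (cell_label c - cell_label c') :: ('n, 'k) mpoly) =
      (\<Sum>x\<in>{x \<in> faces c. del c (fst x) (snd x) = c'}. ?h x)"
      by (simp only: single_sum) (auto intro!: sum.cong)
  qed
  also have "\<dots> = (\<Sum>x\<in>faces c. ?h x)"
  proof (rule sum.group)
    show "finite ?X" using finite_hom_cells by simp
    show "(\<lambda>x. del c (fst x) (snd x)) ` faces c \<subseteq> ?X"
    proof clarify
      fix l w assume f: "(l, w) \<in> faces c"
      have "cell_dim (del c l w) = cell_dim c - 1" using cell_dim_del[OF f] by simp
      then show "del c (fst (l, w)) (snd (l, w)) \<in> hom_cells d H \<and> cell_dim (del c (fst (l, w)) (snd (l, w))) = cell_dim c - 1"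
        using del_hom_cells[OF c f] by simp
    qed
  qed (rule finite_faces)
  finally show ?thesis by (simp add: split_def)
qed

text \<open>The only factor with more than one element is {p < q}, and its two removals have
  exponents 0 and 1. This is the cancellation that the augmentation of vertices requires.\<close>

lemma sum_signs_one_cell:
  assumes c: "c \<in> hom_cells d H" and dim: "cell_dim c = 1"
  shows "(\<Sum>(l, w)\<in>faces c. (-1) ^ sign_exp c l w) = (0 :: 'r::comm_ring_1)"
proof -
  note D = hom_cellsD[OF c]
  obtain l where l: "l < d" "card (c ! l) - 1 = 1" "\<And>i. i < d \<Longrightarrow> i \<noteq> l \<Longrightarrow> card (c ! i) - 1 = 0"
    using dim D(1) unfolding cell_dim_eq_sum One_nat_def by (subst (asm) sum_eq_Suc0_iff) auto
  then have "card (c ! l) = 2" by simp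
  then obtain a b where ab': "c ! l = {a, b}" "a \<noteq> b" by (auto simp: card_2_iff)
  define p where "p = min a b"
  define q where "q = max a b"
  have ab: "c ! l = {p, q}" "p < q" using ab' by (auto simp: p_def q_def min_def max_def)
  have "faces c = {(l, p), (l, q)}"
  proof -
    have "i = l" if "i < d" "2 \<le> card (c ! i)" for i using l(3)[of i] that by (cases "i = l") auto
    then have "x \<in> faces c \<longleftrightarrow> fst x = l \<and> snd x \<in> c ! l" for x
      unfolding faces_def case_prod_beta mem_Collect_eq D(1)
      using l(1) \<open>card (c ! l) = 2\<close> by (metis order_refl)
    then have "faces c = {l} \<times> (c ! l)" by (simp only: set_eq_iff mem_Times_iff singleton_iff simp_thms)
    then show ?thesis unfolding ab(1) by simp
  qed
  moreover have "(\<Sum>k<l. card (c ! k) - 1) = 0" using l by (intro sum.neutral) auto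
  moreover have "{v \<in> c ! l. v < p} = {}" "{v \<in> c ! l. v < q} = {p}" using ab by auto
  then have "card {v \<in> c ! l. v < p} = 0" "card {v \<in> c ! l. v < q} = 1"
    by (simp_all only: card.empty) simp
  ultimately have "sign_exp c l p = 0" "sign_exp c l q = 1" by (simp_all only: sign_exp_def add_0)
  with \<open>faces c = _\<close> show ?thesis using ab(2) by simp
qed

text \<open>Above dimension 1 the two orders of a double removal cancel. In dimension 1 the second
  map is the augmentation into R, which is no removal, and the two endpoints cancel instead.\<close>

lemma cellular_square_zero:
  assumes c: "c \<in> hom_cells d H" and dim: "cell_dim c \<noteq> 0"
  shows "lin (diff (cellular :: ('n, 'k::field, _) based_complex)) (diff cellular (Some c)) = 0"
proof -
  let ?D = "diff (cellular :: ('n, 'k, _) based_complex)"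
  note D = hom_cellsD[OF c]
  have eq: "lin ?D (?D (Some c)) =
    (\<Sum>x\<in>faces c. smult (- ((-1) ^ sign_exp c (fst x) (snd x)) * var (snd x)) (?D (Some (del c (fst x) (snd x)))))"
    by (simp add: diff_cellular[OF c dim] lin_sum split_def)
  show ?thesis
  proof (cases "cell_dim c = 1")
    case True
    \<comment> \<open>The removed variable times the label of the remaining endpoint is the label of
      c for either endpoint; it factors out and only the signs are left.\<close>
    have "smult (- ((-1) ^ sign_exp c (fst x) (snd x)) * var (snd x)) (?D (Some (del c (fst x) (snd x)))) =
        smult (monomial (cell_label c)) (Poly_Mapping.single None (- ((-1) ^ sign_exp c (fst x) (snd x))))"
      if x: "x \<in> faces c" for x
    proof -
      have x': "(fst x, snd x) \<in> faces c" using x by simp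
      have "cell_dim (del c (fst x) (snd x)) = 0" using cell_dim_del[OF x'] True by simp
      then show ?thesis
        by (simp add: diff_cellular_vertex cell_label_del[OF x'] var_eq monomial_mult[symmetric] mult_ac)
    qed
    then have "lin ?D (?D (Some c)) = smult (monomial (cell_label c))
      (\<Sum>x\<in>faces c. Poly_Mapping.single None (- ((-1) ^ sign_exp c (fst x) (snd x))))"
      unfolding eq by (simp add: smult_sum)
    also have "(\<Sum>x\<in>faces c. Poly_Mapping.single None (- ((-1) ^ sign_exp c (fst x) (snd x)))) =
      smult (- (\<Sum>x\<in>faces c. (-1) ^ sign_exp c (fst x) (snd x))) (Poly_Mapping.single None (1 :: ('n, 'k) mpoly))"
      by (simp add: sum_negf single_uminus single_sum)
    also have "(\<Sum>x\<in>faces c. (-1) ^ sign_exp c (fst x) (snd x)) = (0 :: ('n, 'k) mpoly)"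
      using sum_signs_one_cell[OF c True] by (simp add: split_def)
    finally show ?thesis by simp
  next
    case False
    let ?P = "Sigma (faces c) (\<lambda>x. faces (del c (fst x) (snd x)))"
    let ?h = "\<lambda>(x, y). Poly_Mapping.single (Some (del (del c (fst x) (snd x)) (fst y) (snd y)))
      ((-1) ^ sign_exp c (fst x) (snd x) * (-1) ^ sign_exp (del c (fst x) (snd x)) (fst y) (snd y) *
        (var (snd x) * var (snd y) :: ('n, 'k) mpoly))"
    have "smult (- ((-1) ^ sign_exp c (fst x) (snd x)) * var (snd x)) (?D (Some (del c (fst x) (snd x)))) =
        (\<Sum>y\<in>faces (del c (fst x) (snd x)). ?h (x, y))"
      if x: "x \<in> faces c" for x
    proof -
      have x': "(fst x, snd x) \<in> faces c" using x by simp
      have "cell_dim (del c (fst x) (snd x)) \<noteq> 0" using cell_dim_del[OF x'] dim False by auto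
      then show ?thesis
        by (simp add: diff_cellular[OF del_hom_cells[OF c x']] smult_sum split_def mult_ac)
    qed
    then have "lin ?D (?D (Some c)) = (\<Sum>x\<in>faces c. \<Sum>y\<in>faces (del c (fst x) (snd x)). ?h (x, y))"
      unfolding eq by simp
    also have "\<dots> = sum ?h ?P"
      unfolding case_prod_conv by (rule sum.Sigma) (simp_all add: finite_faces)
    also have "\<dots> = 0"
    \<comment> \<open>The factors are disjoint, so the two removed elements differ, and comparing
      them selects one of the two orders.\<close>
    proof (rule sum_antisymmetric_pairs[where key = snd])
      show "finite ?P" by (auto simp: finite_faces)
      fix x y assume "(x, y) \<in> ?P"
      then have x: "(fst x, snd x) \<in> faces c" and y: "(fst y, snd y) \<in> faces (del c (fst x) (snd x))" by auto
      note sw = faces_del_swap[OF D(2) x y]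
      have "(-1) ^ (sign_exp c (fst y) (snd y) + sign_exp (del c (fst y) (snd y)) (fst x) (snd x)) =
          - ((-1) ^ (sign_exp c (fst x) (snd x) + sign_exp (del c (fst x) (snd x)) (fst y) (snd y)) :: ('n, 'k) mpoly)"
      proof (cases "snd x < snd y")
        case True
        then have "sign_exp c (fst y) (snd y) + sign_exp (del c (fst y) (snd y)) (fst x) (snd x) =
          Suc (sign_exp c (fst x) (snd x) + sign_exp (del c (fst x) (snd x)) (fst y) (snd y))"
          using sign_exp_del[OF D(2) x sw(2)] by linarith
        then show ?thesis by (simp only: power_Suc mult_minus_left mult_1)
      next
        case False
        then have "snd y < snd x" using sw(1) by simp
        then have "sign_exp c (fst x) (snd x) + sign_exp (del c (fst x) (snd x)) (fst y) (snd y) =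
          Suc (sign_exp c (fst y) (snd y) + sign_exp (del c (fst y) (snd y)) (fst x) (snd x))"
          using sign_exp_del[OF D(2) sw(2) x] by linarith
        then show ?thesis by (simp only: power_Suc mult_minus_left mult_1 minus_minus)
      qed
      then have "?h (y, x) = - ?h (x, y)"
        unfolding case_prod_conv sw(4) power_add[symmetric]
        by (simp add: single_uminus mult.commute[of "var (snd x)"])
      then show "(y, x) \<in> ?P \<and> ?h (y, x) = - ?h (x, y) \<and> snd x \<noteq> snd y"
        using sw by (auto simp: mem_Times_iff)
    qed
    finally show ?thesis .
  qed
qed

end

section \<open>Symbols and cells\<close>

definition cell :: "'n::linorder set \<Rightarrow> 'n set \<Rightarrow> 'n set list" where
  "cell m \<alpha> = map (\<lambda>l. {elt m l} \<union> (\<alpha> \<inter> gap m l)) [1..<Suc (card m)]"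

lemma symbol_cell_Sym: "symbol_cell (Sym m \<alpha>) = Some (cell m \<alpha>)"
  by (simp add: cell_def)

lemma length_cell [simp]: "length (cell m \<alpha>) = card m"
  by (simp add: cell_def)

lemma cell_nth:
  assumes "l < card m"
  shows "cell m \<alpha> ! l = insert (slist m ! l) {j \<in> \<alpha>. in_gap (slist m) l j}"
proof -
  have "cell m \<alpha> ! l = {elt m (Suc l)} \<union> (\<alpha> \<inter> gap m (Suc l))"
    using assms by (simp add: cell_def del: upt_Suc)
  also have "gap m (Suc l) = {j. in_gap (slist m) l j}"
    using gap_iff_in_gap[of "Suc l" m] assms by auto
  finally show ?thesis by (auto simp: elt_def)
qed

context cointerval_hypergraph
begin

section \<open>From symbols to cells and back\<close>

lemma length_slist: "m \<in> edges H \<Longrightarrow> length (slist m) = d"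
  by (simp add: card_edge)

lemma nth_slist_mem: "m \<in> edges H \<Longrightarrow> l < d \<Longrightarrow> slist m ! l \<in> m"
  using nth_mem[of l "slist m"] by (simp add: card_edge)

lemma cell_nth': "m \<in> edges H \<Longrightarrow> l < d \<Longrightarrow>
    cell m \<alpha> ! l = insert (slist m ! l) {j \<in> \<alpha>. in_gap (slist m) l j}"
  by (simp add: cell_nth card_edge)

lemma Max_cell_nth:
  assumes "m \<in> edges H" "l < d"
  shows "Max (cell m \<alpha> ! l) = slist m ! l"
  unfolding cell_nth'[OF assms] by (rule Max_eqI) (auto simp: in_gap_def)

lemma Union_cell:
  assumes m: "m \<in> edges H" and \<alpha>: "\<alpha> \<subseteq> lset m"
  shows "\<Union>(set (cell m \<alpha>)) = m \<union> \<alpha>"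
proof (intro equalityI subsetI)
  fix x assume "x \<in> \<Union>(set (cell m \<alpha>))"
  then obtain l where "l < d" "x \<in> cell m \<alpha> ! l" by (auto simp: in_set_conv_nth card_edge[OF m])
  then show "x \<in> m \<union> \<alpha>" using nth_slist_mem[OF m] by (auto simp: cell_nth'[OF m])
next
  fix x assume "x \<in> m \<union> \<alpha>"
  then have "\<exists>l<d. x \<in> cell m \<alpha> ! l"
  proof
    assume "x \<in> m"
    then have "x \<in> set (slist m)" by simp
    then obtain l where "l < d" "x = slist m ! l" using length_slist[OF m] by (metis in_set_conv_nth)
    then show ?thesis by (auto simp: cell_nth'[OF m])
  next
    assume x: "x \<in> \<alpha>"
    then obtain l where l: "in_gap (slist m) l x" using \<alpha> lset_in_gap by blast
    then have "l < d" by (simp add: in_gap_def card_edge[OF m])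
    with x l show ?thesis by (auto simp: cell_nth'[OF m])
  qed
  then show "x \<in> \<Union>(set (cell m \<alpha>))" using card_edge[OF m] by (metis UnionI length_cell nth_mem)
qed

text \<open>A vertex of the cell arises from m by replacing several entries by elements of \<alpha>
  in the gaps below them. Each replacement alone gives an edge by the definition of
  \<open>lset\<close>, and \<open>cointerval_exchange\<close> performs them together.\<close>

lemma cell_in_hom_cells:
  assumes m: "m \<in> edges H" and \<alpha>: "\<alpha> \<subseteq> lset m"
  shows "cell m \<alpha> \<in> hom_cells d H"
proof (rule hom_cellsI)
  note len = length_slist[OF m]
  show "length (cell m \<alpha>) = d" by (simp add: card_edge[OF m])
  show "cell m \<alpha> ! l \<noteq> {}" if "l < d" for l using that by (simp add: cell_nth'[OF m])
  show "sorted_wrt set_less (cell m \<alpha>)"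
    unfolding sorted_wrt_iff_nth_less set_less_def
  proof (intro allI impI ballI)
    fix k l x y
    assume kl: "k < l" "l < length (cell m \<alpha>)" and xy: "x \<in> cell m \<alpha> ! k" "y \<in> cell m \<alpha> ! l"
    then have l: "l < d" "k < d" by (simp_all add: card_edge[OF m])
    have "x \<le> slist m ! k" using xy(1) l by (auto simp: cell_nth'[OF m] in_gap_def)
    also have "slist m ! k < y"
      using xy(2) l kl(1) len sorted_wrt_nth_less[OF sorted_slist kl(1), of m] in_gap_less(1)[OF sorted_slist _ _ kl(1), of m y]
      by (auto simp: cell_nth'[OF m])
    finally show "x < y" .
  qed
  fix v assume v: "list_all2 (\<in>) v (cell m \<alpha>)"
  then have lv: "length v = d" by (simp add: list_all2_lengthD card_edge[OF m])
  show "set v \<in> edges H"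
  proof (rule cointerval_exchange[OF cointerval d_graph sorted_slist len _ lv])
    show "set (slist m) \<in> edges H" using m by simp
    fix l assume l: "l < d"
    then have "v ! l \<in> cell m \<alpha> ! l" using v lv by (simp add: list_all2_conv_all_nth)
    then consider "v ! l = slist m ! l" | "v ! l \<in> \<alpha>" "in_gap (slist m) l (v ! l)"
      using l by (auto simp: cell_nth'[OF m])
    then show "v ! l = slist m ! l \<or>
      (in_gap (slist m) l (v ! l) \<and> v ! l \<in> verts H \<and> set ((slist m)[l := v ! l]) \<in> edges H)"
    proof cases
      case 2
      then have "cfun (v ! l) m \<in> edges H" using \<alpha> by (auto simp: lset_def)
      then show ?thesis using 2 in_gap_cfun[OF sorted_slist 2(2)] by (simp add: verts)
    qed simp
  qed
qed

text \<open>Recovers \<alpha> from the cell of (m;\<alpha>); the maxima of the factors recover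
  m.\<close>

definition rest :: "'n set list \<Rightarrow> 'n set" where
  "rest c = \<Union>(set c) - set (map Max c)"

lemma map_Max_cell: "m \<in> edges H \<Longrightarrow> map Max (cell m \<alpha>) = slist m"
  by (intro nth_equalityI) (simp_all add: card_edge Max_cell_nth)

lemma rest_cell: "m \<in> edges H \<Longrightarrow> \<alpha> \<subseteq> lset m \<Longrightarrow> rest (cell m \<alpha>) = \<alpha>"
  unfolding rest_def map_Max_cell Union_cell using lset_disjoint[of m] by auto

text \<open>Surjectivity of the passage from symbols to cells. The maxima form a vertex, hence an
  edge m. Any other j of a factor lies above the preceding factor and below its own maximum, so in a
  gap of m; exchanging this maximum for j gives another vertex of the cell, which puts j into
  \<open>lset m\<close>.\<close>

lemma hom_cell_eq_cell:
  assumes c: "c \<in> hom_cells d H"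
  defines "m \<equiv> set (map Max c)"
  shows "m \<in> edges H" "slist m = map Max c" "rest c \<subseteq> lset m" "cell m (rest c) = c"
proof -
  note D = hom_cellsD[OF c]
  have Max_mem: "Max (c ! l) \<in> c ! l" if "l < d" for l using D(3)[OF that] by simp
  have sorted: "sorted_wrt (<) (map Max c)"
    unfolding sorted_wrt_iff_nth_less
    using sorted_blocks_less[OF D(2)] Max_mem D(1) by simp
  show sl: "slist m = map Max c" unfolding m_def by (rule slist_set[OF sorted])
  show m: "m \<in> edges H" unfolding m_def
    by (rule D(4)) (use D(1) Max_mem in \<open>simp add: list_all2_conv_all_nth\<close>)
  have gap: "in_gap (slist m) l j" if "l < d" "j \<in> c ! l" "j \<noteq> Max (c ! l)" for l j
  proof -
    have "j < Max (c ! l)" using that by (simp add: order_le_neq_trans)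
    moreover have "Max (c ! (l - 1)) < j" if "l \<noteq> 0"
      using sorted_blocks_less[OF D(2), of "l - 1" l "Max (c ! (l - 1))" j] that Max_mem[of "l - 1"]
        \<open>l < d\<close> \<open>j \<in> c ! l\<close> D(1) by simp
    ultimately show ?thesis using that(1) D(1) by (auto simp: in_gap_def sl)
  qed
  have in_rest: "j \<in> rest c" if "l < d" "j \<in> c ! l" "j \<noteq> Max (c ! l)" for l j
  proof -
    have "j \<notin> m" using in_gap_notin[OF sorted_slist gap[OF that]] by simp
    then show ?thesis using that D(1) by (auto simp: rest_def m_def)
  qed
  have rest_gap: "\<exists>l<d. j \<in> c ! l \<and> j \<noteq> Max (c ! l)" if "j \<in> rest c" for j
  proof -
    obtain l where l: "l < d" "j \<in> c ! l" using \<open>j \<in> rest c\<close> D(1) by (auto simp: rest_def in_set_conv_nth)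
    moreover have "j \<noteq> Max (c ! l)"
      using \<open>j \<in> rest c\<close> nth_mem[of l c] l(1) D(1) by (auto simp: rest_def)
    ultimately show ?thesis by blast
  qed
  show "rest c \<subseteq> lset m"
  proof
    fix j assume "j \<in> rest c"
    then obtain l where l: "l < d" "j \<in> c ! l" "j \<noteq> Max (c ! l)" using rest_gap by blast
    have "set ((map Max c)[l := j]) \<in> edges H"
      by (rule D(4)) (use D(1) Max_mem l in \<open>simp add: list_all2_conv_all_nth nth_list_update\<close>)
    then show "j \<in> lset m" using in_gap_lset[OF gap[OF l]] by (simp add: sl)
  qed
  show "cell m (rest c) = c"
  proof (rule nth_equalityI)
    show "length (cell m (rest c)) = length c" using card_edge[OF m] D(1) by simp
    fix l assume "l < length (cell m (rest c))"
    then have l: "l < d" using card_edge[OF m] by simp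
    have "{j \<in> rest c. in_gap (slist m) l j} = c ! l - {Max (c ! l)}"
    proof (intro equalityI subsetI)
      fix j assume j: "j \<in> {j \<in> rest c. in_gap (slist m) l j}"
      then obtain k where k: "k < d" "j \<in> c ! k" "j \<noteq> Max (c ! k)" using rest_gap by blast
      have "k = l" using in_gap_unique[OF sorted_slist gap[OF k]] j by blast
      then show "j \<in> c ! l - {Max (c ! l)}" using k by simp
    next
      fix j assume "j \<in> c ! l - {Max (c ! l)}"
      then show "j \<in> {j \<in> rest c. in_gap (slist m) l j}" using in_rest[OF l] gap[OF l] by simp
    qed
    then show "cell m (rest c) ! l = c ! l"
      using cell_nth'[OF m l, of "rest c"] l D(1) Max_mem[OF l] by (auto simp: sl)
  qed
qed

section \<open>Dimension, signs and label of the cell of a symbol\<close>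

lemma sum_card_cell:
  assumes m: "m \<in> edges H" and "n \<le> d"
  shows "(\<Sum>k<n. card (cell m \<alpha> ! k) - 1) = card {j \<in> \<alpha>. \<exists>k<n. in_gap (slist m) k j}"
  using assms(2)
proof (induction n)
  case (Suc n)
  \<comment> \<open>Factor n consists of the elements of \<alpha> in gap n and one further element,
    so its dimension counts the former.\<close>
  have "slist m ! n \<notin> {j \<in> \<alpha>. in_gap (slist m) n j}" by (auto simp: in_gap_def)
  then have "card (cell m \<alpha> ! n) - 1 = card {j \<in> \<alpha>. in_gap (slist m) n j}"
    using Suc.prems by (simp add: cell_nth'[OF m])
  moreover have "{j \<in> \<alpha>. \<exists>k<Suc n. in_gap (slist m) k j} =
      {j \<in> \<alpha>. \<exists>k<n. in_gap (slist m) k j} \<union> {j \<in> \<alpha>. in_gap (slist m) n j}"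
    by (auto simp: less_Suc_eq)
  moreover have "{j \<in> \<alpha>. \<exists>k<n. in_gap (slist m) k j} \<inter> {j \<in> \<alpha>. in_gap (slist m) n j} = {}"
    using in_gap_unique[OF sorted_slist, of m] by blast
  ultimately show ?case using Suc by (simp add: card_Un_disjoint)
qed simp

lemma cell_dim_cell:
  assumes m: "m \<in> edges H" and \<alpha>: "\<alpha> \<subseteq> lset m"
  shows "cell_dim (cell m \<alpha>) = card \<alpha>"
proof -
  have "\<exists>k<d. in_gap (slist m) k j" if j: "j \<in> \<alpha>" for j
  proof -
    obtain k where k: "in_gap (slist m) k j" using j \<alpha> lset_in_gap by blast
    then show ?thesis by (auto simp: in_gap_def card_edge[OF m])
  qed
  then have "{j \<in> \<alpha>. \<exists>k<d. in_gap (slist m) k j} = \<alpha>" by blast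
  then show ?thesis using sum_card_cell[OF m order_refl] by (simp add: cell_dim_eq_sum card_edge[OF m])
qed

text \<open>The dimensions of the earlier factors count the elements of \<alpha> in earlier gaps,
  the second summand counts those in the same gap below w. Together these are all elements of
  \<alpha> below w, the exponent of the Koszul sign.\<close>

lemma sign_exp_cell:
  assumes m: "m \<in> edges H" and \<alpha>: "\<alpha> \<subseteq> lset m" and l: "l < d" and w: "w \<in> cell m \<alpha> ! l"
  shows "sign_exp (cell m \<alpha>) l w = card {j \<in> \<alpha>. j < w}"
proof -
  let ?xs = "slist m"
  have wl: "w \<le> ?xs ! l" using w l by (auto simp: cell_nth'[OF m] in_gap_def)
  have lw: "?xs ! k < w" if "k < l" for k
    using w l that length_slist[OF m] sorted_wrt_nth_less[OF sorted_slist that, of m]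
      in_gap_less(1)[OF sorted_slist _ _ that, of m w]
    by (auto simp: cell_nth'[OF m])
  have 1: "{v \<in> cell m \<alpha> ! l. v < w} = {j \<in> \<alpha>. in_gap ?xs l j \<and> j < w}"
    using wl l by (auto simp: cell_nth'[OF m])
  have 2: "{j \<in> \<alpha>. j < w} = {j \<in> \<alpha>. \<exists>k<l. in_gap ?xs k j} \<union> {j \<in> \<alpha>. in_gap ?xs l j \<and> j < w}"
  proof (intro equalityI subsetI)
    fix j assume j: "j \<in> {j \<in> \<alpha>. j < w}"
    then obtain k where k: "in_gap ?xs k j" using \<alpha> lset_in_gap by blast
    have "\<not> l < k"
    proof
      assume "l < k"
      then have "?xs ! l < j" using in_gap_less(1)[OF sorted_slist k, of l] l length_slist[OF m] by simp
      also have "j < w" using j by simp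
      finally show False using wl by simp
    qed
    then show "j \<in> {j \<in> \<alpha>. \<exists>k<l. in_gap ?xs k j} \<union> {j \<in> \<alpha>. in_gap ?xs l j \<and> j < w}"
      using j k by (metis (mono_tags, lifting) UnI1 UnI2 linorder_neqE_nat mem_Collect_eq)
  next
    fix j assume j: "j \<in> {j \<in> \<alpha>. \<exists>k<l. in_gap ?xs k j} \<union> {j \<in> \<alpha>. in_gap ?xs l j \<and> j < w}"
    then show "j \<in> {j \<in> \<alpha>. j < w}"
    proof
      assume "j \<in> {j \<in> \<alpha>. \<exists>k<l. in_gap ?xs k j}"
      then obtain k where k: "j \<in> \<alpha>" "k < l" "in_gap ?xs k j" by blast
      then have "j < ?xs ! k" by (simp add: in_gap_def)
      then show ?thesis using k lw[OF k(2)] by simp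
    qed auto
  qed
  have "{j \<in> \<alpha>. \<exists>k<l. in_gap ?xs k j} \<inter> {j \<in> \<alpha>. in_gap ?xs l j \<and> j < w} = {}"
    using in_gap_unique[OF sorted_slist, of m] by blast
  then have "card {j \<in> \<alpha>. j < w} = card {j \<in> \<alpha>. \<exists>k<l. in_gap ?xs k j} + card {j \<in> \<alpha>. in_gap ?xs l j \<and> j < w}"
    unfolding 2 by (intro card_Un_disjoint) auto
  then show ?thesis unfolding sign_exp_def 1 using sum_card_cell[OF m, of l] l by simp
qed

lemma cell_label_hom_cell:
  assumes c: "c \<in> hom_cells d H"
  shows "cell_label c = mon (\<Union>(set c))"
proof -
  have "\<Union>(set c) = (\<Union>l<length c. c ! l)"
    using nth_image[of "length c" c] by (simp add: atLeast0LessThan)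
  moreover have "c ! k \<inter> c ! l = {}" if "k < length c" "l < length c" "k \<noteq> l" for k l
    using sorted_blocks_unique[OF hom_cellsD(2)[OF c]] that by blast
  then have "sum f (\<Union>l<length c. c ! l) = (\<Sum>l<length c. sum f (c ! l))" for f :: "'n \<Rightarrow> 'n monom"
    by (intro sum.UNION_disjoint) simp_all
  ultimately show ?thesis by (simp only: cell_label_eq_sum mon_def)
qed

lemma cell_label_cell:
  assumes m: "m \<in> edges H" and \<alpha>: "\<alpha> \<subseteq> lset m"
  shows "cell_label (cell m \<alpha>) = mon m + mon \<alpha>"
  unfolding cell_label_hom_cell[OF cell_in_hom_cells[OF assms]] Union_cell[OF assms]
  using \<alpha> lset_disjoint[of m] by (intro mon_Un_disjoint) auto

section \<open>Facets of the cell of a symbol\<close>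

definition gap_index :: "'n set \<Rightarrow> 'n \<Rightarrow> nat" where
  "gap_index m j = (THE l. in_gap (slist m) l j)"

lemma gap_index_eq: "in_gap (slist m) l j \<Longrightarrow> gap_index m j = l"
  unfolding gap_index_def by (rule the_equality) (auto dest: in_gap_unique[OF sorted_slist])

lemma in_gap_gap_index:
  assumes "j \<in> lset m"
  shows "in_gap (slist m) (gap_index m j) j"
  using assms gap_index_eq by (metis lset_in_gap)

lemma gap_index_less: "m \<in> edges H \<Longrightarrow> j \<in> lset m \<Longrightarrow> gap_index m j < d"
  using in_gap_gap_index[of j m] by (simp add: in_gap_def card_edge)

text \<open>The element of m that c(x_j m) drops; for j in \<alpha> it is the maximum of the factor
  that contains j.\<close>

definition nxt :: "'n set \<Rightarrow> 'n \<Rightarrow> 'n" where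
  "nxt m j = Min {t \<in> m. j \<le> t}"

lemma nxt_eq: "in_gap (slist m) l j \<Longrightarrow> nxt m j = slist m ! l"
  using in_gap_Min[OF sorted_slist, of m l j] by (simp add: nxt_def)

lemma nxt_gap_index: "j \<in> lset m \<Longrightarrow> nxt m j = slist m ! gap_index m j"
  by (rule nxt_eq[OF in_gap_gap_index])

lemma less_nxt: "j \<in> lset m \<Longrightarrow> j < nxt m j"
  using in_gap_gap_index[of j m] by (simp add: nxt_gap_index in_gap_def)

lemma nxt_mem: "m \<in> edges H \<Longrightarrow> j \<in> lset m \<Longrightarrow> nxt m j \<in> m"
  by (simp add: nxt_gap_index nth_slist_mem gap_index_less)

lemma tset_iff: "j \<in> tset m \<alpha> \<longleftrightarrow> j \<in> \<alpha> \<and> (\<forall>k\<in>\<alpha>. j < k \<longrightarrow> nxt m j < k)"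
  by (simp add: tset_def nxt_def)

lemma tset_same_gap:
  assumes "\<alpha> \<subseteq> lset m" "j \<in> tset m \<alpha>" "k \<in> \<alpha>" "gap_index m j = gap_index m k"
  shows "k \<le> j"
proof (rule ccontr)
  assume "\<not> k \<le> j"
  then have "nxt m j < k" using assms by (simp add: tset_iff)
  moreover have "nxt m j = nxt m k" using assms nxt_gap_index by (metis tset_iff subsetD)
  ultimately show False using less_nxt[of k m] assms by auto
qed

text \<open>A facet removes either an element of \<alpha> or the maximum of a factor. The maximum is
  removable if and only if its gap meets \<alpha>, and then the facet is indexed by the largest such
  element, which is the member of T(\<alpha>) in that gap.\<close>

lemma faces_cell:
  assumes m: "m \<in> edges H" and \<alpha>: "\<alpha> \<subseteq> lset m"
  shows "faces (cell m \<alpha>) = (\<lambda>j. (gap_index m j, j)) ` \<alpha> \<union> (\<lambda>j. (gap_index m j, nxt m j)) ` tset m \<alpha>"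
    (is "?F = ?A \<union> ?B")
proof (intro equalityI subsetI)
  fix x assume "x \<in> ?F"
  then obtain l w where x: "x = (l, w)" "l < d" "w \<in> cell m \<alpha> ! l" "2 \<le> card (cell m \<alpha> ! l)"
    by (auto simp: faces_def card_edge[OF m])
  show "x \<in> ?A \<union> ?B"
  proof (cases "w = slist m ! l")
    case False
    then have "w \<in> \<alpha>" "in_gap (slist m) l w" using x by (auto simp: cell_nth'[OF m])
    then have "x = (gap_index m w, w)" using x(1) by (simp add: gap_index_eq)
    then show ?thesis using \<open>w \<in> \<alpha>\<close> by blast
  next
    case True
    let ?X = "{j \<in> \<alpha>. in_gap (slist m) l j}"
    have ne: "?X \<noteq> {}"
    proof
      assume "?X = {}"
      then have "cell m \<alpha> ! l = {slist m ! l}" unfolding cell_nth'[OF m x(2)] by (simp only:)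
      then show False using x(4) by simp
    qed
    define j where "j = Max ?X"
    have "j \<in> ?X" unfolding j_def using ne by (intro Max_in) auto
    then have j: "j \<in> \<alpha>" "in_gap (slist m) l j" by auto
    \<comment> \<open>By maximality of j a larger k of \<alpha> is outside the gap, and it cannot be
      the closing entry because \<alpha> and m are disjoint.\<close>
    have "nxt m j < k" if k: "k \<in> \<alpha>" "j < k" for k
    proof -
      have "\<not> in_gap (slist m) l k"
      proof
        assume "in_gap (slist m) l k"
        then have "k \<le> j" unfolding j_def using k(1) by (intro Max_ge) auto
        then show False using k(2) by simp
      qed
      then have "slist m ! l \<le> k" using j(2) k(2) by (auto simp: in_gap_def)
      moreover have "slist m ! l \<noteq> k" using nth_slist_mem[OF m x(2)] k(1) \<alpha> lset_disjoint[of m] by blast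
      ultimately show ?thesis by (simp add: nxt_eq[OF j(2)])
    qed
    then have "j \<in> tset m \<alpha>" using j by (simp add: tset_iff)
    moreover have "x = (gap_index m j, nxt m j)" using x(1) True j by (simp add: gap_index_eq nxt_eq)
    ultimately show ?thesis by blast
  qed
next
  have two: "2 \<le> card (cell m \<alpha> ! gap_index m j)" "gap_index m j < d"
    "j \<in> cell m \<alpha> ! gap_index m j" "nxt m j \<in> cell m \<alpha> ! gap_index m j" if "j \<in> \<alpha>" for j
  proof -
    have j: "j \<in> lset m" using that \<alpha> by blast
    show l: "gap_index m j < d" by (rule gap_index_less[OF m j])
    show a: "j \<in> cell m \<alpha> ! gap_index m j" "nxt m j \<in> cell m \<alpha> ! gap_index m j"
      using that in_gap_gap_index[OF j] nxt_gap_index[OF j] by (simp_all add: cell_nth'[OF m l])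
    then have "card {j, nxt m j} \<le> card (cell m \<alpha> ! gap_index m j)" by (intro card_mono) auto
    then show "2 \<le> card (cell m \<alpha> ! gap_index m j)" using less_nxt[OF j] by simp
  qed
  fix x assume "x \<in> ?A \<union> ?B"
  then show "x \<in> ?F" using two by (auto simp: faces_def card_edge[OF m] tset_iff)
qed

lemma del_cell:
  assumes m: "m \<in> edges H" and \<alpha>: "\<alpha> \<subseteq> lset m" and j: "j \<in> \<alpha>"
  shows "del (cell m \<alpha>) (gap_index m j) j = cell m (\<alpha> - {j})"
proof (rule nth_equalityI)
  have jl: "j \<in> lset m" using \<alpha> j by blast
  fix i assume "i < length (del (cell m \<alpha>) (gap_index m j) j)"
  then have i: "i < d" by (simp add: card_edge[OF m])
  have "j \<noteq> slist m ! i" using nth_slist_mem[OF m i] lset_disjoint[of m] jl by blast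
  moreover have "in_gap (slist m) i j \<longleftrightarrow> i = gap_index m j"
    using in_gap_gap_index[OF jl] gap_index_eq by metis
  ultimately show "del (cell m \<alpha>) (gap_index m j) j ! i = cell m (\<alpha> - {j}) ! i"
    using gap_index_less[OF m jl] i by (auto simp: del_nth card_edge[OF m] cell_nth'[OF m])
qed simp

text \<open>Once the maximum of its factor is gone, j becomes the new maximum, so the maxima form
  c(x_j m) and the other elements are \<alpha> - {j}. Reading the symbol off the facet with
  \<open>hom_cell_eq_cell\<close> also shows that this symbol is admissible, which is the second
  claim.\<close>

lemma del_cell_nxt:
  assumes m: "m \<in> edges H" and \<alpha>: "\<alpha> \<subseteq> lset m" and j: "j \<in> tset m \<alpha>"
  shows "del (cell m \<alpha>) (gap_index m j) (nxt m j) = cell (cfun j m) (\<alpha> - {j})"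
    "\<alpha> - {j} \<subseteq> lset (cfun j m)"
proof -
  have ja: "j \<in> \<alpha>" using j by (simp add: tset_iff)
  then have jl: "j \<in> lset m" using \<alpha> by blast
  let ?l = "gap_index m j" and ?t = "nxt m j"
  let ?c = "del (cell m \<alpha>) ?l ?t"
  have l: "?l < d" by (rule gap_index_less[OF m jl])
  note g = in_gap_gap_index[OF jl]
  have "(?l, ?t) \<in> faces (cell m \<alpha>)" unfolding faces_cell[OF m \<alpha>] using j by blast
  then have c: "?c \<in> hom_cells d H" by (rule del_hom_cells[OF cell_in_hom_cells[OF m \<alpha>]])
  have block: "cell m \<alpha> ! ?l - {?t} = {k \<in> \<alpha>. in_gap (slist m) ?l k}"
    unfolding cell_nth'[OF m l] nxt_gap_index[OF jl] by (auto simp: in_gap_def)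
  have "Max (cell m \<alpha> ! ?l - {?t}) = j"
    unfolding block
  proof (rule Max_eqI)
    fix k assume k: "k \<in> {k \<in> \<alpha>. in_gap (slist m) ?l k}"
    then have "?l = gap_index m k" using gap_index_eq[of m ?l k] by simp
    then show "k \<le> j" using tset_same_gap[OF \<alpha> j] k by blast
  qed (use ja g in auto)
  then have mx: "map Max ?c = (slist m)[?l := j]"
    using l by (intro nth_equalityI) (auto simp: del_nth card_edge[OF m] Max_cell_nth[OF m] nth_list_update)
  then have mset: "set (map Max ?c) = cfun j m"
    using in_gap_cfun[OF sorted_slist g] by simp
  have U: "\<Union>(set ?c) = (m \<union> \<alpha>) - {?t}"
  proof (intro equalityI subsetI)
    fix x assume "x \<in> \<Union>(set ?c)"
    then obtain i where i: "i < d" "x \<in> ?c ! i" by (auto simp: in_set_conv_nth card_edge[OF m])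
    then have xi: "x \<in> cell m \<alpha> ! i" using l by (auto simp: del_nth card_edge[OF m] split: if_splits)
    then have "x \<in> \<Union>(set (cell m \<alpha>))" using i(1) card_edge[OF m] by (metis UnionI length_cell nth_mem)
    moreover have "x \<noteq> ?t"
    proof
      assume "x = ?t"
      moreover have "?t \<in> cell m \<alpha> ! ?l" by (simp add: cell_nth'[OF m l] nxt_gap_index[OF jl])
      ultimately have "i = ?l"
        using sorted_blocks_unique[OF hom_cellsD(2)[OF cell_in_hom_cells[OF m \<alpha>]], of i ?l x] xi i(1) l
        by (simp add: card_edge[OF m])
      then show False using i l \<open>x = ?t\<close> by (simp add: del_nth card_edge[OF m])
    qed
    ultimately show "x \<in> (m \<union> \<alpha>) - {?t}" using Union_cell[OF m \<alpha>] by blast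
  next
    fix x assume "x \<in> (m \<union> \<alpha>) - {?t}"
    then have "x \<in> \<Union>(set (cell m \<alpha>))" "x \<noteq> ?t" using Union_cell[OF m \<alpha>] by blast+
    then obtain i where i: "i < d" "x \<in> cell m \<alpha> ! i" by (auto simp: in_set_conv_nth card_edge[OF m])
    then have "x \<in> ?c ! i" using \<open>x \<noteq> ?t\<close> l by (auto simp: del_nth card_edge[OF m])
    moreover have "?c ! i \<in> set ?c" using i(1) by (simp add: card_edge[OF m])
    ultimately show "x \<in> \<Union>(set ?c)" by blast
  qed
  have "cfun j m = insert j (m - {?t})" by (simp add: cfun_def nxt_def)
  moreover have "?t \<notin> \<alpha>" using nxt_mem[OF m jl] \<alpha> lset_disjoint[of m] by blast
  moreover have "\<alpha> \<inter> m = {}" using \<alpha> lset_disjoint[of m] by blast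
  ultimately have "rest ?c = \<alpha> - {j}"
    unfolding rest_def mset U by blast
  then show "?c = cell (cfun j m) (\<alpha> - {j})" "\<alpha> - {j} \<subseteq> lset (cfun j m)"
    using hom_cell_eq_cell[OF c] unfolding mset by simp_all
qed

text \<open>The elements of \<alpha> below the closing entry are those up to j. The additional j is
  why the two sums of the differential have opposite signs.\<close>

lemma card_less_nxt:
  assumes "\<alpha> \<subseteq> lset m" "j \<in> tset m \<alpha>"
  shows "card {k \<in> \<alpha>. k < nxt m j} = Suc (card {k \<in> \<alpha>. k < j})"
proof -
  have j: "j \<in> \<alpha>" "j < nxt m j" using assms less_nxt by (auto simp: tset_iff)
  have "{k \<in> \<alpha>. k < nxt m j} = {k \<in> \<alpha>. k \<le> j}"
    using assms(2) j by (force simp: tset_iff)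
  then show ?thesis using card_le_eq_Suc_card_less[OF finite j(1)] by simp
qed

lemma diff_cellular_cell:
  assumes m: "m \<in> edges H" and \<alpha>: "\<alpha> \<subseteq> lset m" "\<alpha> \<noteq> {}"
  shows "diff (cellular :: ('n, 'k::field, _) based_complex) (Some (cell m \<alpha>)) =
    (\<Sum>j\<in>\<alpha>. Poly_Mapping.single (Some (cell m (\<alpha> - {j}))) (- ((-1) ^ card {k \<in> \<alpha>. k < j}) * var j)) +
    (\<Sum>j\<in>tset m \<alpha>. Poly_Mapping.single (Some (cell (cfun j m) (\<alpha> - {j})))
        ((-1) ^ card {k \<in> \<alpha>. k < j} * var (nxt m j)))"
proof -
  let ?c = "cell m \<alpha>"
  let ?h = "\<lambda>(l, w). Poly_Mapping.single (Some (del ?c l w)) (- ((-1) ^ sign_exp ?c l w) * (var w :: ('n, 'k) mpoly))"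
  let ?f = "\<lambda>j. (gap_index m j, j)" and ?g = "\<lambda>j. (gap_index m j, nxt m j)"
  have T: "tset m \<alpha> \<subseteq> \<alpha>" by (auto simp: tset_iff)
  have dim: "cell_dim ?c \<noteq> 0" using \<alpha> by (simp add: cell_dim_cell[OF m \<alpha>(1)])
  have "?f ` \<alpha> \<inter> ?g ` tset m \<alpha> = {}"
  proof (rule equals0I)
    fix x assume "x \<in> ?f ` \<alpha> \<inter> ?g ` tset m \<alpha>"
    then obtain j k where "j \<in> \<alpha>" "k \<in> tset m \<alpha>" "j = nxt m k" by auto
    then have "j \<in> lset m" "j \<in> m" using nxt_mem[OF m, of k] \<alpha>(1) T by blast+
    then show False using lset_disjoint[of m] by blast
  qed
  then have "diff (cellular :: ('n, 'k, _) based_complex) (Some ?c) = sum ?h (?f ` \<alpha>) + sum ?h (?g ` tset m \<alpha>)"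
    unfolding diff_cellular[OF cell_in_hom_cells[OF m \<alpha>(1)] dim] faces_cell[OF m \<alpha>(1)]
    by (intro sum.union_disjoint) auto
  also have "sum ?h (?f ` \<alpha>) =
    (\<Sum>j\<in>\<alpha>. Poly_Mapping.single (Some (cell m (\<alpha> - {j}))) (- ((-1) ^ card {k \<in> \<alpha>. k < j}) * var j))"
  proof (subst sum.reindex)
    show "inj_on ?f \<alpha>" by (auto intro: inj_onI)
    show "sum (?h \<circ> ?f) \<alpha> = (\<Sum>j\<in>\<alpha>. Poly_Mapping.single (Some (cell m (\<alpha> - {j}))) (- ((-1) ^ card {k \<in> \<alpha>. k < j}) * var j))"
    proof (rule sum.cong[OF refl])
      fix j assume j: "j \<in> \<alpha>"
      then have jl: "j \<in> lset m" using \<alpha> by blast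
      have "j \<in> ?c ! gap_index m j"
        using j in_gap_gap_index[OF jl] by (simp add: cell_nth'[OF m gap_index_less[OF m jl]])
      from sign_exp_cell[OF m \<alpha>(1) gap_index_less[OF m jl] this]
      show "(?h \<circ> ?f) j = Poly_Mapping.single (Some (cell m (\<alpha> - {j}))) (- ((-1) ^ card {k \<in> \<alpha>. k < j}) * var j)"
        by (simp only: comp_def case_prod_conv del_cell[OF m \<alpha>(1) j])
    qed
  qed
  also have "sum ?h (?g ` tset m \<alpha>) = (\<Sum>j\<in>tset m \<alpha>. Poly_Mapping.single (Some (cell (cfun j m) (\<alpha> - {j})))
        ((-1) ^ card {k \<in> \<alpha>. k < j} * var (nxt m j)))"
  proof (subst sum.reindex)
    show "inj_on ?g (tset m \<alpha>)"
    proof (rule inj_onI)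
      fix x y assume xy: "x \<in> tset m \<alpha>" "y \<in> tset m \<alpha>" "?g x = ?g y"
      then have "y \<le> x" "x \<le> y"
        using tset_same_gap[OF \<alpha>(1) xy(1), of y] tset_same_gap[OF \<alpha>(1) xy(2), of x] T by auto
      then show "x = y" by simp
    qed
    show "sum (?h \<circ> ?g) (tset m \<alpha>) = (\<Sum>j\<in>tset m \<alpha>. Poly_Mapping.single (Some (cell (cfun j m) (\<alpha> - {j})))
        ((-1) ^ card {k \<in> \<alpha>. k < j} * var (nxt m j)))"
    proof (rule sum.cong[OF refl])
      fix j assume j: "j \<in> tset m \<alpha>"
      then have jl: "j \<in> lset m" using \<alpha> T by blast
      have "nxt m j \<in> ?c ! gap_index m j"
        by (simp add: cell_nth'[OF m gap_index_less[OF m jl]] nxt_gap_index[OF jl])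
      from sign_exp_cell[OF m \<alpha>(1) gap_index_less[OF m jl] this]
      have "sign_exp ?c (gap_index m j) (nxt m j) = Suc (card {k \<in> \<alpha>. k < j})"
        using card_less_nxt[OF \<alpha>(1) j] by (simp only:)
      then show "(?h \<circ> ?g) j = Poly_Mapping.single (Some (cell (cfun j m) (\<alpha> - {j})))
        ((-1) ^ card {k \<in> \<alpha>. k < j} * var (nxt m j))"
        by (simp only: comp_def case_prod_conv del_cell_nxt(1)[OF m \<alpha>(1) j] power_Suc mult_minus_left mult_1 minus_minus)
    qed
  qed
  finally show ?thesis .
qed

end

section \<open>The iterated mapping cone\<close>

lemma relabel_ident [simp]: "relabel (\<lambda>a. a) x = x"
  using relabel_id[of x] by (simp add: id_def)

lemma keys_sign_monomial:
  "Poly_Mapping.keys ((-1) ^ k * monomial t :: ('n, 'k::field) mpoly) = {t}"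
  by (simp add: minus_one_power_iff)

lemma diff_koszul_free:
  "diff (koszul S :: ('n::{finite,linorder}, 'k::field, _) based_complex) \<alpha> \<in> free ((\<lambda>j. \<alpha> - {j}) ` \<alpha>)"
  unfolding diff_koszul by (intro free_sum free_single imageI)

text \<open>Every \<alpha> is a basis element of the Koszul complex on all variables, whose
  differential is given by the same formula.\<close>

lemma koszul_square_zero:
  "lin (diff (koszul S)) (diff (koszul S :: ('n::{finite,linorder}, 'k::field, _) based_complex) \<alpha>) = 0"
proof -
  have gr: "graded_complex (koszul UNIV :: ('n, 'k, _) based_complex)"
    using koszul_resolves[where S = "UNIV :: 'n set" and 'k = 'k] by (simp add: resolves_def)
  have S: "diff (koszul S :: ('n, 'k, _) based_complex) = diff (koszul UNIV)" by (simp add: koszul_def)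
  show ?thesis
  proof (cases "card \<alpha>")
    case 0
    then show ?thesis using graded_complexD(2)[OF gr, of \<alpha>] by (simp add: S basis_koszul)
  next
    case (Suc p)
    then show ?thesis using graded_complexD(5)[OF gr, of \<alpha> p] by (simp add: S basis_koszul)
  qed
qed

section \<open>The complex of symbols and the lifts\<close>

context cointerval_hypergraph
begin

text \<open>The sum over T(\<alpha>) in the theorem. At the empty set it is multiplication by m into
  R, the map that has to be lifted.\<close>

definition cone_lift :: "'n set \<Rightarrow> 'n set \<Rightarrow> ('n symbol \<Rightarrow>\<^sub>0 ('n, 'k::field) mpoly)" where
  "cone_lift m \<alpha> = (if \<alpha> = {} then Poly_Mapping.single Base (monomial (mon m))
     else (\<Sum>j\<in>tset m \<alpha>. Poly_Mapping.single (Sym (cfun j m) (\<alpha> - {j}))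
        ((-1) ^ card {k \<in> \<alpha>. k < j} * monomial (mon {j} + mon m - mon (cfun j m)))))"

text \<open>The Koszul differential on all variables is used so that one function serves all
  generators, whatever their set(m).\<close>

fun symdiff :: "'n symbol \<Rightarrow> ('n symbol \<Rightarrow>\<^sub>0 ('n, 'k::field) mpoly)" where
  "symdiff Base = 0"
| "symdiff (Sym m \<alpha>) = - relabel (Sym m) (diff (koszul UNIV) \<alpha>) + cone_lift m \<alpha>"

fun symdeg :: "'n symbol \<Rightarrow> 'n monom" where
  "symdeg Base = 0"
| "symdeg (Sym m \<alpha>) = mon m + mon \<alpha>"

definition symbols :: "'n set set \<Rightarrow> nat \<Rightarrow> 'n symbol set" where
  "symbols E i = (if i = 0 then {Base} else {Sym m \<alpha> | m \<alpha>. m \<in> E \<and> \<alpha> \<subseteq> lset m \<and> Suc (card \<alpha>) = i})"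

text \<open>The stage at which the generators in E have been adjoined. Stages differ in their bases
  only; degrees and differential are common to all of them.\<close>

definition symcomplex :: "'n set set \<Rightarrow> ('n, 'k::field, 'n symbol) based_complex" where
  "symcomplex E = \<lparr>basis = symbols E, mdeg = symdeg, diff = symdiff\<rparr>"

lemma symcomplex_simps [simp]:
  "basis (symcomplex E) = symbols E" "mdeg (symcomplex E) = symdeg" "diff (symcomplex E) = symdiff"
  by (simp_all add: symcomplex_def)

lemma symbols_0: "symbols E 0 = {Base}"
  by (simp add: symbols_def)

lemma Sym_in_symbols [simp]: "Sym m \<alpha> \<in> symbols E i \<longleftrightarrow> m \<in> E \<and> \<alpha> \<subseteq> lset m \<and> Suc (card \<alpha>) = i"
  by (auto simp: symbols_def)

lemma Base_in_symbols [simp]: "Base \<in> symbols E i \<longleftrightarrow> i = 0"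
  by (auto simp: symbols_def)

text \<open>c exchanges \<open>nxt m j\<close> for j. Therefore the truncated difference of
  exponents in the formula is a true quotient, namely a single variable.\<close>

lemma cfun_degree:
  assumes m: "m \<in> edges H" and j: "j \<in> lset m"
  shows "mon {j} + mon m = mon {nxt m j} + mon (cfun j m)"
    "mon {j} + mon m - mon (cfun j m) = mon {nxt m j}"
proof -
  have c: "cfun j m = insert j (m - {nxt m j})" by (simp add: cfun_def nxt_def)
  have "mon (cfun j m) = mon {j} + mon (m - {nxt m j})"
    unfolding c using j by (intro mon_insert) (auto simp: lset_def)
  moreover have "mon m = mon {nxt m j} + mon (m - {nxt m j})"
    using nxt_mem[OF m j] by (intro mon_remove) auto
  ultimately show *: "mon {j} + mon m = mon {nxt m j} + mon (cfun j m)" by (simp only: add_ac)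
  show "mon {j} + mon m - mon (cfun j m) = mon {nxt m j}" unfolding * by simp
qed

lemma tset_subset: "tset m \<alpha> \<subseteq> \<alpha>"
  by (auto simp: tset_iff)

lemma cone_lift_eq:
  assumes "m \<in> edges H" "\<alpha> \<subseteq> lset m" "\<alpha> \<noteq> {}"
  shows "(cone_lift m \<alpha> :: _ \<Rightarrow>\<^sub>0 ('n, 'k::field) mpoly) = (\<Sum>j\<in>tset m \<alpha>. Poly_Mapping.single (Sym (cfun j m) (\<alpha> - {j}))
        ((-1) ^ card {k \<in> \<alpha>. k < j} * var (nxt m j)))"
proof -
  have "mon {j} + mon m - mon (cfun j m) = mon {nxt m j}" if "j \<in> tset m \<alpha>" for j
    using cfun_degree(2)[OF assms(1), of j] that assms(2) tset_subset by blast
  then show ?thesis using assms(3) by (auto simp: cone_lift_def var_eq intro!: sum.cong)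
qed

text \<open>Koszul terms correspond to removals of elements of \<alpha>, terms of the lift to
  removals of maxima. For empty \<alpha> the cell is a vertex with label m.\<close>

lemma relabel_symdiff:
  assumes m: "m \<in> edges H" and \<alpha>: "\<alpha> \<subseteq> lset m"
  shows "relabel symbol_cell (symdiff (Sym m \<alpha>) :: _ \<Rightarrow>\<^sub>0 ('n, 'k::field) mpoly) =
    diff cellular (symbol_cell (Sym m \<alpha>))"
proof (cases "\<alpha> = {}")
  case True
  then show ?thesis
    using cell_dim_cell[OF m \<alpha>] cell_label_cell[OF m \<alpha>]
    by (simp add: diff_koszul cone_lift_def diff_cellular_vertex symbol_cell_Sym del: symbol_cell.simps(2))
next
  case False
  show ?thesis
    unfolding symbol_cell_Sym diff_cellular_cell[OF m \<alpha> False] symdiff.simps cone_lift_eq[OF m \<alpha> False]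
    by (simp add: relabel_add relabel_diff relabel_relabel relabel_sum diff_koszul symbol_cell_Sym sum_negf
        single_uminus del: symbol_cell.simps(2))
qed

definition all_symbols :: "'n symbol set" where
  "all_symbols = insert Base {Sym m \<alpha> | m \<alpha>. m \<in> edges H \<and> \<alpha> \<subseteq> lset m}"

lemma inj_symbol_cell: "inj_on symbol_cell all_symbols"
proof (rule inj_onI)
  fix x y assume xy: "x \<in> all_symbols" "y \<in> all_symbols" "symbol_cell x = symbol_cell y"
  show "x = y"
  proof (cases x; cases y)
    fix m \<alpha> m' \<alpha>' assume e: "x = Sym m \<alpha>" "y = Sym m' \<alpha>'"
    then have c: "cell m \<alpha> = cell m' \<alpha>'" and m: "m \<in> edges H" "\<alpha> \<subseteq> lset m" "m' \<in> edges H" "\<alpha>' \<subseteq> lset m'"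
      using xy by (simp_all add: all_symbols_def symbol_cell_Sym del: symbol_cell.simps(2))
    have "slist m = slist m'" using map_Max_cell[OF m(1)] map_Max_cell[OF m(3)] c by metis
    then have "m = m'" by (metis finite set_sorted_list_of_set)
    moreover have "\<alpha> = \<alpha>'" using rest_cell[OF m(1,2)] rest_cell[OF m(3,4)] c by simp
    ultimately show ?thesis using e by simp
  qed (use xy in \<open>auto simp: all_symbols_def\<close>)
qed

text \<open>The generators c(x_j m) precede m, so the lift takes its values in the stage built
  before m is adjoined.\<close>

lemma cone_lift_free:
  assumes m: "m \<in> edges H" and \<alpha>: "\<alpha> \<subseteq> lset m"
  shows "(cone_lift m \<alpha> :: _ \<Rightarrow>\<^sub>0 ('n, 'k::field) mpoly) \<in> free (symbols {e \<in> edges H. slist e < slist m} (card \<alpha>))"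
proof (cases "\<alpha> = {}")
  case True
  then show ?thesis by (auto simp: cone_lift_def intro: free_single)
next
  case False
  show ?thesis unfolding cone_lift_eq[OF m \<alpha> False]
  proof (intro free_sum free_single)
    fix j assume j: "j \<in> tset m \<alpha>"
    then have ja: "j \<in> \<alpha>" using tset_subset by blast
    then have jl: "j \<in> lset m" using \<alpha> by blast
    have "0 < card \<alpha>" using ja by (auto simp: card_gt_0_iff)
    then show "Sym (cfun j m) (\<alpha> - {j}) \<in> symbols {e \<in> edges H. slist e < slist m} (card \<alpha>)"
      using cfun_earlier[OF m jl] del_cell_nxt(2)[OF m \<alpha> j] ja by simp
  qed
qed

lemma symbols_subset: "E \<subseteq> edges H \<Longrightarrow> symbols E i \<subseteq> all_symbols"
  by (auto simp: symbols_def all_symbols_def)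

lemma symdiff_free:
  assumes "b \<in> all_symbols"
  shows "(symdiff b :: _ \<Rightarrow>\<^sub>0 ('n, 'k::field) mpoly) \<in> free all_symbols"
proof (cases b)
  case (Sym m \<alpha>)
  then have m: "m \<in> edges H" and \<alpha>: "\<alpha> \<subseteq> lset m" using assms by (auto simp: all_symbols_def)
  have "(cone_lift m \<alpha> :: _ \<Rightarrow>\<^sub>0 ('n, 'k) mpoly) \<in> free all_symbols"
    using cone_lift_free[OF m \<alpha>] by (rule free_mono) (rule symbols_subset, blast)
  moreover have "relabel (Sym m) (diff (koszul UNIV :: ('n, 'k, _) based_complex) \<alpha>) \<in> free all_symbols"
    using diff_koszul_free by (rule relabel_free) (use m \<alpha> in \<open>auto simp: all_symbols_def\<close>)
  ultimately show ?thesis unfolding Sym symdiff.simps by (intro free_add free_uminus)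
qed simp

text \<open>The injection of symbols into cells intertwines the two differentials, so the vanishing
  of the cellular square can be pulled back.\<close>

lemma symdiff_square_zero:
  assumes b: "b \<in> all_symbols"
  shows "lin symdiff (symdiff b :: _ \<Rightarrow>\<^sub>0 ('n, 'k::field) mpoly) = 0"
proof (cases b)
  case (Sym m \<alpha>)
  let ?D = "diff (cellular :: ('n, 'k, _) based_complex)"
  let ?x = "symdiff b :: _ \<Rightarrow>\<^sub>0 ('n, 'k) mpoly"
  have m: "m \<in> edges H" and \<alpha>: "\<alpha> \<subseteq> lset m" using b Sym by (auto simp: all_symbols_def)
  have rs: "relabel symbol_cell (symdiff a) = ?D (symbol_cell a)" if "a \<in> all_symbols" for a
  proof (cases a)
    case Base
    then show ?thesis by (simp add: diff_cellular_None)
  next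
    case (Sym m' \<beta>)
    then have "Sym m' \<beta> \<in> all_symbols" using that by simp
    then show ?thesis unfolding Sym by (intro relabel_symdiff) (auto simp: all_symbols_def)
  qed
  have "relabel symbol_cell (lin symdiff ?x) = lin (\<lambda>a. ?D (symbol_cell a)) ?x"
    unfolding relabel_lin using symdiff_free[OF b] rs by (rule lin_free_cong)
  also have "\<dots> = lin ?D (relabel symbol_cell ?x)" by (simp only: lin_relabel)
  also have "\<dots> = lin ?D (?D (Some (cell m \<alpha>)))" using rs[OF b] by (simp only: Sym symbol_cell_Sym)
  also have "\<dots> = 0"
  proof (cases "cell_dim (cell m \<alpha>) = 0")
    case True
    then show ?thesis by (simp add: diff_cellular_vertex diff_cellular_None)
  next
    case False
    then show ?thesis by (rule cellular_square_zero[OF cell_in_hom_cells[OF m \<alpha>]])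
  qed
  finally have "relabel symbol_cell (lin symdiff ?x) = relabel symbol_cell 0" by simp
  moreover have "lin symdiff ?x \<in> free all_symbols"
    using symdiff_free[OF b] symdiff_free by (rule lin_free)
  ultimately show ?thesis using relabel_inj[OF inj_symbol_cell] free_zero by blast
qed simp

lemma cone_lift_chain_map:
  assumes m: "m \<in> edges H"
  defines "E \<equiv> {e \<in> edges H. slist e < slist m}"
  shows "chain_map (shift (mon m) (koszul (lset m))) (symcomplex E :: ('n, 'k::field, _) based_complex) (cone_lift m)"
  unfolding chain_map_def
proof (intro allI ballI conjI)
  fix i \<alpha> assume "\<alpha> \<in> basis (shift (mon m) (koszul (lset m) :: ('n, 'k, _) based_complex)) i"
  then have \<alpha>: "\<alpha> \<subseteq> lset m" "card \<alpha> = i" by (simp_all add: basis_koszul)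
  let ?p = "cone_lift m :: 'n set \<Rightarrow> 'n symbol \<Rightarrow>\<^sub>0 ('n, 'k) mpoly"
  let ?K = "koszul UNIV :: ('n, 'k, _) based_complex"
  show "?p \<alpha> \<in> free (basis (symcomplex E :: ('n, 'k, _) based_complex) i)"
    using cone_lift_free[OF m \<alpha>(1)] \<alpha>(2) by (simp add: E_def)
  show "homogeneous (mdeg (symcomplex E :: ('n, 'k, _) based_complex))
     (mdeg (shift (mon m) (koszul (lset m) :: ('n, 'k, _) based_complex)) \<alpha>) (?p \<alpha>)"
  proof (cases "\<alpha> = {}")
    case True
    then show ?thesis by (auto simp: cone_lift_def mdeg_koszul intro!: homogeneous_single)
  next
    case False
    show ?thesis unfolding cone_lift_eq[OF m \<alpha>(1) False]
    proof (intro homogeneous_sum homogeneous_single)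
      fix j s assume j: "j \<in> tset m \<alpha>"
        and s: "s \<in> Poly_Mapping.keys ((-1) ^ card {k \<in> \<alpha>. k < j} * var (nxt m j) :: ('n, 'k) mpoly)"
      have ja: "j \<in> \<alpha>" using j tset_subset by blast
      have "s = mon {nxt m j}" using s by (simp add: var_eq keys_sign_monomial)
      then have "s + (mon (cfun j m) + mon (\<alpha> - {j})) = (mon {nxt m j} + mon (cfun j m)) + mon (\<alpha> - {j})"
        by (simp only: add.assoc)
      also have "\<dots> = mon m + (mon {j} + mon (\<alpha> - {j}))"
        unfolding cfun_degree(1)[OF m subsetD[OF \<alpha>(1) ja], symmetric] by (simp only: add_ac)
      also have "mon {j} + mon (\<alpha> - {j}) = mon \<alpha>" using mon_remove[OF finite ja] by simp
      finally show "s + mdeg (symcomplex E :: ('n, 'k, _) based_complex) (Sym (cfun j m) (\<alpha> - {j})) =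
          mdeg (shift (mon m) (koszul (lset m) :: ('n, 'k, _) based_complex)) \<alpha>"
        by (simp add: mdeg_koszul)
    qed
  qed
  \<comment> \<open>The square of the differential at (m;\<alpha>) consists of a doubled Koszul
    part, which is 0, and of d(\<psi> \<alpha>) - \<psi>(d \<alpha>).\<close>
  have "0 = lin symdiff (symdiff (Sym m \<alpha>) :: _ \<Rightarrow>\<^sub>0 ('n, 'k) mpoly)"
    using m \<alpha>(1) by (intro symdiff_square_zero[symmetric]) (simp add: all_symbols_def)
  also have "\<dots> = - lin (\<lambda>\<beta>. symdiff (Sym m \<beta>)) (diff ?K \<alpha>) + lin symdiff (?p \<alpha>)"
    by (simp only: symdiff.simps(2)[of m \<alpha>] lin_add lin_uminus lin_relabel)
  also have "lin (\<lambda>\<beta>. symdiff (Sym m \<beta>)) (diff ?K \<alpha>) = - relabel (Sym m) (lin (diff ?K) (diff ?K \<alpha>)) + lin ?p (diff ?K \<alpha>)"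
    unfolding symdiff.simps relabel_lin lin_uminus_fun[symmetric] lin_add_fun ..
  finally have "lin ?p (diff ?K \<alpha>) = lin symdiff (?p \<alpha>)"
    by (simp add: koszul_square_zero)
  then show "lin ?p (diff (shift (mon m) (koszul (lset m))) \<alpha>) = lin (diff (symcomplex E)) (?p \<alpha>)"
    by (simp add: koszul_def)
qed

text \<open>As m is not in E, the new symbols do not collide with those of the earlier stage, and
  \<open>symdiff\<close> at a symbol of m was defined in the shape of the cone differential.\<close>

lemma cone_iso:
  assumes m: "m \<in> edges H" and E: "m \<notin> E"
  shows "based_iso (case_sum (Sym m) id)
    (mapping_cone (shift (mon m) (koszul (lset m))) (symcomplex E) (cone_lift m))
    (symcomplex (insert m E) :: ('n, 'k::field, _) based_complex)"
    (is "based_iso ?f ?C ?F")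
  unfolding based_iso_def
proof (intro allI conjI ballI)
  fix i
  show "bij_betw ?f (basis ?C i) (basis ?F i)"
  proof (cases i)
    case 0
    then show ?thesis by (simp add: basis_mapping_cone symbols_0 bij_betw_def)
  next
    case (Suc p)
    have C: "basis ?C i = Inl ` {\<alpha>. \<alpha> \<subseteq> lset m \<and> card \<alpha> = p} \<union> Inr ` symbols E i"
      unfolding Suc basis_mapping_cone shift_simps basis_koszul symcomplex_simps ..
    have no: "Sym m \<alpha> \<noteq> b" if "b \<in> symbols E i" for \<alpha> b using E that by auto
    have "inj_on ?f (basis ?C i)"
      unfolding C inj_on_Un
    proof (intro conjI)
      show "inj_on ?f (Inl ` {\<alpha>. \<alpha> \<subseteq> lset m \<and> card \<alpha> = p})"
        by (rule inj_onI, elim imageE) simp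
      show "inj_on ?f (Inr ` symbols E i)" by (rule inj_onI, elim imageE) simp
      have "?f x \<noteq> ?f y" if x: "x \<in> Inl ` {\<alpha>. \<alpha> \<subseteq> lset m \<and> card \<alpha> = p}" and y: "y \<in> Inr ` symbols E i" for x y
        using x y no by (elim imageE) simp
      then show "?f ` (Inl ` {\<alpha>. \<alpha> \<subseteq> lset m \<and> card \<alpha> = p} - Inr ` symbols E i) \<inter>
          ?f ` (Inr ` symbols E i - Inl ` {\<alpha>. \<alpha> \<subseteq> lset m \<and> card \<alpha> = p}) = {}" by blast
    qed
    moreover have "?f ` basis ?C i = Sym m ` {\<alpha>. \<alpha> \<subseteq> lset m \<and> card \<alpha> = p} \<union> symbols E i"
      unfolding C by (simp add: image_Un image_image)
    moreover have "\<dots> = basis ?F i" unfolding Suc symcomplex_simps symbols_def by auto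
    ultimately show ?thesis by (simp add: bij_betw_def)
  qed
  fix b assume b: "b \<in> basis ?C i"
  show "mdeg ?F (?f b) = mdeg ?C b"
    by (cases b) (simp_all add: mdeg_mapping_cone mdeg_koszul)
  show "diff ?F (?f b) = relabel ?f (diff ?C b)"
  proof (cases b)
    case (Inl \<alpha>)
    have "diff (koszul (lset m) :: ('n, 'k, _) based_complex) = diff (koszul UNIV)" by (simp add: koszul_def)
    then show ?thesis
      unfolding Inl sum.case diff_mapping_cone shift_simps symcomplex_simps relabel_add relabel_simps relabel_relabel symdiff.simps
      by (simp only: id_apply relabel_ident)
  next
    case (Inr a)
    show ?thesis
      unfolding Inr sum.case diff_mapping_cone symcomplex_simps relabel_relabel
      by (simp only: id_apply relabel_ident)
  qed
qed

section \<open>The stages along the list of generators and the identification with X_H\<close>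

definition cone_complex :: "nat \<Rightarrow> ('n, 'k::field, 'n symbol) based_complex" where
  "cone_complex j = symcomplex (set (take j (gens H)))"

lemma cone_complex_step:
  assumes j: "j < length (gens H)"
  defines "m \<equiv> gens H ! j"
  shows "chain_map (shift (mon m) (koszul (lset m))) (cone_complex j :: ('n, 'k::field, _) based_complex) (cone_lift m)"
    "lifts_mult {} Base (ideal_upto (gens H) j :: ('n, 'k) mpoly set) (monomial (mon m)) (cone_lift m)"
    "based_iso (case_sum (Sym m) id)
       (mapping_cone (shift (mon m) (koszul (lset m))) (cone_complex j) (cone_lift m)) (cone_complex (Suc j) :: ('n, 'k, _) based_complex)"
    "resolves {} (colon (ideal_upto (gens H) j) (monomial (mon m))) (koszul (lset m) :: ('n, 'k, _) based_complex)"
proof -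
  have m: "m \<in> edges H" unfolding m_def using j by (rule gens_nth)
  show "chain_map (shift (mon m) (koszul (lset m))) (cone_complex j :: ('n, 'k, _) based_complex) (cone_lift m)"
    unfolding cone_complex_def set_take_gens[OF j] using cone_lift_chain_map[OF m] by (simp only: m_def)
  show "lifts_mult {} Base (ideal_upto (gens H) j :: ('n, 'k) mpoly set) (monomial (mon m)) (cone_lift m)"
    unfolding lifts_mult_def
  proof
    fix g :: "'n set \<Rightarrow>\<^sub>0 ('n, 'k) mpoly" assume "g \<in> free {{}}"
    then obtain r where "g = Poly_Mapping.single {} r" by (rule free_singletonE)
    \<comment> \<open>The lift is multiplication by m on the nose, so the difference is 0 and not
      merely an element of the ideal.\<close>
    then show "lkp (lin (cone_lift m) g) Base - monomial (mon m) * lkp g {} \<in> ideal_upto (gens H) j"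
      by (simp add: cone_lift_def mult.commute ideal_upto_def)
  qed
  have "m \<notin> set (take j (gens H))" unfolding set_take_gens[OF j] m_def by simp
  then show "based_iso (case_sum (Sym m) id)
       (mapping_cone (shift (mon m) (koszul (lset m))) (cone_complex j) (cone_lift m)) (cone_complex (Suc j) :: ('n, 'k, _) based_complex)"
    using cone_iso[OF m] j unfolding cone_complex_def by (simp add: take_Suc_conv_app_nth m_def)
  show "resolves {} (colon (ideal_upto (gens H) j) (monomial (mon m))) (koszul (lset m) :: ('n, 'k, _) based_complex)"
    using koszul_resolves colon_ideal_upto[OF j] unfolding m_def by metis
qed

lemma basis_cone_complex_0: "basis (cone_complex 0 :: ('n, 'k::field, _) based_complex) i = (if i = 0 then {Base} else {})"
  by (simp add: cone_complex_def symbols_def)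

lemma cone_complex_resolves:
  "j \<le> length (gens H) \<Longrightarrow> resolves Base (ideal_upto (gens H) j) (cone_complex j :: ('n, 'k::field, _) based_complex)"
proof (induction j)
  case 0
  show ?case
    using basis_cone_complex_0 by (simp add: resolves_def graded_complex_def ideal_upto_def) (auto simp: cone_complex_def)
next
  case (Suc j)
  then have j: "j < length (gens H)" and F: "resolves Base (ideal_upto (gens H) j) (cone_complex j :: ('n, 'k, _) based_complex)"
    by simp_all
  let ?m = "gens H ! j"
  note st = cone_complex_step[OF j]
  have "ideal_gen (insert (monomial (mon ?m)) ((\<lambda>m. monomial (mon m)) ` set (take j (gens H)))) =
      (ideal_upto (gens H) (Suc j) :: ('n, 'k) mpoly set)"
    using j by (simp add: ideal_upto_def take_Suc_conv_app_nth)
  with mapping_cone_resolves[OF st(4)[unfolded ideal_upto_def] F[unfolded ideal_upto_def] st(1) st(2)[unfolded ideal_upto_def]]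
  have "resolves (Inr Base) (ideal_upto (gens H) (Suc j))
    (mapping_cone (shift (mon ?m) (koszul (lset ?m))) (cone_complex j) (cone_lift ?m) :: ('n, 'k, _) based_complex)"
    by simp
  from based_iso_resolves[OF st(3) this] show ?case by simp
qed

text \<open>Bijectivity on bases combines the injectivity of \<open>symbol_cell\<close> with
  \<open>hom_cell_eq_cell\<close>. Through this isomorphism the cellular complex inherits exactness
  from the last cone.\<close>

lemma cellular_iso: "based_iso symbol_cell (cone_complex (length (gens H))) (cellular :: ('n, 'k::field, _) based_complex)"
  (is "based_iso _ ?F ?C")
  unfolding based_iso_def
proof (intro allI conjI ballI)
  have B: "basis ?F = symbols (edges H)" by (simp add: cone_complex_def set_gens)
  fix i
  show "bij_betw symbol_cell (basis ?F i) (basis ?C i)"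
  proof (cases i)
    case 0
    then show ?thesis by (simp add: B symbols_0 cellular_complex_def bij_betw_def)
  next
    case (Suc p)
    have "inj_on symbol_cell (basis ?F i)"
      using inj_on_subset[OF inj_symbol_cell symbols_subset] B by simp
    moreover have "symbol_cell ` basis ?F i = Some ` {c \<in> hom_cells d H. cell_dim c = p}"
    proof (intro equalityI subsetI)
      fix x assume "x \<in> symbol_cell ` basis ?F i"
      then obtain m \<alpha> where m: "m \<in> edges H" "\<alpha> \<subseteq> lset m" "card \<alpha> = p" "x = symbol_cell (Sym m \<alpha>)"
        unfolding B Suc symbols_def by auto
      then show "x \<in> Some ` {c \<in> hom_cells d H. cell_dim c = p}"
        unfolding symbol_cell_Sym using cell_in_hom_cells[OF m(1,2)] cell_dim_cell[OF m(1,2)] by blast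
    next
      fix x assume "x \<in> Some ` {c \<in> hom_cells d H. cell_dim c = p}"
      then obtain c where c: "c \<in> hom_cells d H" "cell_dim c = p" "x = Some c" by blast
      note e = hom_cell_eq_cell[OF c(1)]
      have "x = symbol_cell (Sym (set (map Max c)) (rest c))" unfolding symbol_cell_Sym e(4) c(3) ..
      moreover have "card (rest c) = p" using cell_dim_cell[OF e(1,3)] c(2) e(4) by simp
      then have "Sym (set (map Max c)) (rest c) \<in> basis ?F i"
        unfolding B Suc Sym_in_symbols using e(1,3) by simp
      ultimately show "x \<in> symbol_cell ` basis ?F i" by (rule image_eqI)
    qed
    ultimately show ?thesis by (simp add: Suc cellular_complex_def bij_betw_def)
  qed
  fix b assume "b \<in> basis ?F i"
  then have b: "b \<in> all_symbols" unfolding B using symbols_subset by blast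
  have "mdeg ?C (symbol_cell b) = mdeg ?F b \<and> diff ?C (symbol_cell b) = relabel symbol_cell (diff ?F b)"
  proof (cases b)
    case Base
    then show ?thesis by (simp add: cone_complex_def diff_cellular_None) (simp add: cellular_complex_def)
  next
    case (Sym m \<alpha>)
    then have m: "m \<in> edges H" "\<alpha> \<subseteq> lset m" using b by (auto simp: all_symbols_def)
    have "mdeg ?C (Some (cell m \<alpha>)) = mon m + mon \<alpha>"
      using cell_label_cell[OF m] by (simp add: cellular_complex_def)
    then show ?thesis
      unfolding Sym using relabel_symdiff[OF m, where 'k = 'k] by (simp add: cone_complex_def symbol_cell_Sym del: symbol_cell.simps(2) symdiff.simps)
  qed
  then show "mdeg ?C (symbol_cell b) = mdeg ?F b" "diff ?C (symbol_cell b) = relabel symbol_cell (diff ?F b)"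
    by auto
qed

lemma ideal_upto_gens: "ideal_upto (gens H) (length (gens H)) = (edge_ideal H :: ('n, 'k::field) mpoly set)"
  by (simp add: ideal_upto_def edge_ideal_def set_gens)

lemma cellular_resolves: "resolves None (edge_ideal H) (cellular :: ('n, 'k::field, _) based_complex)"
  using based_iso_resolves[OF cellular_iso cone_complex_resolves[OF order_refl]] by (simp add: ideal_upto_gens)

text \<open>In positive dimension every coefficient is a sum of signed variables. At a vertex it is
  the monomial of an edge, from which a variable splits off because d is positive.\<close>

lemma cellular_minimal: "minimal_complex (cellular :: ('n, 'k::field, _) based_complex)"
  unfolding minimal_complex_def
proof (intro allI ballI)
  fix i b b' assume b: "b \<in> basis (cellular :: ('n, 'k, _) based_complex) i"
  let ?M = "ideal_gen (range var) :: ('n, 'k) mpoly set"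
  have v: "var j \<in> ?M" for j by (rule ideal_gen_base) simp
  show "lkp (diff (cellular :: ('n, 'k, _) based_complex) b) b' \<in> ?M"
  proof (cases b)
    case None
    then show ?thesis by (simp add: diff_cellular_None)
  next
    case (Some c)
    then have c: "c \<in> hom_cells d H" using b by (cases i) (auto simp: cellular_complex_def)
    show ?thesis
    proof (cases "cell_dim c = 0")
      case True
      note e = hom_cell_eq_cell[OF c]
      obtain j where j: "j \<in> set (map Max c)" using edge_nonempty[OF e(1)] by (meson all_not_in_conv)
      have "cell_label c = mon {j} + (mon (set (map Max c) - {j}) + mon (rest c))"
        using cell_label_cell[OF e(1,3)] e(4) mon_remove[OF finite j] by (simp only: add.assoc)
      then have "monomial (cell_label c) = monomial (mon (set (map Max c) - {j}) + mon (rest c)) * (var j :: ('n, 'k) mpoly)"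
        by (simp add: var_eq monomial_mult add.commute)
      then have "monomial (cell_label c) \<in> ?M" using ideal_gen_mult[OF v] by simp
      then show ?thesis
        using True by (simp add: Some diff_cellular_vertex lookup_single when_def)
    next
      case False
      have "lkp (Poly_Mapping.single a (r * var w)) b' \<in> ?M" for a r w
        using ideal_gen_mult[OF v] by (simp add: lookup_single when_def)
      then show ?thesis
        unfolding Some diff_cellular[OF c False] lookup_sum case_prod_beta by (intro ideal_gen_sum)
    qed
  qed
qed

text \<open>The element at position i has i elements of \<alpha> at or below it and i - 1 strictly
  below. So the negated Koszul sign is (-1)^i, while the lift carries (-1)^(i-1).\<close>

lemma symdiff_formula:
  assumes m: "m \<in> edges H" and \<alpha>: "\<alpha> \<subseteq> lset m"
  shows "symdiff (Sym m \<alpha>) =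
          (if \<alpha> = {} then Poly_Mapping.single Base (monomial (mon m))
           else (\<Sum>i\<in>{1..card \<alpha>}.
                   Poly_Mapping.single (Sym m (\<alpha> - {elt \<alpha> i})) ((-1) ^ i * var (elt \<alpha> i))) +
                (\<Sum>i\<in>{i \<in> {1..card \<alpha>}. elt \<alpha> i \<in> Tset (edge_ideal H :: ('n, 'k::field) mpoly set) m \<alpha>}.
                   Poly_Mapping.single (Sym (cfun (elt \<alpha> i) m) (\<alpha> - {elt \<alpha> i}))
                     ((-1) ^ (i - 1) *
                      monomial (mon {elt \<alpha> i} + mon m - mon (cfun (elt \<alpha> i) m)) :: ('n, 'k) mpoly)))"
proof (cases "\<alpha> = {}")
  case True
  then show ?thesis by (simp add: diff_koszul cone_lift_def)
next
  case False
  have "(\<Sum>i = 1..card \<alpha>. Poly_Mapping.single (Sym m (\<alpha> - {elt \<alpha> i})) ((-1) ^ i * var (elt \<alpha> i))) =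
      (\<Sum>j\<in>\<alpha>. Poly_Mapping.single (Sym m (\<alpha> - {j})) ((-1) ^ card {k \<in> \<alpha>. k \<le> j} * (var j :: ('n, 'k) mpoly)))"
    by (rule sum_elt_all[OF finite])
  also have "\<dots> = - relabel (Sym m) (diff (koszul UNIV) \<alpha>)"
    by (simp add: diff_koszul relabel_sum card_le_eq_Suc_card_less single_uminus sum_negf)
  finally have 1: "(\<Sum>i = 1..card \<alpha>. Poly_Mapping.single (Sym m (\<alpha> - {elt \<alpha> i})) ((-1) ^ i * var (elt \<alpha> i))) =
      - relabel (Sym m) (diff (koszul UNIV :: ('n, 'k, _) based_complex) \<alpha>)" .
  have "(\<Sum>i\<in>{i \<in> {1..card \<alpha>}. elt \<alpha> i \<in> tset m \<alpha>}. Poly_Mapping.single (Sym (cfun (elt \<alpha> i) m) (\<alpha> - {elt \<alpha> i}))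
        ((-1) ^ (i - 1) * monomial (mon {elt \<alpha> i} + mon m - mon (cfun (elt \<alpha> i) m)) :: ('n, 'k) mpoly)) =
      (\<Sum>j\<in>{j \<in> \<alpha>. j \<in> tset m \<alpha>}. Poly_Mapping.single (Sym (cfun j m) (\<alpha> - {j}))
        ((-1) ^ (card {k \<in> \<alpha>. k \<le> j} - 1) * monomial (mon {j} + mon m - mon (cfun j m))))"
    by (rule sum_elt[OF finite])
  also have "\<dots> = cone_lift m \<alpha>"
    using False by (auto simp: cone_lift_def tset_iff card_le_eq_Suc_card_less intro!: sum.cong)
  finally show ?thesis using False 1 by (simp add: Tset_eq[OF m \<alpha>])
qed

end

theorem theorem4p13:
  fixes H :: "'n::{finite,linorder} hypergraph" and d :: nat
  assumes "d \<ge> 1" and "d_graph d H" and "verts H = UNIV" and "cointerval d H"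
  defines "I \<equiv> (edge_ideal H :: ('n, 'k::field) mpoly set)"
  defines "ms \<equiv> gens H"
  defines "S \<equiv> (\<lambda>j. lin_set (ideal_upto ms j :: ('n, 'k) mpoly set) (ms ! j))"
  shows "\<exists>(\<epsilon> :: 'n set list \<Rightarrow> int)
          (Fs :: nat \<Rightarrow> ('n, 'k, 'n symbol) based_complex)
          (\<psi> :: nat \<Rightarrow> 'n set \<Rightarrow> ('n symbol \<Rightarrow>\<^sub>0 ('n, 'k) mpoly)).
     (\<forall>c. \<epsilon> c \<in> {1, -1}) \<and>
     resolves None I (cellular_complex d H \<epsilon>) \<and>
     minimal_complex (cellular_complex d H \<epsilon> :: ('n, 'k, _) based_complex) \<and>
     iterated_mapping_cone ms Fs \<psi> \<and>
     based_iso symbol_cell (Fs (length ms)) (cellular_complex d H \<epsilon>) \<and>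
     (\<forall>i\<ge>1. basis (Fs (length ms)) i =
        {Sym (ms ! j) \<alpha> | j \<alpha>. j < length ms \<and> \<alpha> \<subseteq> S j \<and> card \<alpha> = i - 1}) \<and>
     (\<forall>j<length ms. \<forall>\<alpha>\<subseteq>S j. let m = ms ! j in
        diff (Fs (length ms)) (Sym m \<alpha>) =
          (if \<alpha> = {} then Poly_Mapping.single Base (monomial (mon m))
           else (\<Sum>i\<in>{1..card \<alpha>}.
                   Poly_Mapping.single (Sym m (\<alpha> - {elt \<alpha> i})) ((-1) ^ i * var (elt \<alpha> i))) +
                (\<Sum>i\<in>{i \<in> {1..card \<alpha>}. elt \<alpha> i \<in> Tset I m \<alpha>}.
                   Poly_Mapping.single (Sym (cfun (elt \<alpha> i) m) (\<alpha> - {elt \<alpha> i}))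
                     ((-1) ^ (i - 1) *
                      monomial (mon {elt \<alpha> i} + mon m - mon (cfun (elt \<alpha> i) m))))))"
proof -
  interpret cointerval_hypergraph H d using assms(1-4) by unfold_locales
  \<comment> \<open>At positions of actual generators the ideal-theoretic set(m) is replaced by its
    combinatorial form.\<close>
  have S: "S j = lset (ms ! j)" if "j < length ms" for j
    using lin_set_ideal_upto[of j] that by (simp add: S_def ms_def)
  have len: "cone_complex (length ms) = (symcomplex (edges H) :: ('n, 'k, _) based_complex)"
    by (simp add: cone_complex_def ms_def set_gens)
  show ?thesis
  proof (rule exI[of _ orient], rule exI[of _ cone_complex], rule exI[of _ "\<lambda>j. cone_lift (ms ! j)"], intro conjI)
    show "\<forall>c. orient c \<in> {1, -1}"
      by (simp add: orient_def minus_one_power_iff)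
    show "resolves None I cellular" unfolding I_def by (rule cellular_resolves)
    show "minimal_complex (cellular :: ('n, 'k, _) based_complex)" by (rule cellular_minimal)
    show "based_iso symbol_cell (cone_complex (length ms)) (cellular :: ('n, 'k, _) based_complex)"
      unfolding ms_def by (rule cellular_iso)
    show "iterated_mapping_cone ms (cone_complex :: nat \<Rightarrow> ('n, 'k, _) based_complex) (\<lambda>j. cone_lift (ms ! j))"
      unfolding iterated_mapping_cone_def Let_def
    proof (intro conjI allI impI)
      fix j assume j: "j < length ms"
      note st = cone_complex_step[OF j[unfolded ms_def], where 'k = 'k, folded ms_def]
      have "lset (ms ! j) = lin_set (ideal_upto ms j :: ('n, 'k) mpoly set) (ms ! j)"
        using S[OF j] by (simp add: S_def)
      note st' = st[unfolded this]
      show "resolves {} (colon (ideal_upto ms j) (monomial (mon (ms ! j))))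
          (koszul (lin_set (ideal_upto ms j :: ('n, 'k) mpoly set) (ms ! j)) :: ('n, 'k, _) based_complex)"
        by (rule st'(4))
      show "chain_map (shift (mon (ms ! j)) (koszul (lin_set (ideal_upto ms j :: ('n, 'k) mpoly set) (ms ! j))))
          (cone_complex j :: ('n, 'k, _) based_complex) (cone_lift (ms ! j))"
        by (rule st'(1))
      show "lifts_mult {} Base (ideal_upto ms j :: ('n, 'k) mpoly set) (monomial (mon (ms ! j))) (cone_lift (ms ! j))"
        by (rule st'(2))
      show "based_iso (case_sum (Sym (ms ! j)) id)
          (mapping_cone (shift (mon (ms ! j)) (koszul (lin_set (ideal_upto ms j :: ('n, 'k) mpoly set) (ms ! j))))
            (cone_complex j) (cone_lift (ms ! j))) (cone_complex (Suc j) :: ('n, 'k, _) based_complex)"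
        by (rule st'(3))
    next
      fix i show "basis (cone_complex 0 :: ('n, 'k, _) based_complex) i = (if i = 0 then {Base} else {})"
        by (rule basis_cone_complex_0)
    next
      fix j assume "j \<le> length ms"
      then show "resolves Base (ideal_upto ms j) (cone_complex j :: ('n, 'k, _) based_complex)"
        unfolding ms_def by (rule cone_complex_resolves)
    qed
    show "\<forall>i\<ge>1. basis (cone_complex (length ms) :: ('n, 'k, _) based_complex) i =
        {Sym (ms ! j) \<alpha> | j \<alpha>. j < length ms \<and> \<alpha> \<subseteq> S j \<and> card \<alpha> = i - 1}"
    proof (intro allI impI)
      fix i :: nat assume i: "1 \<le> i"
      have E: "m \<in> edges H \<longleftrightarrow> (\<exists>j<length ms. m = ms ! j)" for m
        unfolding set_gens[symmetric] ms_def in_set_conv_nth by blast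
      have "basis (cone_complex (length ms) :: ('n, 'k, _) based_complex) i =
          {Sym m \<alpha> | m \<alpha>. m \<in> edges H \<and> \<alpha> \<subseteq> lset m \<and> card \<alpha> = i - 1}"
        unfolding len using i by (auto simp: symbols_def)
      also have "\<dots> = {Sym (ms ! j) \<alpha> | j \<alpha>. j < length ms \<and> \<alpha> \<subseteq> S j \<and> card \<alpha> = i - 1}"
        unfolding E using S by auto metis
      finally show "basis (cone_complex (length ms) :: ('n, 'k, _) based_complex) i =
          {Sym (ms ! j) \<alpha> | j \<alpha>. j < length ms \<and> \<alpha> \<subseteq> S j \<and> card \<alpha> = i - 1}" .
    qed
    show "\<forall>j<length ms. \<forall>\<alpha>\<subseteq>S j. let m = ms ! j in
        diff (cone_complex (length ms) :: ('n, 'k, _) based_complex) (Sym m \<alpha>) =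
          (if \<alpha> = {} then Poly_Mapping.single Base (monomial (mon m))
           else (\<Sum>i\<in>{1..card \<alpha>}.
                   Poly_Mapping.single (Sym m (\<alpha> - {elt \<alpha> i})) ((-1) ^ i * var (elt \<alpha> i))) +
                (\<Sum>i\<in>{i \<in> {1..card \<alpha>}. elt \<alpha> i \<in> Tset I m \<alpha>}.
                   Poly_Mapping.single (Sym (cfun (elt \<alpha> i) m) (\<alpha> - {elt \<alpha> i}))
                     ((-1) ^ (i - 1) *
                      monomial (mon {elt \<alpha> i} + mon m - mon (cfun (elt \<alpha> i) m)))))"
    proof (intro allI impI)
      fix j \<alpha> assume j: "j < length ms" and \<alpha>: "\<alpha> \<subseteq> S j"
      have "ms ! j \<in> edges H" using gens_nth j by (simp add: ms_def)
      moreover have "\<alpha> \<subseteq> lset (ms ! j)" using \<alpha> S[OF j] by simp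
      ultimately show "let m = ms ! j in
        diff (cone_complex (length ms) :: ('n, 'k, _) based_complex) (Sym m \<alpha>) =
          (if \<alpha> = {} then Poly_Mapping.single Base (monomial (mon m))
           else (\<Sum>i\<in>{1..card \<alpha>}.
                   Poly_Mapping.single (Sym m (\<alpha> - {elt \<alpha> i})) ((-1) ^ i * var (elt \<alpha> i))) +
                (\<Sum>i\<in>{i \<in> {1..card \<alpha>}. elt \<alpha> i \<in> Tset I m \<alpha>}.
                   Poly_Mapping.single (Sym (cfun (elt \<alpha> i) m) (\<alpha> - {elt \<alpha> i}))
                     ((-1) ^ (i - 1) *
                      monomial (mon {elt \<alpha> i} + mon m - mon (cfun (elt \<alpha> i) m)))))"
        unfolding Let_def len symcomplex_simps I_def by (rule symdiff_formula)
    qed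
  qed
qed

end
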